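(* Let $\mathcal{A}$ be an abelian category and suppose given short exact sequences in $\mathcal{A}$ $$0\to P\to E\to R\to 0,\quad 0\to P\to H\to S\to 0,\quad 0\to R\to F\to Q\to 0,\quad 0\to S\to G\to Q\to 0 .$$ Let $Y=F\times_Q G$, and let $\mathcal{S}\subseteq \mathrm{Ext}^1(Y,P)$ be the set of classes $[X]$ of the extensions $0\to P\to X\to Y\to 0$ associated with completions $X$ of these four sequences to a $3\times 3$ diagram (as defined in the context). Assume $\mathcal{S}$ is nonempty. Then $\mathcal{S}$ is a principal homogeneous space under the abelian group $$\frac{\mathrm{Ext}^1(Q,P)}{\mathrm{Im}(\delta_F+\delta_G)},$$ where the class $\overline{\lambda}$ of $\lambda\in \mathrm{Ext}^1(Q,P)$ acts on $\mathcal{S}$ by $\overline{\lambda}\cdot[X]:=\beta(\lambda)+[X]$. In particular, if $\alpha:\mathrm{Hom}(R\oplus S,P)\to \mathrm{Ext}^1(Q,P)$ is surjective, then there is a unique completion up to isomorphism, i.e. $\mathcal{S}$ consists of exactly one class.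
   Context: $\mathrm{Ext}^n$ denotes the Yoneda Ext groups of $\mathcal{A}$. Completion: an object $X$ with morphisms $E\to X$, $H\to X$, $X\to F$, $X\to G$ such that the $3\times 3$ diagram with rows $0\to P\to E\to R\to 0$, $0\to H\to X\to F\to 0$, $0\to S\to G\to Q\to 0$ and columns $0\to P\to H\to S\to 0$, $0\to E\to X\to G\to 0$, $0\to R\to F\to Q\to 0$ is commutative with all rows and columns exact (the outer rows and columns being the given sequences). $Y=F\times_Q G$ is the pullback of $F\to Q$ and $G\to Q$. For a completion $X$, the maps $X\to F$ and $X\to G$ induce $X\to Y$, and together with the composite $P\to E\to X$ (equal to $P\to H\to X$) this gives a short exact sequence $0\to P\to X\to Y\to 0$, whose class is denoted $[X]\in \mathrm{Ext}^1(Y,P)$. The morphisms $R\to Y$ (given by $R\to F$ and $0:R\to G$) and $S\to Y$ (given by $0:S\to F$ and $S\to G$) induce a short exact sequence $0\to R\oplus S\to Y\to Q\to 0$. Applying $\mathrm{Hom}(-,P)$ gives the long exact sequence $$\cdots\to \mathrm{Hom}(R\oplus S,P)\xrightarrow{\alpha}\mathrm{Ext}^1(Q,P)\xrightarrow{\beta}\mathrm{Ext}^1(Y,P)\xrightarrow{\gamma}\mathrm{Ext}^1(R\oplus S,P)\xrightarrow{\delta_Y}\mathrm{Ext}^2(Q,P),$$ in which $\alpha(\phi)$ is the class of the pushout of $0\to R\oplus S\to Y\to Q\to 0$ along $\phi$, and $\beta$ is pullback along $Y\to Q$. $\delta_F:\mathrm{Hom}(R,P)\to \mathrm{Ext}^1(Q,P)$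 and $\delta_G:\mathrm{Hom}(S,P)\to \mathrm{Ext}^1(Q,P)$ are the connecting homomorphisms obtained by applying $\mathrm{Hom}(-,P)$ to $0\to R\to F\to Q\to 0$ and $0\to S\to G\to Q\to 0$ respectively (pushout of the extension along the given homomorphism), and $\delta_F+\delta_G:\mathrm{Hom}(R,P)\oplus\mathrm{Hom}(S,P)\to \mathrm{Ext}^1(Q,P)$ is $(f,g)\mapsto \delta_F(f)+\delta_G(g)$. *)

theory Defs
  imports "HOL-Algebra.Group_Action"
begin

section \<open>Abelian categories\<close>

record ('o, 'm) category =
  Obj :: "'o set"
  Arr :: "'m set"
  Dom :: "'m \<Rightarrow> 'o"
  Cod :: "'m \<Rightarrow> 'o"
  Id :: "'o \<Rightarrow> 'm"
  Comp :: "'m \<Rightarrow> 'm \<Rightarrow> 'm"  (infixl "\<cdot>\<index>" 70)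

record ('o, 'm) preadditive_category = "('o, 'm) category" +
  Add :: "'m \<Rightarrow> 'm \<Rightarrow> 'm"  (infixl "\<boxplus>\<index>" 65)
  Zero :: "'o \<Rightarrow> 'o \<Rightarrow> 'm"

definition Hom :: "('o, 'm, 'z) category_scheme \<Rightarrow> 'o \<Rightarrow> 'o \<Rightarrow> 'm set"
  where "Hom C A B = {f \<in> Arr C. Dom C f = A \<and> Cod C f = B}"

text \<open>Composition is only constrained on composable pairs, and \<^term>\<open>g \<cdot>\<^bsub>C\<^esub> f\<close> means
  \<open>f\<close> first, then \<open>g\<close>.\<close>

locale category =
  fixes C :: "('o, 'm, 'z) category_scheme" (structure)
  assumes Dom_in_Obj: "f \<in> Arr C \<Longrightarrow> Dom C f \<in> Obj C"
    and Cod_in_Obj: "f \<in> Arr C \<Longrightarrow> Cod C f \<in> Obj C"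
    and Id_in_Hom: "A \<in> Obj C \<Longrightarrow> Id C A \<in> Hom C A A"
    and Comp_in_Hom: "\<lbrakk>f \<in> Hom C A B; g \<in> Hom C B D\<rbrakk> \<Longrightarrow> g \<cdot> f \<in> Hom C A D"
    and Comp_assoc: "\<lbrakk>f \<in> Hom C A B; g \<in> Hom C B D; h \<in> Hom C D E\<rbrakk>
      \<Longrightarrow> (h \<cdot> g) \<cdot> f = h \<cdot> (g \<cdot> f)"
    and Comp_Id: "f \<in> Hom C A B \<Longrightarrow> f \<cdot> Id C A = f"
    and Id_Comp: "f \<in> Hom C A B \<Longrightarrow> Id C B \<cdot> f = f"

definition Hom_group :: "('o, 'm, 'z) preadditive_category_scheme \<Rightarrow> 'o \<Rightarrow> 'o \<Rightarrow> 'm monoid"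
  where "Hom_group C A B = \<lparr>carrier = Hom C A B, mult = Add C, one = Zero C A B\<rparr>"

locale preadditive_category = category C
  for C :: "('o, 'm, 'z) preadditive_category_scheme" (structure) +
  assumes Hom_comm_group: "\<lbrakk>A \<in> Obj C; B \<in> Obj C\<rbrakk> \<Longrightarrow> comm_group (Hom_group C A B)"
    and Comp_Add_left: "\<lbrakk>f \<in> Hom C A B; g \<in> Hom C B D; g' \<in> Hom C B D\<rbrakk>
      \<Longrightarrow> (g \<boxplus> g') \<cdot> f = (g \<cdot> f) \<boxplus> (g' \<cdot> f)"
    and Comp_Add_right: "\<lbrakk>f \<in> Hom C A B; f' \<in> Hom C A B; g \<in> Hom C B D\<rbrakk>
      \<Longrightarrow> g \<cdot> (f \<boxplus> f') = (g \<cdot> f) \<boxplus> (g \<cdot> f')"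

definition is_zero_object :: "('o, 'm, 'z) category_scheme \<Rightarrow> 'o \<Rightarrow> bool"
  where "is_zero_object C Z \<longleftrightarrow> Z \<in> Obj C \<and>
    (\<forall>A\<in>Obj C. (\<exists>!f. f \<in> Hom C A Z) \<and> (\<exists>!f. f \<in> Hom C Z A))"

definition is_iso :: "('o, 'm, 'z) category_scheme \<Rightarrow> 'm \<Rightarrow> bool"
  where "is_iso C f \<longleftrightarrow> f \<in> Arr C \<and>
    (\<exists>g \<in> Hom C (Cod C f) (Dom C f).
      g \<cdot>\<^bsub>C\<^esub> f = Id C (Dom C f) \<and> f \<cdot>\<^bsub>C\<^esub> g = Id C (Cod C f))"

definition is_mono :: "('o, 'm, 'z) category_scheme \<Rightarrow> 'm \<Rightarrow> bool"
  where "is_mono C f \<longleftrightarrow> f \<in> Arr C \<and>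
    (\<forall>A. \<forall>g \<in> Hom C A (Dom C f). \<forall>h \<in> Hom C A (Dom C f).
      f \<cdot>\<^bsub>C\<^esub> g = f \<cdot>\<^bsub>C\<^esub> h \<longrightarrow> g = h)"

definition is_epi :: "('o, 'm, 'z) category_scheme \<Rightarrow> 'm \<Rightarrow> bool"
  where "is_epi C f \<longleftrightarrow> f \<in> Arr C \<and>
    (\<forall>B. \<forall>g \<in> Hom C (Cod C f) B. \<forall>h \<in> Hom C (Cod C f) B.
      g \<cdot>\<^bsub>C\<^esub> f = h \<cdot>\<^bsub>C\<^esub> f \<longrightarrow> g = h)"

definition is_kernel :: "('o, 'm, 'z) preadditive_category_scheme \<Rightarrow> 'm \<Rightarrow> 'm \<Rightarrow> bool"
  where "is_kernel C k f \<longleftrightarrow> k \<in> Arr C \<and> f \<in> Arr C \<and> Cod C k = Dom C f \<and>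
    f \<cdot>\<^bsub>C\<^esub> k = Zero C (Dom C k) (Cod C f) \<and>
    (\<forall>A. \<forall>g \<in> Hom C A (Dom C f). f \<cdot>\<^bsub>C\<^esub> g = Zero C A (Cod C f)
      \<longrightarrow> (\<exists>!u. u \<in> Hom C A (Dom C k) \<and> k \<cdot>\<^bsub>C\<^esub> u = g))"

definition is_cokernel :: "('o, 'm, 'z) preadditive_category_scheme \<Rightarrow> 'm \<Rightarrow> 'm \<Rightarrow> bool"
  where "is_cokernel C q f \<longleftrightarrow> q \<in> Arr C \<and> f \<in> Arr C \<and> Dom C q = Cod C f \<and>
    q \<cdot>\<^bsub>C\<^esub> f = Zero C (Dom C f) (Cod C q) \<and>
    (\<forall>B. \<forall>g \<in> Hom C (Cod C f) B. g \<cdot>\<^bsub>C\<^esub> f = Zero C (Dom C f) B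
      \<longrightarrow> (\<exists>!u. u \<in> Hom C (Cod C q) B \<and> u \<cdot>\<^bsub>C\<^esub> q = g))"

definition is_biproduct ::
    "('o, 'm, 'z) preadditive_category_scheme \<Rightarrow> 'o \<Rightarrow> 'o \<Rightarrow> 'o \<times> 'm \<times> 'm \<times> 'm \<times> 'm \<Rightarrow> bool"
  where "is_biproduct C A B = (\<lambda>(D, i1, i2, p1, p2).
    i1 \<in> Hom C A D \<and> i2 \<in> Hom C B D \<and> p1 \<in> Hom C D A \<and> p2 \<in> Hom C D B \<and>
    p1 \<cdot>\<^bsub>C\<^esub> i1 = Id C A \<and> p2 \<cdot>\<^bsub>C\<^esub> i2 = Id C B \<and>
    p1 \<cdot>\<^bsub>C\<^esub> i2 = Zero C B A \<and> p2 \<cdot>\<^bsub>C\<^esub> i1 = Zero C A B \<and>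
    (i1 \<cdot>\<^bsub>C\<^esub> p1) \<boxplus>\<^bsub>C\<^esub> (i2 \<cdot>\<^bsub>C\<^esub> p2) = Id C D)"

locale abelian_category = preadditive_category C
  for C :: "('o, 'm, 'z) preadditive_category_scheme" (structure) +
  assumes zero_object_exists: "\<exists>Z. is_zero_object C Z"
    and biproduct_exists: "\<lbrakk>A \<in> Obj C; B \<in> Obj C\<rbrakk> \<Longrightarrow> \<exists>D. is_biproduct C A B D"
    and kernel_exists: "f \<in> Arr C \<Longrightarrow> \<exists>k. is_kernel C k f"
    and cokernel_exists: "f \<in> Arr C \<Longrightarrow> \<exists>q. is_cokernel C q f"
    and mono_normal: "is_mono C f \<Longrightarrow> \<exists>g. is_kernel C f g"
    and epi_normal: "is_epi C f \<Longrightarrow> \<exists>g. is_cokernel C f g"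


section \<open>Direct sums, pullbacks, pushouts\<close>

definition biproduct ::
    "('o, 'm, 'z) preadditive_category_scheme \<Rightarrow> 'o \<Rightarrow> 'o \<Rightarrow> 'o \<times> 'm \<times> 'm \<times> 'm \<times> 'm"
  where "biproduct C A B = (SOME D. is_biproduct C A B D)"

definition dsum :: "('o, 'm, 'z) preadditive_category_scheme \<Rightarrow> 'o \<Rightarrow> 'o \<Rightarrow> 'o"
  where "dsum C A B = (case biproduct C A B of (D, i1, i2, p1, p2) \<Rightarrow> D)"

definition inj1 :: "('o, 'm, 'z) preadditive_category_scheme \<Rightarrow> 'o \<Rightarrow> 'o \<Rightarrow> 'm"
  where "inj1 C A B = (case biproduct C A B of (D, i1, i2, p1, p2) \<Rightarrow> i1)"

definition inj2 :: "('o, 'm, 'z) preadditive_category_scheme \<Rightarrow> 'o \<Rightarrow> 'o \<Rightarrow> 'm"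
  where "inj2 C A B = (case biproduct C A B of (D, i1, i2, p1, p2) \<Rightarrow> i2)"

definition proj1 :: "('o, 'm, 'z) preadditive_category_scheme \<Rightarrow> 'o \<Rightarrow> 'o \<Rightarrow> 'm"
  where "proj1 C A B = (case biproduct C A B of (D, i1, i2, p1, p2) \<Rightarrow> p1)"

definition proj2 :: "('o, 'm, 'z) preadditive_category_scheme \<Rightarrow> 'o \<Rightarrow> 'o \<Rightarrow> 'm"
  where "proj2 C A B = (case biproduct C A B of (D, i1, i2, p1, p2) \<Rightarrow> p2)"

text \<open>\<open>copair C A B f g\<close> is the map \<open>A \<oplus> B \<rightarrow> D\<close> with components \<open>f : A \<rightarrow> D\<close> and \<open>g : B \<rightarrow> D\<close>;
  \<open>dsum_map C A B A' B' f g\<close> is \<open>f \<oplus> g : A \<oplus> B \<rightarrow> A' \<oplus> B'\<close>.\<close>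

definition copair ::
    "('o, 'm, 'z) preadditive_category_scheme \<Rightarrow> 'o \<Rightarrow> 'o \<Rightarrow> 'm \<Rightarrow> 'm \<Rightarrow> 'm"
  where "copair C A B f g = (f \<cdot>\<^bsub>C\<^esub> proj1 C A B) \<boxplus>\<^bsub>C\<^esub> (g \<cdot>\<^bsub>C\<^esub> proj2 C A B)"

definition dsum_map ::
    "('o, 'm, 'z) preadditive_category_scheme \<Rightarrow> 'o \<Rightarrow> 'o \<Rightarrow> 'o \<Rightarrow> 'o \<Rightarrow> 'm \<Rightarrow> 'm \<Rightarrow> 'm"
  where "dsum_map C A B A' B' f g =
    copair C A B (inj1 C A' B' \<cdot>\<^bsub>C\<^esub> f) (inj2 C A' B' \<cdot>\<^bsub>C\<^esub> g)"

definition diagonal :: "('o, 'm, 'z) preadditive_category_scheme \<Rightarrow> 'o \<Rightarrow> 'm"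
  where "diagonal C A = inj1 C A A \<boxplus>\<^bsub>C\<^esub> inj2 C A A"

definition codiagonal :: "('o, 'm, 'z) preadditive_category_scheme \<Rightarrow> 'o \<Rightarrow> 'm"
  where "codiagonal C A = copair C A A (Id C A) (Id C A)"

text \<open>\<open>is_pullback C f g p q\<close>: the maps \<open>p\<close>, \<open>q\<close> exhibit \<open>Dom p = Dom q\<close> as the fibre product of
  \<open>Dom f\<close> and \<open>Dom g\<close> over \<open>Cod f = Cod g\<close>.  Dually for \<open>is_pushout C f g h k\<close>.\<close>

definition is_pullback :: "('o, 'm, 'z) category_scheme \<Rightarrow> 'm \<Rightarrow> 'm \<Rightarrow> 'm \<Rightarrow> 'm \<Rightarrow> bool"
  where "is_pullback C f g p q \<longleftrightarrow>
    f \<in> Arr C \<and> g \<in> Arr C \<and> Cod C f = Cod C g \<and>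
    p \<in> Hom C (Dom C p) (Dom C f) \<and> q \<in> Hom C (Dom C p) (Dom C g) \<and>
    f \<cdot>\<^bsub>C\<^esub> p = g \<cdot>\<^bsub>C\<^esub> q \<and>
    (\<forall>A. \<forall>a \<in> Hom C A (Dom C f). \<forall>b \<in> Hom C A (Dom C g). f \<cdot>\<^bsub>C\<^esub> a = g \<cdot>\<^bsub>C\<^esub> b
      \<longrightarrow> (\<exists>!u. u \<in> Hom C A (Dom C p) \<and> p \<cdot>\<^bsub>C\<^esub> u = a \<and> q \<cdot>\<^bsub>C\<^esub> u = b))"

definition is_pushout :: "('o, 'm, 'z) category_scheme \<Rightarrow> 'm \<Rightarrow> 'm \<Rightarrow> 'm \<Rightarrow> 'm \<Rightarrow> bool"
  where "is_pushout C f g h k \<longleftrightarrow>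
    f \<in> Arr C \<and> g \<in> Arr C \<and> Dom C f = Dom C g \<and>
    h \<in> Hom C (Cod C f) (Cod C h) \<and> k \<in> Hom C (Cod C g) (Cod C h) \<and>
    h \<cdot>\<^bsub>C\<^esub> f = k \<cdot>\<^bsub>C\<^esub> g \<and>
    (\<forall>B. \<forall>a \<in> Hom C (Cod C f) B. \<forall>b \<in> Hom C (Cod C g) B. a \<cdot>\<^bsub>C\<^esub> f = b \<cdot>\<^bsub>C\<^esub> g
      \<longrightarrow> (\<exists>!u. u \<in> Hom C (Cod C h) B \<and> u \<cdot>\<^bsub>C\<^esub> h = a \<and> u \<cdot>\<^bsub>C\<^esub> k = b))"

definition pullback_lift :: "('o, 'm, 'z) category_scheme \<Rightarrow> 'm \<Rightarrow> 'm \<Rightarrow> 'm \<Rightarrow> 'm \<Rightarrow> 'm"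
  where "pullback_lift C p q a b =
    (THE u. u \<in> Hom C (Dom C a) (Dom C p) \<and> p \<cdot>\<^bsub>C\<^esub> u = a \<and> q \<cdot>\<^bsub>C\<^esub> u = b)"


section \<open>Extensions and the Yoneda group \<open>Ext\<^sup>1\<close>\<close>

definition short_exact ::
    "('o, 'm, 'z) preadditive_category_scheme \<Rightarrow> 'o \<Rightarrow> 'm \<Rightarrow> 'o \<Rightarrow> 'm \<Rightarrow> 'o \<Rightarrow> bool"
  where "short_exact C P i E p Q \<longleftrightarrow>
    i \<in> Hom C P E \<and> p \<in> Hom C E Q \<and> is_kernel C i p \<and> is_cokernel C p i"

text \<open>An extension \<open>0 \<rightarrow> P \<rightarrow> E \<rightarrow> Q \<rightarrow> 0\<close> is represented by its pair of maps \<open>(i, p)\<close>; the middle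
  term is \<open>Cod i\<close>.\<close>

definition extensions :: "('o, 'm, 'z) preadditive_category_scheme \<Rightarrow> 'o \<Rightarrow> 'o \<Rightarrow> ('m \<times> 'm) set"
  where "extensions C Q P = {(i, p). short_exact C P i (Cod C i) p Q}"

definition ext_equiv ::
    "('o, 'm, 'z) preadditive_category_scheme \<Rightarrow> 'm \<times> 'm \<Rightarrow> 'm \<times> 'm \<Rightarrow> bool"
  where "ext_equiv C = (\<lambda>(i, p) (i', p'). \<exists>h \<in> Hom C (Cod C i) (Cod C i').
    is_iso C h \<and> h \<cdot>\<^bsub>C\<^esub> i = i' \<and> p' \<cdot>\<^bsub>C\<^esub> h = p)"

definition ext_class ::
    "('o, 'm, 'z) preadditive_category_scheme \<Rightarrow> 'm \<times> 'm \<Rightarrow> ('m \<times> 'm) set"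
  where "ext_class C = (\<lambda>(i, p).
    {e' \<in> extensions C (Cod C p) (Dom C i). ext_equiv C (i, p) e'})"

text \<open>Operations on classes return the set of all extensions arising by the construction, over all
  representatives and all choices of pushout or pullback.  This set is the equivalence class of
  any single one of them.\<close>

definition ext_push ::
    "('o, 'm, 'z) preadditive_category_scheme \<Rightarrow> 'm \<Rightarrow> ('m \<times> 'm) set \<Rightarrow> ('m \<times> 'm) set"
  where "ext_push C \<phi> \<xi> = {(i', p'). \<exists>(i, p) \<in> \<xi>. \<exists>h.
    (i', p') \<in> extensions C (Cod C p) (Cod C \<phi>) \<and>
    is_pushout C i \<phi> h i' \<and> p' \<cdot>\<^bsub>C\<^esub> h = p}"

definition ext_pull ::
    "('o, 'm, 'z) preadditive_category_scheme \<Rightarrow> 'm \<Rightarrow> ('m \<times> 'm) set \<Rightarrow> ('m \<times> 'm) set"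
  where "ext_pull C \<psi> \<xi> = {(i', p'). \<exists>(i, p) \<in> \<xi>. \<exists>h.
    (i', p') \<in> extensions C (Dom C \<psi>) (Dom C i) \<and>
    is_pullback C p \<psi> h p' \<and> h \<cdot>\<^bsub>C\<^esub> i' = i}"

definition ext_dsum ::
    "('o, 'm, 'z) preadditive_category_scheme \<Rightarrow> 'm \<times> 'm \<Rightarrow> 'm \<times> 'm \<Rightarrow> 'm \<times> 'm"
  where "ext_dsum C = (\<lambda>(i, p) (i', p').
    (dsum_map C (Dom C i) (Dom C i') (Cod C i) (Cod C i') i i',
     dsum_map C (Dom C p) (Dom C p') (Cod C p) (Cod C p') p p'))"

definition baer_sum ::
    "('o, 'm, 'z) preadditive_category_scheme \<Rightarrow> 'o \<Rightarrow> 'o \<Rightarrow>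
      ('m \<times> 'm) set \<Rightarrow> ('m \<times> 'm) set \<Rightarrow> ('m \<times> 'm) set"
  where "baer_sum C Q P \<xi> \<xi>' =
    ext_push C (codiagonal C P) (ext_pull C (diagonal C Q)
      (\<Union>e\<in>\<xi>. \<Union>e'\<in>\<xi>'. ext_class C (ext_dsum C e e')))"

text \<open>The group \<open>Ext\<^sup>1(Q, P)\<close>, written multiplicatively as in HOL-Algebra; its operation is the
  Baer sum and its neutral element is the class of the split extension.\<close>

definition Ext1 ::
    "('o, 'm, 'z) preadditive_category_scheme \<Rightarrow> 'o \<Rightarrow> 'o \<Rightarrow> ('m \<times> 'm) set monoid"
  where "Ext1 C Q P =
    \<lparr>carrier = ext_class C ` extensions C Q P,
     mult = baer_sum C Q P,
     one = ext_class C (inj1 C P Q, proj2 C P Q)\<rparr>"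

text \<open>The connecting map \<open>Hom(K, P) \<rightarrow> Ext\<^sup>1(Q, P)\<close> of \<open>0 \<rightarrow> K \<rightarrow> M \<rightarrow> Q \<rightarrow> 0\<close>, given as \<open>(i, p)\<close>.\<close>

definition connecting ::
    "('o, 'm, 'z) preadditive_category_scheme \<Rightarrow> 'm \<times> 'm \<Rightarrow> 'm \<Rightarrow> ('m \<times> 'm) set"
  where "connecting C e \<phi> = ext_push C \<phi> (ext_class C e)"


section \<open>Completions to a \<open>3 \<times> 3\<close> diagram\<close>

text \<open>The four given sequences are \<open>P \<rightarrow> E \<rightarrow> R\<close>, \<open>P \<rightarrow> H \<rightarrow> S\<close>, \<open>R \<rightarrow> F \<rightarrow> Q\<close>, \<open>S \<rightarrow> G \<rightarrow> Q\<close> with maps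
  \<open>(iE, pE)\<close>, \<open>(iH, pH)\<close>, \<open>(iF, pF)\<close>, \<open>(iG, pG)\<close>.  The completing maps are \<open>a : E \<rightarrow> X\<close>, \<open>b : H \<rightarrow> X\<close>,
  \<open>c : X \<rightarrow> F\<close>, \<open>d : X \<rightarrow> G\<close>.\<close>

definition is_completion ::
    "('o, 'm, 'z) preadditive_category_scheme \<Rightarrow> 'm \<times> 'm \<Rightarrow> 'm \<times> 'm \<Rightarrow> 'm \<times> 'm \<Rightarrow> 'm \<times> 'm \<Rightarrow>
      'o \<Rightarrow> 'm \<Rightarrow> 'm \<Rightarrow> 'm \<Rightarrow> 'm \<Rightarrow> bool"
  where "is_completion C = (\<lambda>(iE, pE) (iH, pH) (iF, pF) (iG, pG) X a b c d.
    short_exact C (Cod C iH) b X c (Cod C iF) \<and>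
    short_exact C (Cod C iE) a X d (Cod C iG) \<and>
    a \<cdot>\<^bsub>C\<^esub> iE = b \<cdot>\<^bsub>C\<^esub> iH \<and> c \<cdot>\<^bsub>C\<^esub> a = iF \<cdot>\<^bsub>C\<^esub> pE \<and>
    d \<cdot>\<^bsub>C\<^esub> b = iG \<cdot>\<^bsub>C\<^esub> pH \<and> pF \<cdot>\<^bsub>C\<^esub> c = pG \<cdot>\<^bsub>C\<^esub> d)"

text \<open>The set of classes \<open>[X]\<close> of \<open>0 \<rightarrow> P \<rightarrow> X \<rightarrow> Y \<rightarrow> 0\<close>, where \<open>yF : Y \<rightarrow> F\<close> and \<open>yG : Y \<rightarrow> G\<close> are the
  projections of the fibre product \<open>Y\<close>.\<close>

definition completion_classes ::
    "('o, 'm, 'z) preadditive_category_scheme \<Rightarrow> 'm \<times> 'm \<Rightarrow> 'm \<times> 'm \<Rightarrow> 'm \<times> 'm \<Rightarrow> 'm \<times> 'm \<Rightarrow>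
      'm \<Rightarrow> 'm \<Rightarrow> ('m \<times> 'm) set set"
  where "completion_classes C eE eH eF eG yF yG =
    {ext_class C (a \<cdot>\<^bsub>C\<^esub> fst eE, pullback_lift C yF yG c d) | X a b c d.
      is_completion C eE eH eF eG X a b c d}"

text \<open>The extension \<open>0 \<rightarrow> R \<oplus> S \<rightarrow> Y \<rightarrow> Q \<rightarrow> 0\<close>.\<close>

definition fibre_product_ext ::
    "('o, 'm, 'z) preadditive_category_scheme \<Rightarrow> 'm \<times> 'm \<Rightarrow> 'm \<times> 'm \<Rightarrow> 'm \<Rightarrow> 'm \<Rightarrow> 'm \<times> 'm"
  where "fibre_product_ext C = (\<lambda>(iF, pF) (iG, pG) yF yG.
    (copair C (Dom C iF) (Dom C iG)
       (pullback_lift C yF yG iF (Zero C (Dom C iF) (Cod C iG)))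
       (pullback_lift C yF yG (Zero C (Dom C iG) (Cod C iF)) iG),
     pF \<cdot>\<^bsub>C\<^esub> yF))"


section \<open>Principal homogeneous spaces\<close>

definition principal_homogeneous_space ::
    "('g, 'b) monoid_scheme \<Rightarrow> 'x set \<Rightarrow> ('g \<Rightarrow> 'x \<Rightarrow> 'x) \<Rightarrow> bool"
  where "principal_homogeneous_space G T act \<longleftrightarrow>
    T \<noteq> {} \<and> group_action G T act \<and>
    (\<forall>x\<in>T. \<forall>y\<in>T. \<exists>!g. g \<in> carrier G \<and> act g x = y)"

end

theory Submission
  imports Defs
begin

text \<open>
  Write \<open>r : R \<rightarrow> Y\<close> and \<open>s : S \<rightarrow> Y\<close> for the two canonical maps and \<open>\<pi> : Y \<rightarrow> Q\<close> for the projection.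
  A completion is the same thing as an extension of \<open>Y\<close> by \<open>P\<close> whose pullback along \<open>r\<close> is \<open>E\<close> and whose
  pullback along \<open>s\<close> is \<open>H\<close>: given such an extension \<open>X\<close>, the maps \<open>E \<rightarrow> X\<close> and \<open>H \<rightarrow> X\<close> are the middle
  maps of the pullback squares, and \<open>X \<rightarrow> F\<close>, \<open>X \<rightarrow> G\<close> are the composites through \<open>Y\<close>
  (\<open>completion_classes_eq\<close>).  Hence the set of classes is a fibre of the homomorphism \<open>(r\<^sup>*, s\<^sup>*)\<close> on
  \<open>Ext\<^sup>1(Y, P)\<close>, and a nonempty fibre is a coset of its kernel.  That kernel is the kernel of restriction to
  \<open>R \<oplus> S\<close>, because lifts of \<open>r\<close> and of \<open>s\<close> to \<open>X\<close> together lift \<open>R \<oplus> S \<rightarrow> Y\<close>; so by exactness at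
  \<open>Ext\<^sup>1(Y, P)\<close> (\<open>ext_pull_surj\<close>) it is the image of \<open>\<pi>\<^sup>* = \<beta>\<close>.  By exactness at \<open>Ext\<^sup>1(Q, P)\<close>
  (\<open>ext_pull_kernel\<close>) the kernel of \<open>\<beta>\<close> is the image of the connecting map of \<open>R \<oplus> S \<rightarrow> Y \<rightarrow> Q\<close>, which is
  the image of \<open>\<delta>\<^sub>F + \<delta>\<^sub>G\<close> (\<open>image_connecting_sum\<close>).

  The group structure rests on one observation.  All constructions on extensions are expressed through
  morphisms of extensions (\<open>ext_mor\<close>), and finitely many extensions of \<open>Q\<close> are pushouts of a single
  extension \<open>0 \<rightarrow> K \<rightarrow> M \<rightarrow> Q \<rightarrow> 0\<close> (\<open>common_cover\<close>).  In terms of such a cover the Baer sum is addition in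
  \<open>Hom(K, P)\<close> (\<open>baer_sum_class\<close>), so the group axioms for \<open>Ext\<^sup>1(Q, P)\<close> and the additivity of pullback
  are inherited from \<open>Hom\<close> groups, without any computation with iterated Baer sums.
\<close>

section \<open>Arrow calculus\<close>

lemma in_Hom [simp]: "f \<in> Hom C A B \<longleftrightarrow> f \<in> Arr C \<and> Dom C f = A \<and> Cod C f = B"
  by (simp add: Hom_def)

context category
begin

declare Dom_in_Obj [simp] Cod_in_Obj [simp]

text \<open>The typing premise comes second so that the simplifier finds \<open>f\<close> by matching \<^term>\<open>Dom C f = A\<close>
  against the context.\<close>

lemma Obj_Dom [simp, intro]: "Dom C f = A \<Longrightarrow> f \<in> Arr C \<Longrightarrow> A \<in> Obj C"
  by auto

lemma Obj_Cod [simp, intro]: "Cod C f = A \<Longrightarrow> f \<in> Arr C \<Longrightarrow> A \<in> Obj C"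
  by auto

lemma Comp_simps [simp]:
  assumes "f \<in> Arr C" "g \<in> Arr C" "Cod C f = Dom C g"
  shows "g \<cdot> f \<in> Arr C" "Dom C (g \<cdot> f) = Dom C f" "Cod C (g \<cdot> f) = Cod C g"
  using Comp_in_Hom[of f "Dom C f" "Cod C f" g "Cod C g"] assms by auto

lemma Comp_assoc_Arr [simp]:
  assumes "f \<in> Arr C" "g \<in> Arr C" "h \<in> Arr C" "Cod C f = Dom C g" "Cod C g = Dom C h"
  shows "(h \<cdot> g) \<cdot> f = h \<cdot> (g \<cdot> f)"
  using Comp_assoc[of f "Dom C f" "Cod C f" g "Cod C g" h "Cod C h"] assms by auto

lemma Id_simps [simp]:
  assumes "A \<in> Obj C"
  shows "Id C A \<in> Arr C" "Dom C (Id C A) = A" "Cod C (Id C A) = A"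
  using Id_in_Hom[OF assms] by auto

lemma Comp_Id_Arr [simp]: "f \<in> Arr C \<Longrightarrow> Dom C f = A \<Longrightarrow> f \<cdot> Id C A = f"
  using Comp_Id[of f A "Cod C f"] by auto

lemma Id_Comp_Arr [simp]: "f \<in> Arr C \<Longrightarrow> Cod C f = A \<Longrightarrow> Id C A \<cdot> f = f"
  using Id_Comp[of f "Dom C f" A] by auto

text \<open>Composites are normalised to associate to the right, so an equation between composites of two arrows
  has to be brought into the form in which it applies in front of a further arrow.\<close>

lemma Comp_eq_extend:
  assumes "g \<cdot> f = k" "f \<in> Arr C" "g \<in> Arr C" "Cod C f = Dom C g"
    and "t \<in> Arr C" "Cod C t = Dom C f"
  shows "g \<cdot> (f \<cdot> t) = k \<cdot> t"
  using assms Comp_assoc_Arr[of t f g] by simp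

lemma Comp_eq_extend2:
  assumes "g \<cdot> f = k \<cdot> l" "f \<in> Arr C" "g \<in> Arr C" "Cod C f = Dom C g"
    "k \<in> Arr C" "l \<in> Arr C" "Cod C l = Dom C k"
    and "t \<in> Arr C" "Cod C t = Dom C f" "Cod C t = Dom C l"
  shows "g \<cdot> (f \<cdot> t) = k \<cdot> (l \<cdot> t)"
  using assms Comp_assoc_Arr[of t f g] by simp

end

context preadditive_category
begin

lemma Add_simps [simp]:
  assumes "f \<in> Arr C" "g \<in> Arr C" "Dom C g = Dom C f" "Cod C g = Cod C f"
  shows "f \<boxplus> g \<in> Arr C" "Dom C (f \<boxplus> g) = Dom C f" "Cod C (f \<boxplus> g) = Cod C f"
proof -
  interpret comm_group "Hom_group C (Dom C f) (Cod C f)"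
    using assms by (intro Hom_comm_group) auto
  have "f \<boxplus> g \<in> Hom C (Dom C f) (Cod C f)"
    using m_closed[of f g] assms by (simp add: Hom_group_def)
  then show "f \<boxplus> g \<in> Arr C" "Dom C (f \<boxplus> g) = Dom C f" "Cod C (f \<boxplus> g) = Cod C f"
    by auto
qed

lemma Zero_simps [simp]:
  assumes "A \<in> Obj C" "B \<in> Obj C"
  shows "Zero C A B \<in> Arr C" "Dom C (Zero C A B) = A" "Cod C (Zero C A B) = B"
proof -
  interpret comm_group "Hom_group C A B"
    using assms by (intro Hom_comm_group) auto
  show "Zero C A B \<in> Arr C" "Dom C (Zero C A B) = A" "Cod C (Zero C A B) = B"
    using one_closed by (auto simp: Hom_group_def)
qed

lemma Add_Zero [simp]:
  assumes "f \<in> Arr C" "Dom C f = A" "Cod C f = B"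
  shows "f \<boxplus> Zero C A B = f" "Zero C A B \<boxplus> f = f"
proof -
  interpret comm_group "Hom_group C A B"
    using assms by (intro Hom_comm_group) auto
  show "f \<boxplus> Zero C A B = f" "Zero C A B \<boxplus> f = f"
    using l_one[of f] r_one[of f] assms by (auto simp: Hom_group_def)
qed

lemma Add_assoc_Arr:
  assumes "f \<in> Arr C" "g \<in> Arr C" "h \<in> Arr C"
    and "Dom C g = Dom C f" "Cod C g = Cod C f" "Dom C h = Dom C f" "Cod C h = Cod C f"
  shows "(f \<boxplus> g) \<boxplus> h = f \<boxplus> (g \<boxplus> h)"
proof -
  interpret comm_group "Hom_group C (Dom C f) (Cod C f)"
    using assms by (intro Hom_comm_group) auto
  show ?thesis using m_assoc[of f g h] assms by (simp add: Hom_group_def)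
qed

lemma Add_commute_Arr:
  assumes "f \<in> Arr C" "g \<in> Arr C" "Dom C g = Dom C f" "Cod C g = Cod C f"
  shows "f \<boxplus> g = g \<boxplus> f"
proof -
  interpret comm_group "Hom_group C (Dom C f) (Cod C f)"
    using assms by (intro Hom_comm_group) auto
  show ?thesis using m_comm[of f g] assms by (simp add: Hom_group_def)
qed

lemma negative_exists:
  assumes "f \<in> Arr C"
  obtains n where "n \<in> Arr C" "Dom C n = Dom C f" "Cod C n = Cod C f"
    "n \<boxplus> f = Zero C (Dom C f) (Cod C f)" "f \<boxplus> n = Zero C (Dom C f) (Cod C f)"
proof -
  interpret comm_group "Hom_group C (Dom C f) (Cod C f)"
    using assms by (intro Hom_comm_group) auto
  show ?thesis
    using that[of "inv\<^bsub>Hom_group C (Dom C f) (Cod C f)\<^esub> f"] inv_closed[of f] l_inv[of f] r_inv[of f] assms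
    by (auto simp: Hom_group_def)
qed

lemma Add_right_cancel:
  assumes "f \<boxplus> n = g \<boxplus> n" "f \<in> Arr C" "g \<in> Arr C" "n \<in> Arr C"
    and "Dom C g = Dom C f" "Cod C g = Cod C f" "Dom C n = Dom C f" "Cod C n = Cod C f"
  shows "f = g"
proof -
  interpret comm_group "Hom_group C (Dom C f) (Cod C f)"
    using assms by (intro Hom_comm_group) auto
  show ?thesis using right_cancel[of n f g] assms by (simp add: Hom_group_def)
qed

lemma Comp_Add [simp]:
  assumes "f \<in> Arr C" "f' \<in> Arr C" "g \<in> Arr C" "Dom C f' = Dom C f" "Cod C f' = Cod C f"
    and "Cod C f = Dom C g"
  shows "g \<cdot> (f \<boxplus> f') = (g \<cdot> f) \<boxplus> (g \<cdot> f')"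
  using Comp_Add_right[of f "Dom C f" "Cod C f" f' g "Cod C g"] assms by auto

lemma Add_Comp [simp]:
  assumes "f \<in> Arr C" "g \<in> Arr C" "g' \<in> Arr C" "Dom C g' = Dom C g" "Cod C g' = Cod C g"
    and "Cod C f = Dom C g"
  shows "(g \<boxplus> g') \<cdot> f = (g \<cdot> f) \<boxplus> (g' \<cdot> f)"
  using Comp_Add_left[of f "Dom C f" "Cod C f" g "Cod C g" g'] assms by auto

lemma Comp_Zero [simp]:
  assumes "f \<in> Arr C" "A \<in> Obj C" "Dom C f = B"
  shows "f \<cdot> Zero C A B = Zero C A (Cod C f)"
proof (rule Add_right_cancel)
  show "f \<cdot> Zero C A B \<boxplus> f \<cdot> Zero C A B = Zero C A (Cod C f) \<boxplus> f \<cdot> Zero C A B"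
    using assms Comp_Add[of "Zero C A B" "Zero C A B" f] by (simp del: Comp_Add)
qed (use assms in auto)

lemma Zero_Comp [simp]:
  assumes "f \<in> Arr C" "B \<in> Obj C" "Cod C f = A"
  shows "Zero C A B \<cdot> f = Zero C (Dom C f) B"
proof (rule Add_right_cancel)
  show "Zero C A B \<cdot> f \<boxplus> Zero C A B \<cdot> f = Zero C (Dom C f) B \<boxplus> Zero C A B \<cdot> f"
    using assms Add_Comp[of f "Zero C A B" "Zero C A B"] by (simp del: Add_Comp)
qed (use assms in auto)

lemma monoI:
  assumes "f \<in> Arr C"
    and zero: "\<And>t. \<lbrakk>t \<in> Arr C; Cod C t = Dom C f; f \<cdot> t = Zero C (Dom C t) (Cod C f)\<rbrakk>
      \<Longrightarrow> t = Zero C (Dom C t) (Dom C f)"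
  shows "is_mono C f"
  unfolding is_mono_def
proof (intro conjI allI ballI impI)
  fix A g h
  assume g: "g \<in> Hom C A (Dom C f)" and h: "h \<in> Hom C A (Dom C f)" and eq: "f \<cdot> g = f \<cdot> h"
  obtain n where n: "n \<in> Arr C" "Dom C n = A" "Cod C n = Dom C f"
      "h \<boxplus> n = Zero C A (Dom C f)"
    using negative_exists[of h] h by auto
  have "f \<cdot> (g \<boxplus> n) = f \<cdot> (h \<boxplus> n)"
    using g h n(1-3) eq assms(1) by simp
  then have "f \<cdot> (g \<boxplus> n) = Zero C A (Cod C f)"
    using n assms(1) g by simp
  then have "g \<boxplus> n = h \<boxplus> n"
    using zero[of "g \<boxplus> n"] g n by simp
  then show "g = h"
    by (rule Add_right_cancel) (use g h n(1-3) in auto)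
qed fact

lemma mono_zero:
  assumes "is_mono C f" "t \<in> Arr C" "Cod C t = Dom C f" "f \<cdot> t = Zero C (Dom C t) (Cod C f)"
  shows "t = Zero C (Dom C t) (Dom C f)"
proof -
  have "f \<in> Arr C" using assms(1) by (simp add: is_mono_def)
  then show ?thesis
    using assms unfolding is_mono_def
    by (metis Comp_Zero Cod_in_Obj Dom_in_Obj Zero_simps in_Hom)
qed

end

section \<open>The opposite category\<close>

text \<open>The axioms of an abelian category are self-dual.  Statements on cokernels, epimorphisms and pushouts
  are obtained from those on kernels, monomorphisms and pullbacks by passing to the opposite category.\<close>

definition opposite ::
    "('o, 'm, 'z) preadditive_category_scheme \<Rightarrow> ('o, 'm) preadditive_category"
  where "opposite C = \<lparr>Obj = Obj C, Arr = Arr C, Dom = Cod C, Cod = Dom C, Id = Id C,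
    Comp = (\<lambda>g f. f \<cdot>\<^bsub>C\<^esub> g), Add = Add C, Zero = (\<lambda>A B. Zero C B A)\<rparr>"

lemma opposite_simps [simp]:
  "Obj (opposite C) = Obj C" "Arr (opposite C) = Arr C" "Dom (opposite C) = Cod C"
  "Cod (opposite C) = Dom C" "Id (opposite C) = Id C" "g \<cdot>\<^bsub>opposite C\<^esub> f = f \<cdot>\<^bsub>C\<^esub> g"
  "Add (opposite C) = Add C" "Zero (opposite C) A B = Zero C B A"
  by (simp_all add: opposite_def)

lemma Hom_opposite: "Hom (opposite C) A B = Hom C B A"
  by (auto simp: Hom_def)

lemma mono_opposite: "is_mono (opposite C) f \<longleftrightarrow> is_epi C f"
  by (simp add: is_mono_def is_epi_def Hom_opposite)

lemma epi_opposite: "is_epi (opposite C) f \<longleftrightarrow> is_mono C f"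
  by (simp add: is_mono_def is_epi_def Hom_opposite)

lemma kernel_opposite: "is_kernel (opposite C) k f \<longleftrightarrow> is_cokernel C k f"
  by (auto simp: is_kernel_def is_cokernel_def Hom_opposite)

lemma cokernel_opposite: "is_cokernel (opposite C) k f \<longleftrightarrow> is_kernel C k f"
  by (auto simp: is_kernel_def is_cokernel_def Hom_opposite)

lemma pullback_opposite: "is_pullback (opposite C) f g p q \<longleftrightarrow> is_pushout C f g p q"
  by (simp add: is_pullback_def is_pushout_def Hom_opposite)

lemma short_exact_opposite: "short_exact (opposite C) Q p E i P \<longleftrightarrow> short_exact C P i E p Q"
  by (auto simp: short_exact_def kernel_opposite cokernel_opposite)

lemma zero_object_opposite: "is_zero_object (opposite C) Z \<longleftrightarrow> is_zero_object C Z"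
  by (auto simp: is_zero_object_def Hom_opposite)

lemma biproduct_opposite:
  "is_biproduct (opposite C) A B (D, p1, p2, i1, i2) \<longleftrightarrow> is_biproduct C A B (D, i1, i2, p1, p2)"
  by (auto simp: is_biproduct_def Hom_opposite)

lemma (in preadditive_category) preadditive_opposite: "preadditive_category (opposite C)"
proof -
  have "category (opposite C)"
    by unfold_locales auto
  moreover have "comm_group (Hom_group (opposite C) A B)" if "A \<in> Obj C" "B \<in> Obj C" for A B
    using Hom_comm_group[OF that(2,1)] by (simp add: Hom_group_def Hom_opposite)
  ultimately show ?thesis
    by (intro preadditive_category.intro preadditive_category_axioms.intro) auto
qed

lemma (in abelian_category) abelian_opposite: "abelian_category (opposite C)"
proof -
  interpret op: preadditive_category "opposite C" by (rule preadditive_opposite)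
  show ?thesis
  proof
    show "\<exists>D. is_biproduct (opposite C) A B D"
      if "A \<in> Obj (opposite C)" "B \<in> Obj (opposite C)" for A B
      using biproduct_exists[of A B] that biproduct_opposite[of C A B] by (metis opposite_simps(1) prod_cases5)
  qed (use kernel_exists cokernel_exists mono_normal epi_normal zero_object_exists in
    \<open>simp_all add: zero_object_opposite kernel_opposite cokernel_opposite mono_opposite
      epi_opposite\<close>)
qed

section \<open>Monomorphisms, kernels and short exact sequences\<close>

context category
begin

lemma mono_Arr [simp]: "is_mono C f \<Longrightarrow> f \<in> Arr C"
  by (simp add: is_mono_def)

lemma epi_Arr [simp]: "is_epi C f \<Longrightarrow> f \<in> Arr C"
  by (simp add: is_epi_def)

lemma mono_cancel:
  assumes "is_mono C f" "f \<cdot> g = f \<cdot> h" "g \<in> Arr C" "h \<in> Arr C"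
    and "Cod C g = Dom C f" "Cod C h = Dom C f" "Dom C h = Dom C g"
  shows "g = h"
  using assms unfolding is_mono_def by auto

lemma epi_cancel:
  assumes "is_epi C f" "g \<cdot> f = h \<cdot> f" "g \<in> Arr C" "h \<in> Arr C"
    and "Dom C g = Cod C f" "Dom C h = Cod C f" "Cod C h = Cod C g"
  shows "g = h"
  using assms unfolding is_epi_def by auto

lemma epi_comp:
  assumes "is_epi C f" "is_epi C g" "Cod C f = Dom C g"
  shows "is_epi C (g \<cdot> f)"
  unfolding is_epi_def
proof (intro conjI allI ballI impI)
  fix B u v
  assume *: "u \<in> Hom C (Cod C (g \<cdot> f)) B" "v \<in> Hom C (Cod C (g \<cdot> f)) B" "u \<cdot> (g \<cdot> f) = v \<cdot> (g \<cdot> f)"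
  have "(u \<cdot> g) \<cdot> f = (v \<cdot> g) \<cdot> f"
    using * assms by simp
  then have "u \<cdot> g = v \<cdot> g"
    by (rule epi_cancel[OF assms(1)]) (use * assms in auto)
  then show "u = v"
    by (rule epi_cancel[OF assms(2)]) (use * assms in auto)
qed (use assms in simp)

lemma epi_of_comp:
  assumes "is_epi C (g \<cdot> f)" "f \<in> Arr C" "g \<in> Arr C" "Cod C f = Dom C g"
  shows "is_epi C g"
  unfolding is_epi_def
proof (intro conjI allI ballI impI)
  fix B u v
  assume *: "u \<in> Hom C (Cod C g) B" "v \<in> Hom C (Cod C g) B" "u \<cdot> g = v \<cdot> g"
  then have "u \<cdot> (g \<cdot> f) = v \<cdot> (g \<cdot> f)"
    using assms Comp_assoc_Arr[of f g u] Comp_assoc_Arr[of f g v] by (simp del: Comp_assoc_Arr)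
  then show "u = v"
    by (rule epi_cancel[OF assms(1)]) (use * assms in auto)
qed fact

end

context preadditive_category
begin

lemma kernelD:
  assumes "is_kernel C k f"
  shows "k \<in> Arr C" "f \<in> Arr C" "Cod C k = Dom C f" "f \<cdot> k = Zero C (Dom C k) (Cod C f)"
  using assms by (auto simp: is_kernel_def)

lemma kernel_lift:
  assumes "is_kernel C k f" "g \<in> Arr C" "Cod C g = Dom C f" "f \<cdot> g = Zero C (Dom C g) (Cod C f)"
  obtains u where "u \<in> Arr C" "Dom C u = Dom C g" "Cod C u = Dom C k" "k \<cdot> u = g"
proof -
  have "\<exists>!u. u \<in> Hom C (Dom C g) (Dom C k) \<and> k \<cdot> u = g"
    using assms unfolding is_kernel_def by auto
  then show ?thesis using that by auto
qed

lemma kernel_mono: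
  assumes "is_kernel C k f"
  shows "is_mono C k"
proof (rule monoI)
  note k = kernelD[OF assms]
  show "k \<in> Arr C" by fact
  fix t
  assume t: "t \<in> Arr C" "Cod C t = Dom C k" "k \<cdot> t = Zero C (Dom C t) (Cod C k)"
  have "\<exists>!u. u \<in> Hom C (Dom C t) (Dom C k) \<and> k \<cdot> u = Zero C (Dom C t) (Cod C k)"
    using assms k t(1,2) unfolding is_kernel_def by auto
  moreover have "k \<cdot> Zero C (Dom C t) (Dom C k) = Zero C (Dom C t) (Cod C k)"
    using k(1) t(1) by simp
  ultimately show "t = Zero C (Dom C t) (Dom C k)"
    using t k(1)
    by (metis Cod_in_Obj Dom_in_Obj Zero_simps in_Hom)
qed

lemma kernelI:
  assumes k: "is_mono C k" and f: "f \<in> Arr C" "Cod C k = Dom C f" "f \<cdot> k = Zero C (Dom C k) (Cod C f)"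
    and lift: "\<And>t. \<lbrakk>t \<in> Arr C; Cod C t = Dom C f; f \<cdot> t = Zero C (Dom C t) (Cod C f)\<rbrakk>
      \<Longrightarrow> \<exists>u. u \<in> Arr C \<and> Dom C u = Dom C t \<and> Cod C u = Dom C k \<and> k \<cdot> u = t"
  shows "is_kernel C k f"
  unfolding is_kernel_def
proof (intro conjI allI ballI impI)
  fix A g
  assume g: "g \<in> Hom C A (Dom C f)" "f \<cdot> g = Zero C A (Cod C f)"
  then obtain u where u: "u \<in> Arr C" "Dom C u = A" "Cod C u = Dom C k" "k \<cdot> u = g"
    using lift[of g] by auto
  show "\<exists>!u. u \<in> Hom C A (Dom C k) \<and> k \<cdot> u = g"
    using u mono_cancel[OF k] by (intro ex1I[of _ u]) auto
qed (use k f in auto)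

lemma epiI:
  assumes "f \<in> Arr C"
    and "\<And>t. \<lbrakk>t \<in> Arr C; Dom C t = Cod C f; t \<cdot> f = Zero C (Dom C f) (Cod C t)\<rbrakk>
      \<Longrightarrow> t = Zero C (Cod C f) (Cod C t)"
  shows "is_epi C f"
  using preadditive_category.monoI[OF preadditive_opposite, of f] assms by (auto simp: mono_opposite)

lemma epi_zero:
  assumes "is_epi C f" "t \<in> Arr C" "Dom C t = Cod C f" "t \<cdot> f = Zero C (Dom C f) (Cod C t)"
  shows "t = Zero C (Cod C f) (Cod C t)"
  using preadditive_category.mono_zero[OF preadditive_opposite, of f t] assms
  by (auto simp: mono_opposite)

end

context abelian_category
begin

text \<open>Every epimorphism is the cokernel of something, and that something factors through the kernel.\<close>

lemma kernel_of_epi: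
  assumes k: "is_kernel C k f" and f: "is_epi C f"
  shows "is_cokernel C f k"
proof -
  note D = kernelD[OF k]
  obtain g where g: "is_cokernel C f g"
    using epi_normal[OF f] by blast
  then have gA: "g \<in> Arr C" "Cod C g = Dom C f" "f \<cdot> g = Zero C (Dom C g) (Cod C f)"
    by (auto simp: is_cokernel_def)
  obtain u where u: "u \<in> Arr C" "Dom C u = Dom C g" "Cod C u = Dom C k" "k \<cdot> u = g"
    using kernel_lift[OF k gA] .
  show ?thesis
    unfolding is_cokernel_def
  proof (intro conjI allI ballI impI)
    fix B h
    assume h: "h \<in> Hom C (Cod C k) B" "h \<cdot> k = Zero C (Dom C k) B"
    have "h \<cdot> (k \<cdot> u) = Zero C (Dom C k) B \<cdot> u"
      by (rule Comp_eq_extend[OF h(2)]) (use h(1) u(1-3) D in auto)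
    also have "\<dots> = Zero C (Dom C g) B"
      using h(1) u(1-3) by auto
    finally have "h \<cdot> g = Zero C (Dom C g) B"
      unfolding u(4) .
    then show "\<exists>!u. u \<in> Hom C (Cod C f) B \<and> u \<cdot> f = h"
      using g h D gA unfolding is_cokernel_def by auto
  qed (use D in auto)
qed

lemma cokernel_of_mono:
  assumes "is_cokernel C f k" "is_mono C k"
  shows "is_kernel C k f"
  using abelian_category.kernel_of_epi[OF abelian_opposite, of f k] assms
  by (simp add: kernel_opposite cokernel_opposite epi_opposite)

text \<open>A monomorphism is the kernel of some \<open>g\<close>; if it is epi as well, then \<open>g = 0\<close>, so the identity of the
  codomain lifts along it.\<close>

lemma mono_epi_iso:
  assumes m: "is_mono C f" and e: "is_epi C f"
  shows "is_iso C f"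
proof -
  obtain g where g: "is_kernel C f g"
    using mono_normal[OF m] by blast
  note D = kernelD[OF g]
  have "g = Zero C (Cod C f) (Cod C g)"
    by (rule epi_zero[OF e]) (use D in auto)
  then have "g \<cdot> Id C (Cod C f) = Zero C (Cod C f) (Cod C g)"
    using D by (metis Comp_Id_Arr)
  then obtain u where u: "u \<in> Arr C" "Dom C u = Cod C f" "Cod C u = Dom C f" "f \<cdot> u = Id C (Cod C f)"
    using kernel_lift[OF g, of "Id C (Cod C f)"] D by auto
  have "f \<cdot> (u \<cdot> f) = f \<cdot> Id C (Dom C f)"
    using Comp_eq_extend[OF u(4), of f] u D by auto
  then have "u \<cdot> f = Id C (Dom C f)"
    by (rule mono_cancel[OF m]) (use u D in auto)
  then show ?thesis
    using u D unfolding is_iso_def by auto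
qed

lemma short_exactI:
  assumes "is_kernel C i p" "is_epi C p" "Dom C i = P" "Cod C i = E" "Cod C p = Q"
  shows "short_exact C P i E p Q"
  using assms kernelD[OF assms(1)] kernel_of_epi[OF assms(1,2)] by (auto simp: short_exact_def)

lemma short_exactD:
  assumes "short_exact C P i E p Q"
  shows "i \<in> Arr C" "Dom C i = P" "Cod C i = E" "p \<in> Arr C" "Dom C p = E" "Cod C p = Q"
    "p \<cdot> i = Zero C P Q" "is_mono C i" "is_epi C p" "is_kernel C i p"
    "P \<in> Obj C" "E \<in> Obj C" "Q \<in> Obj C"
proof -
  interpret op: abelian_category "opposite C" by (rule abelian_opposite)
  have k: "is_kernel C i p" and i: "i \<in> Hom C P E" and p: "p \<in> Hom C E Q"
    using assms by (simp_all add: short_exact_def)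
  note D = kernelD[OF k]
  show "is_kernel C i p" by fact
  show "is_mono C i"
    using k by (rule kernel_mono)
  show "is_epi C p"
    using assms op.kernel_mono[of p i]
    by (simp add: short_exact_def kernel_opposite mono_opposite)
  show "i \<in> Arr C" "Dom C i = P" "Cod C i = E" "p \<in> Arr C" "Dom C p = E" "Cod C p = Q"
    using i p by simp_all
  then show "p \<cdot> i = Zero C P Q" "P \<in> Obj C" "E \<in> Obj C" "Q \<in> Obj C"
    using D(4) by auto
qed

lemma short_exact_lift:
  assumes "short_exact C P i E p Q" "t \<in> Arr C" "Cod C t = E" "p \<cdot> t = Zero C (Dom C t) Q"
  obtains u where "u \<in> Arr C" "Dom C u = Dom C t" "Cod C u = P" "i \<cdot> u = t"
  using kernel_lift[of i p t] assms short_exactD[OF assms(1)] by metis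

lemma short_exact_colift:
  assumes "short_exact C P i E p Q" "t \<in> Arr C" "Dom C t = E" "t \<cdot> i = Zero C P (Cod C t)"
  obtains u where "u \<in> Arr C" "Cod C u = Cod C t" "Dom C u = Q" "u \<cdot> p = t"
  using abelian_category.short_exact_lift[OF abelian_opposite, of Q p E i P t] assms
  by (auto simp: short_exact_opposite)

section \<open>Biproducts and pullbacks\<close>

lemma is_biproduct_dsum:
  assumes "A \<in> Obj C" "B \<in> Obj C"
  shows "is_biproduct C A B (dsum C A B, inj1 C A B, inj2 C A B, proj1 C A B, proj2 C A B)"
proof -
  have "is_biproduct C A B (biproduct C A B)"
    unfolding biproduct_def using biproduct_exists[OF assms] by (rule someI_ex)
  then show ?thesis
    by (auto simp: dsum_def inj1_def inj2_def proj1_def proj2_def split: prod.splits)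
qed

lemma inj_proj_simps [simp]:
  assumes "A \<in> Obj C" "B \<in> Obj C"
  shows "inj1 C A B \<in> Arr C" "Dom C (inj1 C A B) = A" "Cod C (inj1 C A B) = dsum C A B"
    "inj2 C A B \<in> Arr C" "Dom C (inj2 C A B) = B" "Cod C (inj2 C A B) = dsum C A B"
    "proj1 C A B \<in> Arr C" "Dom C (proj1 C A B) = dsum C A B" "Cod C (proj1 C A B) = A"
    "proj2 C A B \<in> Arr C" "Dom C (proj2 C A B) = dsum C A B" "Cod C (proj2 C A B) = B"
    "proj1 C A B \<cdot> inj1 C A B = Id C A" "proj2 C A B \<cdot> inj2 C A B = Id C B"
    "proj1 C A B \<cdot> inj2 C A B = Zero C B A" "proj2 C A B \<cdot> inj1 C A B = Zero C A B"
    "inj1 C A B \<cdot> proj1 C A B \<boxplus> inj2 C A B \<cdot> proj2 C A B = Id C (dsum C A B)"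
    "dsum C A B \<in> Obj C"
  using is_biproduct_dsum[OF assms] unfolding is_biproduct_def by auto

lemma proj_inj_Comp [simp]:
  assumes "A \<in> Obj C" "B \<in> Obj C" "t \<in> Arr C"
  shows "Cod C t = A \<Longrightarrow> proj1 C A B \<cdot> (inj1 C A B \<cdot> t) = t"
    "Cod C t = B \<Longrightarrow> proj2 C A B \<cdot> (inj2 C A B \<cdot> t) = t"
    "Cod C t = B \<Longrightarrow> proj1 C A B \<cdot> (inj2 C A B \<cdot> t) = Zero C (Dom C t) A"
    "Cod C t = A \<Longrightarrow> proj2 C A B \<cdot> (inj1 C A B \<cdot> t) = Zero C (Dom C t) B"
  using assms Comp_assoc_Arr[symmetric, of t "inj1 C A B" "proj1 C A B"]
    Comp_assoc_Arr[symmetric, of t "inj2 C A B" "proj1 C A B"]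
    Comp_assoc_Arr[symmetric, of t "inj1 C A B" "proj2 C A B"]
    Comp_assoc_Arr[symmetric, of t "inj2 C A B" "proj2 C A B"]
  by (simp_all del: Comp_assoc_Arr)

lemma dsum_decomp:
  assumes "A \<in> Obj C" "B \<in> Obj C" "t \<in> Arr C" "Cod C t = dsum C A B"
  shows "t = inj1 C A B \<cdot> (proj1 C A B \<cdot> t) \<boxplus> inj2 C A B \<cdot> (proj2 C A B \<cdot> t)"
proof -
  have "t = (inj1 C A B \<cdot> proj1 C A B \<boxplus> inj2 C A B \<cdot> proj2 C A B) \<cdot> t"
    using assms by simp
  then show ?thesis
    using assms by (simp del: inj_proj_simps(17))
qed

lemma dsum_codecomp:
  assumes "A \<in> Obj C" "B \<in> Obj C" "t \<in> Arr C" "Dom C t = dsum C A B"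
  shows "t = (t \<cdot> inj1 C A B) \<cdot> proj1 C A B \<boxplus> (t \<cdot> inj2 C A B) \<cdot> proj2 C A B"
proof -
  have "t = t \<cdot> (inj1 C A B \<cdot> proj1 C A B \<boxplus> inj2 C A B \<cdot> proj2 C A B)"
    using assms by simp
  then show ?thesis
    using assms by (simp del: inj_proj_simps(17))
qed

lemma dsum_eqI:
  assumes "proj1 C A B \<cdot> s = proj1 C A B \<cdot> t" "proj2 C A B \<cdot> s = proj2 C A B \<cdot> t"
    and "A \<in> Obj C" "B \<in> Obj C" "s \<in> Arr C" "Cod C s = dsum C A B" "t \<in> Arr C" "Cod C t = dsum C A B"
  shows "s = t"
  using dsum_decomp[of A B s] dsum_decomp[of A B t] assms by metis

lemma dsum_coeqI:
  assumes "s \<cdot> inj1 C A B = t \<cdot> inj1 C A B" "s \<cdot> inj2 C A B = t \<cdot> inj2 C A B"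
    and "A \<in> Obj C" "B \<in> Obj C" "s \<in> Arr C" "Dom C s = dsum C A B" "t \<in> Arr C" "Dom C t = dsum C A B"
  shows "s = t"
  using dsum_codecomp[of A B s] dsum_codecomp[of A B t] assms by metis

lemma copair_simps [simp]:
  assumes "f \<in> Arr C" "g \<in> Arr C" "Dom C f = A" "Dom C g = B" "Cod C g = Cod C f"
  shows "copair C A B f g \<in> Arr C" "Dom C (copair C A B f g) = dsum C A B"
    "Cod C (copair C A B f g) = Cod C f"
    "copair C A B f g \<cdot> inj1 C A B = f" "copair C A B f g \<cdot> inj2 C A B = g"
    "t \<in> Arr C \<Longrightarrow> Cod C t = A \<Longrightarrow> copair C A B f g \<cdot> (inj1 C A B \<cdot> t) = f \<cdot> t"
    "t \<in> Arr C \<Longrightarrow> Cod C t = B \<Longrightarrow> copair C A B f g \<cdot> (inj2 C A B \<cdot> t) = g \<cdot> t"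
proof -
  have [simp]: "A \<in> Obj C" "B \<in> Obj C"
    using assms by auto
  show "copair C A B f g \<in> Arr C" "Dom C (copair C A B f g) = dsum C A B"
    "Cod C (copair C A B f g) = Cod C f"
    "copair C A B f g \<cdot> inj1 C A B = f" "copair C A B f g \<cdot> inj2 C A B = g"
    "t \<in> Arr C \<Longrightarrow> Cod C t = A \<Longrightarrow> copair C A B f g \<cdot> (inj1 C A B \<cdot> t) = f \<cdot> t"
    "t \<in> Arr C \<Longrightarrow> Cod C t = B \<Longrightarrow> copair C A B f g \<cdot> (inj2 C A B \<cdot> t) = g \<cdot> t"
    using assms by (auto simp: copair_def)
qed

lemma pullbackD:
  assumes "is_pullback C f g p q"
  shows "f \<in> Arr C" "g \<in> Arr C" "Cod C g = Cod C f" "p \<in> Arr C" "Cod C p = Dom C f"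
    "q \<in> Arr C" "Dom C q = Dom C p" "Cod C q = Dom C g" "f \<cdot> p = g \<cdot> q"
  using assms by (auto simp: is_pullback_def)

lemma pullback_ex1:
  assumes "is_pullback C f g p q" "a \<in> Arr C" "b \<in> Arr C" "Dom C b = Dom C a"
    and "Cod C a = Dom C f" "Cod C b = Dom C g" "f \<cdot> a = g \<cdot> b"
  shows "\<exists>!u. u \<in> Hom C (Dom C a) (Dom C p) \<and> p \<cdot> u = a \<and> q \<cdot> u = b"
proof -
  have U: "\<forall>A. \<forall>a \<in> Hom C A (Dom C f). \<forall>b \<in> Hom C A (Dom C g). f \<cdot> a = g \<cdot> b
      \<longrightarrow> (\<exists>!u. u \<in> Hom C A (Dom C p) \<and> p \<cdot> u = a \<and> q \<cdot> u = b)"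
    using assms(1) unfolding is_pullback_def by (elim conjE)
  show ?thesis
    by (rule U[rule_format]) (use assms(2-) in simp_all)
qed

lemma pullback_lift_ex:
  assumes "is_pullback C f g p q" "a \<in> Arr C" "b \<in> Arr C" "Dom C b = Dom C a"
    and "Cod C a = Dom C f" "Cod C b = Dom C g" "f \<cdot> a = g \<cdot> b"
  obtains u where "u \<in> Arr C" "Dom C u = Dom C a" "Cod C u = Dom C p" "p \<cdot> u = a" "q \<cdot> u = b"
  using pullback_ex1[OF assms] that by (auto simp del: Comp_assoc_Arr)

lemma pullback_eqI:
  assumes pb: "is_pullback C f g p q" and "p \<cdot> u = p \<cdot> v" "q \<cdot> u = q \<cdot> v"
    and "u \<in> Arr C" "v \<in> Arr C" "Dom C v = Dom C u" "Cod C u = Dom C p" "Cod C v = Dom C p"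
  shows "u = v"
proof -
  note D = pullbackD[OF pb]
  have "f \<cdot> (p \<cdot> u) = g \<cdot> (q \<cdot> u)"
    using Comp_eq_extend2[OF D(9)] D assms by simp
  then have "\<exists>!w. w \<in> Hom C (Dom C u) (Dom C p) \<and> p \<cdot> w = p \<cdot> u \<and> q \<cdot> w = q \<cdot> u"
    using pullback_ex1[OF pb, of "p \<cdot> u" "q \<cdot> u"] assms(4-) D(1-8) by simp
  moreover have "u \<in> Hom C (Dom C u) (Dom C p) \<and> p \<cdot> u = p \<cdot> u \<and> q \<cdot> u = q \<cdot> u"
    "v \<in> Hom C (Dom C u) (Dom C p) \<and> p \<cdot> v = p \<cdot> u \<and> q \<cdot> v = q \<cdot> u"
    using assms by simp_all
  ultimately show ?thesis by blast
qed

lemma pullbackI: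
  assumes "f \<in> Arr C" "g \<in> Arr C" "Cod C g = Cod C f" "p \<in> Arr C" "Cod C p = Dom C f"
    "q \<in> Arr C" "Dom C q = Dom C p" "Cod C q = Dom C g" "f \<cdot> p = g \<cdot> q"
    and lift: "\<And>a b. \<lbrakk>a \<in> Arr C; b \<in> Arr C; Dom C b = Dom C a; Cod C a = Dom C f; Cod C b = Dom C g;
        f \<cdot> a = g \<cdot> b\<rbrakk>
      \<Longrightarrow> \<exists>u. u \<in> Arr C \<and> Dom C u = Dom C a \<and> Cod C u = Dom C p \<and> p \<cdot> u = a \<and> q \<cdot> u = b"
    and eq: "\<And>u v. \<lbrakk>p \<cdot> u = p \<cdot> v; q \<cdot> u = q \<cdot> v; u \<in> Arr C; v \<in> Arr C; Dom C v = Dom C u;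
        Cod C u = Dom C p; Cod C v = Dom C p\<rbrakk> \<Longrightarrow> u = v"
  shows "is_pullback C f g p q"
  unfolding is_pullback_def
proof (intro conjI allI ballI impI)
  fix A a b
  assume ab: "a \<in> Hom C A (Dom C f)" "b \<in> Hom C A (Dom C g)" "f \<cdot> a = g \<cdot> b"
  then obtain u where u: "u \<in> Arr C" "Dom C u = A" "Cod C u = Dom C p" "p \<cdot> u = a" "q \<cdot> u = b"
    using lift[of a b] by auto
  show "\<exists>!u. u \<in> Hom C A (Dom C p) \<and> p \<cdot> u = a \<and> q \<cdot> u = b"
    using u eq by (intro ex1I[of _ u]) auto
qed (use assms in auto)

lemma pullback_sym:
  assumes pb: "is_pullback C f g p q"
  shows "is_pullback C g f q p"
proof -
  note D = pullbackD[OF pb]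
  show ?thesis
  proof (rule pullbackI)
    fix a b
    assume ab: "a \<in> Arr C" "b \<in> Arr C" "Dom C b = Dom C a" "Cod C a = Dom C g" "Cod C b = Dom C f"
      "g \<cdot> a = f \<cdot> b"
    obtain u where "u \<in> Arr C" "Dom C u = Dom C b" "Cod C u = Dom C p" "p \<cdot> u = b" "q \<cdot> u = a"
      using pullback_lift_ex[OF pb ab(2,1) ab(3)[symmetric] ab(5,4) ab(6)[symmetric]] .
    then show "\<exists>u. u \<in> Arr C \<and> Dom C u = Dom C a \<and> Cod C u = Dom C q \<and> q \<cdot> u = a \<and> p \<cdot> u = b"
      using D(7) ab(3) by metis
  next
    fix u v
    assume "q \<cdot> u = q \<cdot> v" "p \<cdot> u = p \<cdot> v" "u \<in> Arr C" "v \<in> Arr C" "Dom C v = Dom C u"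
      "Cod C u = Dom C q" "Cod C v = Dom C q"
    then show "u = v"
      using pullback_eqI[OF pb] D(7) by metis
  qed (use D in simp_all)
qed

text \<open>The fibre product is the kernel of \<open>(f, -g)\<close> on the biproduct.  If \<open>f\<close> is epi then so is \<open>(f, -g)\<close>,
  which is therefore the cokernel of that kernel; a map vanishing on the image of \<open>q\<close> then factors, after
  composition with the second projection, through \<open>(f, -g)\<close>.\<close>

lemma pullback_exists:
  assumes f: "f \<in> Arr C" and g: "g \<in> Arr C" and fg: "Cod C g = Cod C f"
  obtains p q where "is_pullback C f g p q" "is_epi C f \<Longrightarrow> is_epi C q"
proof -
  define A where "A = Dom C f"
  define B where "B = Dom C g"
  have AB [simp]: "A \<in> Obj C" "B \<in> Obj C"
    using f g by (auto simp: A_def B_def)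
  \<comment> \<open>\<open>n\<close> is \<open>-g\<close>\<close>
  obtain n where n: "n \<in> Arr C" "Dom C n = Dom C g" "Cod C n = Cod C g"
    "g \<boxplus> n = Zero C (Dom C g) (Cod C g)"
    using negative_exists[OF g] by metis
  define d where "d = copair C A B f n"
  have d [simp]: "d \<in> Arr C" "Dom C d = dsum C A B" "Cod C d = Cod C f"
    using f g n fg by (simp_all add: d_def A_def B_def)
  have d_iff: "d \<cdot> t = Zero C (Dom C t) (Cod C f) \<longleftrightarrow>
      f \<cdot> (proj1 C A B \<cdot> t) = g \<cdot> (proj2 C A B \<cdot> t)"
    if t: "t \<in> Arr C" "Cod C t = dsum C A B" for t
  proof -
    have dt: "d \<cdot> t = f \<cdot> (proj1 C A B \<cdot> t) \<boxplus> n \<cdot> (proj2 C A B \<cdot> t)"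
      using t f g n fg by (simp add: d_def copair_def A_def B_def)
    have gn: "g \<cdot> (proj2 C A B \<cdot> t) \<boxplus> n \<cdot> (proj2 C A B \<cdot> t) = Zero C (Dom C t) (Cod C f)"
      using Add_Comp[of "proj2 C A B \<cdot> t" g n] t g n fg by (simp add: B_def A_def f del: Add_Comp)
    show ?thesis
    proof
      assume "d \<cdot> t = Zero C (Dom C t) (Cod C f)"
      then have "f \<cdot> (proj1 C A B \<cdot> t) \<boxplus> n \<cdot> (proj2 C A B \<cdot> t)
          = g \<cdot> (proj2 C A B \<cdot> t) \<boxplus> n \<cdot> (proj2 C A B \<cdot> t)"
        using dt gn by simp
      then show "f \<cdot> (proj1 C A B \<cdot> t) = g \<cdot> (proj2 C A B \<cdot> t)"
        by (rule Add_right_cancel) (use t f g n fg in \<open>auto simp: A_def B_def\<close>)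
    qed (use dt gn in simp)
  qed
  obtain k where k: "is_kernel C k d"
    using kernel_exists[OF d(1)] by blast
  note K = kernelD[OF k]
  define p where "p = proj1 C A B \<cdot> k"
  define q where "q = proj2 C A B \<cdot> k"
  have pq [simp]: "p \<in> Arr C" "Dom C p = Dom C k" "Cod C p = A"
    "q \<in> Arr C" "Dom C q = Dom C k" "Cod C q = B"
    using K by (auto simp: p_def q_def)
  have pb: "is_pullback C f g p q"
  proof (rule pullbackI)
    show "f \<cdot> p = g \<cdot> q"
      using d_iff[of k] K by (simp add: p_def q_def)
  next
    fix a b
    assume ab: "a \<in> Arr C" "b \<in> Arr C" "Dom C b = Dom C a" "Cod C a = Dom C f" "Cod C b = Dom C g"
        "f \<cdot> a = g \<cdot> b"
    let ?t = "inj1 C A B \<cdot> a \<boxplus> inj2 C A B \<cdot> b"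
    have t: "?t \<in> Arr C" "Dom C ?t = Dom C a" "Cod C ?t = dsum C A B"
        "proj1 C A B \<cdot> ?t = a" "proj2 C A B \<cdot> ?t = b"
      using ab by (auto simp: A_def[symmetric] B_def[symmetric])
    obtain u where u: "u \<in> Arr C" "Dom C u = Dom C a" "Cod C u = Dom C k" "k \<cdot> u = ?t"
      using kernel_lift[OF k, of ?t] d_iff[of ?t] t ab by auto
    have "p \<cdot> u = a" "q \<cdot> u = b"
      using u t K by (auto simp: p_def q_def)
    then show "\<exists>u. u \<in> Arr C \<and> Dom C u = Dom C a \<and> Cod C u = Dom C p \<and> p \<cdot> u = a \<and> q \<cdot> u = b"
      using u by auto
  next
    fix u v
    assume uv: "p \<cdot> u = p \<cdot> v" "q \<cdot> u = q \<cdot> v" "u \<in> Arr C" "v \<in> Arr C" "Dom C v = Dom C u"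
        "Cod C u = Dom C p" "Cod C v = Dom C p"
    have "k \<cdot> u = k \<cdot> v"
      by (rule dsum_eqI[of A B]) (use uv K in \<open>auto simp: p_def q_def\<close>)
    then show "u = v"
      by (rule mono_cancel[OF kernel_mono[OF k]]) (use uv in auto)
  qed (use f g fg in \<open>auto simp: A_def B_def\<close>)
  moreover have "is_epi C q" if epi: "is_epi C f"
  proof (rule epiI)
    fix u
    assume u: "u \<in> Arr C" "Dom C u = Cod C q" "u \<cdot> q = Zero C (Dom C q) (Cod C u)"
    have "is_epi C (d \<cdot> inj1 C A B)"
      using epi f g n fg by (simp add: d_def A_def B_def)
    then have "is_epi C d"
      by (rule epi_of_comp) auto
    then have "is_cokernel C d k"
      using kernel_of_epi[OF k] by blast
    then have "short_exact C (Dom C k) k (dsum C A B) d (Cod C f)"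
      using k K by (auto simp: short_exact_def)
    then obtain v where v: "v \<in> Arr C" "Cod C v = Cod C u" "Dom C v = Cod C f" "v \<cdot> d = u \<cdot> proj2 C A B"
      using short_exact_colift[of "Dom C k" k "dsum C A B" d "Cod C f" "u \<cdot> proj2 C A B"] u K
      by (auto simp: q_def)
    have "d \<cdot> inj1 C A B = f"
      using f g n fg by (simp add: d_def A_def B_def)
    then have "v \<cdot> f = (u \<cdot> proj2 C A B) \<cdot> inj1 C A B"
      using Comp_eq_extend[OF v(4), of "inj1 C A B"] v(1-3) by simp
    also have "\<dots> = Zero C A (Cod C v)"
      using u(1,2) v(2) by simp
    finally have "v = Zero C (Cod C f) (Cod C v)"
      by (intro epi_zero[OF epi]) (use v in \<open>auto simp: A_def\<close>)
    then have "u \<cdot> proj2 C A B = Zero C (dsum C A B) (Cod C u)"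
      using v u d by (metis Zero_Comp Obj_Cod)
    then have "(u \<cdot> proj2 C A B) \<cdot> inj2 C A B = Zero C B (Cod C u)"
      using u by auto
    then show "u = Zero C (Cod C q) (Cod C u)"
      using u by auto
  qed simp
  ultimately show ?thesis
    using that by blast
qed

lemma pullback_epi:
  assumes pb: "is_pullback C f g p q" and "is_epi C f"
  shows "is_epi C q"
proof -
  note D = pullbackD[OF pb]
  obtain p' q' where pb': "is_pullback C f g p' q'" and epi: "is_epi C q'"
    using pullback_exists[of f g] D assms(2) by metis
  note D' = pullbackD[OF pb']
  obtain u where u: "u \<in> Arr C" "Dom C u = Dom C p'" "Cod C u = Dom C p" "q \<cdot> u = q'"
    using pullback_lift_ex[OF pb, of p' q'] D' by metis
  show ?thesis
    by (rule epi_of_comp[of q u]) (use u epi D in auto)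
qed

lemma pullback_lift_simps:
  assumes pb: "is_pullback C f g p q" "a \<in> Arr C" "b \<in> Arr C" "Dom C b = Dom C a"
    and "Cod C a = Dom C f" "Cod C b = Dom C g" "f \<cdot> a = g \<cdot> b"
  shows "pullback_lift C p q a b \<in> Arr C" "Dom C (pullback_lift C p q a b) = Dom C a"
    "Cod C (pullback_lift C p q a b) = Dom C p"
    "p \<cdot> pullback_lift C p q a b = a" "q \<cdot> pullback_lift C p q a b = b"
proof -
  from theI'[OF pullback_ex1[OF assms]]
  show "pullback_lift C p q a b \<in> Arr C" "Dom C (pullback_lift C p q a b) = Dom C a"
    "Cod C (pullback_lift C p q a b) = Dom C p"
    "p \<cdot> pullback_lift C p q a b = a" "q \<cdot> pullback_lift C p q a b = b"
    unfolding pullback_lift_def by auto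
qed

lemma pullback_lift_eq:
  assumes pb: "is_pullback C f g p q" and "u \<in> Arr C" "Cod C u = Dom C p"
  shows "pullback_lift C p q (p \<cdot> u) (q \<cdot> u) = u"
proof -
  note D = pullbackD[OF pb]
  have "f \<cdot> (p \<cdot> u) = g \<cdot> (q \<cdot> u)"
    using Comp_eq_extend2[OF D(9)] D assms by simp
  note L = pullback_lift_simps[OF pb _ _ _ _ _ this]
  show ?thesis
    by (rule pullback_eqI[OF pb]) (use L D assms in auto)
qed

end

section \<open>Morphisms of extensions\<close>

context abelian_category
begin

text \<open>The argument for being mono is applied twice, the second time in the opposite category.\<close>

lemma five_lemma:
  assumes e: "short_exact C P i E p Q" and e': "short_exact C P i' E' p' Q"
    and h: "h \<in> Arr C" "Dom C h = E" "Cod C h = E'" "h \<cdot> i = i'" "p' \<cdot> h = p"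
  shows "is_iso C h"
proof -
  have mono: "is_mono C h"
    if "abelian_category C" and e: "short_exact C P i E p Q" and e': "short_exact C P i' E' p' Q"
    and h: "h \<in> Arr C" "Dom C h = E" "Cod C h = E'" "h \<cdot>\<^bsub>C\<^esub> i = i'" "p' \<cdot>\<^bsub>C\<^esub> h = p"
    for C :: "('o, 'm, 'y) preadditive_category_scheme" and P Q i p i' p' E E' h
  proof -
    interpret abelian_category C by fact
    note D = short_exactD[OF e]
    note D' = short_exactD[OF e']
    show ?thesis
    proof (rule monoI)
      fix t
      assume t: "t \<in> Arr C" "Cod C t = Dom C h" "h \<cdot>\<^bsub>C\<^esub> t = Zero C (Dom C t) (Cod C h)"
      have "p \<cdot>\<^bsub>C\<^esub> t = p' \<cdot>\<^bsub>C\<^esub> (h \<cdot>\<^bsub>C\<^esub> t)"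
        using Comp_eq_extend[OF h(5)] t(1,2) h(1-3) D' by simp
      also have "\<dots> = Zero C (Dom C t) Q"
        unfolding t(3) using D' h t by auto
      finally obtain u where u: "u \<in> Arr C" "Dom C u = Dom C t" "Cod C u = P" "i \<cdot>\<^bsub>C\<^esub> u = t"
        using short_exact_lift[OF e, of t] t h by auto
      have "i' \<cdot>\<^bsub>C\<^esub> u = h \<cdot>\<^bsub>C\<^esub> t"
        unfolding u(4)[symmetric] using Comp_eq_extend[OF h(4)] u(1-3) h(1-3) D by simp
      then have "u = Zero C (Dom C u) P"
        using mono_zero[OF D'(8), of u] u(1-3) t(3) D' h by simp
      then have "t = i \<cdot>\<^bsub>C\<^esub> Zero C (Dom C u) P"
        using u(4) by simp
      then show "t = Zero C (Dom C t) (Dom C h)"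
        using D h u by auto
    qed fact
  qed
  have "is_mono C h"
    by (rule mono[OF abelian_category_axioms e e']) fact+
  moreover have "is_mono (opposite C) h"
    using mono[OF abelian_opposite, of Q p' E' i' P p E i h] e e' h
    by (simp add: short_exact_opposite)
  ultimately show ?thesis
    using mono_epi_iso by (simp add: mono_opposite)
qed

text \<open>Stated for an arbitrary fibre product, because it also yields the extensions \<open>R \<rightarrow> Y \<rightarrow> G\<close> and
  \<open>S \<rightarrow> Y \<rightarrow> F\<close>.\<close>

lemma pullback_extension:
  assumes e: "short_exact C P i E p Q" and pb: "is_pullback C p \<psi> h p'"
    and i': "i' \<in> Arr C" "Dom C i' = P" "Cod C i' = Dom C h" "h \<cdot> i' = i"
      "p' \<cdot> i' = Zero C P (Dom C \<psi>)"
  shows "short_exact C P i' (Dom C h) p' (Dom C \<psi>)"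
proof -
  note D = short_exactD[OF e]
  note B = pullbackD[OF pb]
  have "is_mono C i'"
  proof (rule monoI)
    fix t
    assume t: "t \<in> Arr C" "Cod C t = Dom C i'" "i' \<cdot> t = Zero C (Dom C t) (Cod C i')"
    have "i \<cdot> t = h \<cdot> (i' \<cdot> t)"
      using Comp_eq_extend[OF i'(4)] t(1,2) i'(1-3) B by simp
    also have "\<dots> = Zero C (Dom C t) E"
      unfolding t(3) using D i' B t by auto
    finally show "t = Zero C (Dom C t) (Dom C i')"
      using mono_zero[OF D(8), of t] D t i' by simp
  qed fact
  then have "is_kernel C i' p'"
  proof (rule kernelI)
    fix t
    assume t: "t \<in> Arr C" "Cod C t = Dom C p'" "p' \<cdot> t = Zero C (Dom C t) (Cod C p')"
    have "p \<cdot> (h \<cdot> t) = \<psi> \<cdot> (p' \<cdot> t)"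
      by (rule Comp_eq_extend2[OF B(9)]) (use B t in auto)
    also have "\<dots> = Zero C (Dom C t) Q"
      unfolding t(3) using B D t by auto
    finally obtain u where u: "u \<in> Arr C" "Dom C u = Dom C t" "Cod C u = P" "i \<cdot> u = h \<cdot> t"
      using short_exact_lift[OF e, of "h \<cdot> t"] B D t by auto
    have "i' \<cdot> u = t"
    proof (rule pullback_eqI[OF pb])
      show "h \<cdot> (i' \<cdot> u) = h \<cdot> t"
        using Comp_eq_extend[OF i'(4), of u] u i'(1-3) B by simp
      have "p' \<cdot> (i' \<cdot> u) = Zero C P (Dom C \<psi>) \<cdot> u"
        by (rule Comp_eq_extend[OF i'(5)]) (use u i'(1-3) B in auto)
      then show "p' \<cdot> (i' \<cdot> u) = p' \<cdot> t"
        using t u B by auto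
    qed (use u i' t B in auto)
    then show "\<exists>u. u \<in> Arr C \<and> Dom C u = Dom C t \<and> Cod C u = Dom C i' \<and> i' \<cdot> u = t"
      using u i' by auto
  qed (use i' B in auto)
  moreover have "is_epi C p'"
    using pullback_epi[OF pb] D by simp
  ultimately show ?thesis
    using short_exactI i' B by simp
qed

lemma extension_pullback_exists:
  assumes e: "short_exact C P i E p Q" and \<psi>: "\<psi> \<in> Arr C" "Cod C \<psi> = Q"
  obtains i' E' p' h where "short_exact C P i' E' p' (Dom C \<psi>)" "is_pullback C p \<psi> h p'"
    "Dom C h = E'" "h \<cdot> i' = i"
proof -
  note D = short_exactD[OF e]
  obtain h p' where pb: "is_pullback C p \<psi> h p'"
    using pullback_exists[of p \<psi>] D \<psi> by metis
  note B = pullbackD[OF pb]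
  obtain i' where i': "i' \<in> Arr C" "Dom C i' = P" "Cod C i' = Dom C h" "h \<cdot> i' = i"
      "p' \<cdot> i' = Zero C P (Dom C \<psi>)"
    using pullback_lift_ex[OF pb, of i "Zero C P (Dom C \<psi>)"] D \<psi> by auto
  show ?thesis
    using that[OF pullback_extension[OF e pb i'] pb refl i'(4)] .
qed

text \<open>The square is compared with a chosen fibre product, which is an extension with the same ends,
  by the short five lemma.\<close>

lemma mor_pullback:
  assumes e: "short_exact C P i E p Q" and e': "short_exact C P i' E' p' Q'"
    and h: "h \<in> Arr C" "Dom C h = E'" "Cod C h = E" "h \<cdot> i' = i"
    and \<psi>: "\<psi> \<in> Arr C" "Dom C \<psi> = Q'" "Cod C \<psi> = Q" "p \<cdot> h = \<psi> \<cdot> p'"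
  shows "is_pullback C p \<psi> h p'"
proof -
  note D = short_exactD[OF e]
  note D' = short_exactD[OF e']
  obtain j W b a where w: "short_exact C P j W b Q'" and pb: "is_pullback C p \<psi> a b"
    and a: "Dom C a = W" "a \<cdot> j = i"
    using extension_pullback_exists[OF e \<psi>(1,3)] unfolding \<psi>(2) by metis
  note W = short_exactD[OF w]
  note B = pullbackD[OF pb]
  obtain u where u: "u \<in> Arr C" "Dom C u = E'" "Cod C u = W" "a \<cdot> u = h" "b \<cdot> u = p'"
    using pullback_lift_ex[OF pb, of h p'] h \<psi> D D' a by metis
  have "u \<cdot> i' = j"
  proof (rule pullback_eqI[OF pb])
    show "a \<cdot> (u \<cdot> i') = a \<cdot> j"
      using Comp_eq_extend[OF u(4)] u(1-3) B a D' h by simp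
    show "b \<cdot> (u \<cdot> i') = b \<cdot> j"
      using Comp_eq_extend[OF u(5)] u(1-3) W a D' by simp
  qed (use u D' W a in auto)
  then have "is_iso C u"
    using five_lemma[OF e' w u(1-3)] u(5) by simp
  then obtain v where v: "v \<in> Arr C" "Dom C v = W" "Cod C v = E'" "v \<cdot> u = Id C E'" "u \<cdot> v = Id C W"
    using u by (auto simp: is_iso_def)
  show ?thesis
  proof (rule pullbackI)
    fix x y
    assume xy: "x \<in> Arr C" "y \<in> Arr C" "Dom C y = Dom C x" "Cod C x = Dom C p" "Cod C y = Dom C \<psi>"
      "p \<cdot> x = \<psi> \<cdot> y"
    obtain t where t: "t \<in> Arr C" "Dom C t = Dom C x" "Cod C t = W" "a \<cdot> t = x" "b \<cdot> t = y"
      using pullback_lift_ex[OF pb xy] a by metis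
    have uvt: "u \<cdot> (v \<cdot> t) = t"
      using Comp_eq_extend[OF v(5)] v(1-3) u(1-3) t by simp
    have "h \<cdot> (v \<cdot> t) = x"
      using Comp_eq_extend[OF u(4), of "v \<cdot> t"] uvt u(1-3) v(1-3) t a B D by simp
    moreover have "p' \<cdot> (v \<cdot> t) = y"
      using Comp_eq_extend[OF u(5), of "v \<cdot> t"] uvt u(1-3) v(1-3) t W by simp
    ultimately show "\<exists>u. u \<in> Arr C \<and> Dom C u = Dom C x \<and> Cod C u = Dom C h \<and> h \<cdot> u = x \<and> p' \<cdot> u = y"
      using v(1-3) t(1-3) h by (intro exI[of _ "v \<cdot> t"]) auto
  next
    fix s t
    assume st: "h \<cdot> s = h \<cdot> t" "p' \<cdot> s = p' \<cdot> t" "s \<in> Arr C" "t \<in> Arr C" "Dom C t = Dom C s"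
        "Cod C s = Dom C h" "Cod C t = Dom C h"
    have "u \<cdot> s = u \<cdot> t"
    proof (rule pullback_eqI[OF pb])
      show "a \<cdot> (u \<cdot> s) = a \<cdot> (u \<cdot> t)"
        using Comp_eq_extend[OF u(4), of s] Comp_eq_extend[OF u(4), of t] u(1-3) B a D h st by simp
      show "b \<cdot> (u \<cdot> s) = b \<cdot> (u \<cdot> t)"
        using Comp_eq_extend[OF u(5), of s] Comp_eq_extend[OF u(5), of t] u(1-3) W a D h st by simp
    qed (use u st h a in auto)
    then have "v \<cdot> (u \<cdot> s) = v \<cdot> (u \<cdot> t)"
      by simp
    then show "s = t"
      using Comp_eq_extend[OF v(4), of s] Comp_eq_extend[OF v(4), of t] v(1-3) u(1-3) st h by simp
  qed (use D D' h \<psi> in simp_all)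
qed

lemma mor_pushout:
  assumes e: "short_exact C P i E p Q" and e': "short_exact C P' i' E' p' Q"
    and h: "h \<in> Arr C" "Dom C h = E" "Cod C h = E'" "p' \<cdot> h = p"
    and \<phi>: "\<phi> \<in> Arr C" "Dom C \<phi> = P" "Cod C \<phi> = P'" "h \<cdot> i = i' \<cdot> \<phi>"
  shows "is_pushout C i \<phi> h i'"
  using abelian_category.mor_pullback[OF abelian_opposite, of Q p E i P p' E' i' P' h \<phi>] assms
  by (simp add: short_exact_opposite pullback_opposite)

end

text \<open>A morphism of extensions is recorded by its effect on the two ends; the middle map is
  existentially quantified.  Both equivalence of extensions and the operations on classes are
  instances: pushing out along \<open>\<phi>\<close> is the case where the right end map is an identity, and pulling
  back along \<open>\<psi>\<close> the case where the left end map is one.\<close>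

definition ext_mor ::
    "('o, 'm, 'z) preadditive_category_scheme \<Rightarrow> 'm \<Rightarrow> 'm \<Rightarrow> 'm \<times> 'm \<Rightarrow> 'm \<times> 'm \<Rightarrow> bool"
  where "ext_mor C \<phi> \<psi> e e' \<longleftrightarrow> (\<exists>h \<in> Hom C (Cod C (fst e)) (Cod C (fst e')).
    h \<cdot>\<^bsub>C\<^esub> fst e = fst e' \<cdot>\<^bsub>C\<^esub> \<phi> \<and> snd e' \<cdot>\<^bsub>C\<^esub> h = \<psi> \<cdot>\<^bsub>C\<^esub> snd e)"

context abelian_category
begin

lemma extensionE:
  assumes "e \<in> extensions C Q P"
  obtains i E p where "e = (i, p)" "short_exact C P i E p Q"
  using assms by (auto simp: extensions_def)

lemma extensionI: "short_exact C P i E p Q \<Longrightarrow> (i, p) \<in> extensions C Q P"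
  using short_exactD(3) by (auto simp: extensions_def)

lemma extension_ends:
  assumes "e \<in> extensions C Q P"
  shows "Q \<in> Obj C" "P \<in> Obj C"
  using assms short_exactD by (auto elim!: extensionE)

lemma ext_morI:
  assumes "short_exact C P i E p Q" "short_exact C P' i' E' p' Q'"
    and "h \<in> Arr C" "Dom C h = E" "Cod C h = E'" "h \<cdot> i = i' \<cdot> \<phi>" "p' \<cdot> h = \<psi> \<cdot> p"
  shows "ext_mor C \<phi> \<psi> (i, p) (i', p')"
  using assms short_exactD(3)[OF assms(1)] short_exactD(3)[OF assms(2)]
  unfolding ext_mor_def by (intro bexI[of _ h]) auto

lemma ext_morE:
  assumes "ext_mor C \<phi> \<psi> (i, p) (i', p')"
    and "short_exact C P i E p Q" "short_exact C P' i' E' p' Q'"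
  obtains h where "h \<in> Arr C" "Dom C h = E" "Cod C h = E'" "h \<cdot> i = i' \<cdot> \<phi>" "p' \<cdot> h = \<psi> \<cdot> p"
  using assms short_exactD(3)[OF assms(2)] short_exactD(3)[OF assms(3)]
  unfolding ext_mor_def by auto

lemma ext_mor_pullE:
  assumes "ext_mor C (Id C P) \<psi> (i, p) (i', p')"
    and "short_exact C P i E p Q" "short_exact C P i' E' p' Q'"
  obtains h where "h \<in> Arr C" "Dom C h = E" "Cod C h = E'" "h \<cdot> i = i'" "p' \<cdot> h = \<psi> \<cdot> p"
  using ext_morE[OF assms] short_exactD[OF assms(3)] by (metis Comp_Id_Arr)

lemma ext_mor_pushE:
  assumes "ext_mor C \<phi> (Id C Q) (i, p) (i', p')"
    and "short_exact C P i E p Q" "short_exact C P' i' E' p' Q"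
  obtains h where "h \<in> Arr C" "Dom C h = E" "Cod C h = E'" "h \<cdot> i = i' \<cdot> \<phi>" "p' \<cdot> h = p"
  using ext_morE[OF assms] short_exactD[OF assms(2)] by (metis Id_Comp_Arr)

lemma ext_mor_refl:
  assumes "e \<in> extensions C Q P"
  shows "ext_mor C (Id C P) (Id C Q) e e"
proof -
  obtain i E p where e: "e = (i, p)" "short_exact C P i E p Q"
    using assms by (rule extensionE)
  note D = short_exactD[OF e(2)]
  show ?thesis
    unfolding e(1) by (rule ext_morI[OF e(2) e(2), of "Id C E"]) (use D in simp_all)
qed

lemma ext_mor_comp:
  assumes m: "ext_mor C \<phi> \<psi> e e'" "ext_mor C \<phi>' \<psi>' e' e''"
    and "e \<in> extensions C Q P" "e' \<in> extensions C Q' P'" "e'' \<in> extensions C Q'' P''"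
    and \<phi>: "\<phi> \<in> Hom C P P'" "\<psi> \<in> Hom C Q Q'" "\<phi>' \<in> Hom C P' P''" "\<psi>' \<in> Hom C Q' Q''"
  shows "ext_mor C (\<phi>' \<cdot> \<phi>) (\<psi>' \<cdot> \<psi>) e e''"
proof -
  obtain i E p where e: "e = (i, p)" "short_exact C P i E p Q"
    using assms(3) by (rule extensionE)
  obtain i' E' p' where e': "e' = (i', p')" "short_exact C P' i' E' p' Q'"
    using assms(4) by (rule extensionE)
  obtain i'' E'' p'' where e'': "e'' = (i'', p'')" "short_exact C P'' i'' E'' p'' Q''"
    using assms(5) by (rule extensionE)
  obtain h where h: "h \<in> Arr C" "Dom C h = E" "Cod C h = E'" "h \<cdot> i = i' \<cdot> \<phi>" "p' \<cdot> h = \<psi> \<cdot> p"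
    using ext_morE[OF m(1)[unfolded e e'] e(2) e'(2)] .
  obtain k where k: "k \<in> Arr C" "Dom C k = E'" "Cod C k = E''" "k \<cdot> i' = i'' \<cdot> \<phi>'" "p'' \<cdot> k = \<psi>' \<cdot> p'"
    using ext_morE[OF m(2)[unfolded e' e''] e'(2) e''(2)] .
  note D = short_exactD[OF e(2)] short_exactD[OF e'(2)] short_exactD[OF e''(2)]
  have "k \<cdot> (h \<cdot> i) = i'' \<cdot> (\<phi>' \<cdot> \<phi>)"
    unfolding h(4) by (rule Comp_eq_extend2[OF k(4)]) (use k(1-3) D \<phi> in simp_all)
  moreover have "p'' \<cdot> (k \<cdot> h) = \<psi>' \<cdot> (\<psi> \<cdot> p)"
    unfolding h(5)[symmetric] by (rule Comp_eq_extend2[OF k(5)]) (use k(1-3) h(1-3) D \<phi> in simp_all)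
  ultimately show ?thesis
    unfolding e(1) e''(1)
    by (intro ext_morI[OF e(2) e''(2), of "k \<cdot> h"]) (use k(1-3) h(1-3) D \<phi> in simp_all)
qed

text \<open>The pullback of an extension is universal among morphisms of extensions whose right end map factors
  through \<open>\<psi>\<close>.  Uniqueness of pullbacks up to equivalence and the symmetry of equivalence are special
  cases.\<close>

lemma ext_mor_factor_pull:
  assumes m: "ext_mor C (Id C P) \<psi> e' e" "ext_mor C \<chi> (\<psi> \<cdot> \<rho>) d e"
    and "e \<in> extensions C Q P" "e' \<in> extensions C Q' P" "d \<in> extensions C V U"
    and \<phi>: "\<psi> \<in> Hom C Q' Q" "\<chi> \<in> Hom C U P" "\<rho> \<in> Hom C V Q'"
  shows "ext_mor C \<chi> \<rho> d e'"
proof -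
  obtain i E p where e: "e = (i, p)" "short_exact C P i E p Q"
    using assms(3) by (rule extensionE)
  obtain i' E' p' where e': "e' = (i', p')" "short_exact C P i' E' p' Q'"
    using assms(4) by (rule extensionE)
  obtain j M q where d: "d = (j, q)" "short_exact C U j M q V"
    using assms(5) by (rule extensionE)
  note D = short_exactD[OF e(2)]
  note D' = short_exactD[OF e'(2)]
  note Dd = short_exactD[OF d(2)]
  obtain h where h: "h \<in> Arr C" "Dom C h = E'" "Cod C h = E" "h \<cdot> i' = i" "p \<cdot> h = \<psi> \<cdot> p'"
    using ext_mor_pullE[OF m(1)[unfolded e e'] e'(2) e(2)] .
  obtain k where k: "k \<in> Arr C" "Dom C k = M" "Cod C k = E" "k \<cdot> j = i \<cdot> \<chi>" "p \<cdot> k = (\<psi> \<cdot> \<rho>) \<cdot> q"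
    using ext_morE[OF m(2)[unfolded e d] d(2) e(2)] .
  have pb: "is_pullback C p \<psi> h p'"
    by (rule mor_pullback[OF e(2) e'(2)]) (use h \<phi> in simp_all)
  have "p \<cdot> k = \<psi> \<cdot> (\<rho> \<cdot> q)"
    using k(5) \<phi> Dd by simp
  then obtain u where u: "u \<in> Arr C" "Dom C u = M" "Cod C u = E'" "h \<cdot> u = k" "p' \<cdot> u = \<rho> \<cdot> q"
    using pullback_lift_ex[OF pb, of k "\<rho> \<cdot> q"] k(1-3) \<phi> Dd D h(1-3) by auto
  have "u \<cdot> j = i' \<cdot> \<chi>"
  proof (rule pullback_eqI[OF pb])
    show "h \<cdot> (u \<cdot> j) = h \<cdot> (i' \<cdot> \<chi>)"
      using Comp_eq_extend[OF u(4), of j] Comp_eq_extend[OF h(4), of \<chi>] k(4) u(1-3) h(1-3) D D' Dd \<phi>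
      by simp
    have "p' \<cdot> (u \<cdot> j) = \<rho> \<cdot> (q \<cdot> j)"
      by (rule Comp_eq_extend2[OF u(5)]) (use u(1-3) D' Dd \<phi> in simp_all)
    also have "\<dots> = Zero C U Q'"
      unfolding Dd(7) using Dd \<phi> by simp
    also have "\<dots> = Zero C P Q' \<cdot> \<chi>"
      using D' \<phi> by simp
    also have "\<dots> = p' \<cdot> (i' \<cdot> \<chi>)"
      by (rule Comp_eq_extend[OF D'(7), symmetric]) (use D' \<phi> in simp_all)
    finally show "p' \<cdot> (u \<cdot> j) = p' \<cdot> (i' \<cdot> \<chi>)" .
  qed (use u(1-3) h(1-3) D' Dd \<phi> in simp_all)
  then show ?thesis
    unfolding d(1) e'(1) using u by (intro ext_morI[OF d(2) e'(2), of u])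
qed

lemma extensions_opposite:
  "e \<in> extensions C Q P \<longleftrightarrow> prod.swap e \<in> extensions (opposite C) P Q"
proof (cases e)
  case (Pair i p)
  have "short_exact C P i (Cod C i) p Q \<longleftrightarrow> short_exact C P i (Dom C p) p Q"
    using short_exactD(3,5)[of P i _ p Q] by metis
  then show ?thesis
    by (simp add: Pair extensions_def short_exact_opposite)
qed

lemma ext_mor_opposite:
  assumes "e \<in> extensions C Q P" "e' \<in> extensions C Q' P'"
  shows "ext_mor (opposite C) \<psi> \<phi> (prod.swap e') (prod.swap e) \<longleftrightarrow> ext_mor C \<phi> \<psi> e e'"
proof -
  have "Dom C (snd e) = Cod C (fst e)" "Dom C (snd e') = Cod C (fst e')"
    using assms short_exactD(3,5) by (auto elim!: extensionE)
  then show ?thesis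
    by (auto simp: ext_mor_def)
qed

lemma ext_mor_factor_push:
  assumes "ext_mor C \<phi> (Id C Q) e e'" "ext_mor C (\<chi> \<cdot> \<phi>) \<psi> e d"
    and "e \<in> extensions C Q P" "e' \<in> extensions C Q P'" "d \<in> extensions C V U"
    and "\<phi> \<in> Hom C P P'" "\<chi> \<in> Hom C P' U" "\<psi> \<in> Hom C Q V"
  shows "ext_mor C \<chi> \<psi> e' d"
  using abelian_category.ext_mor_factor_pull[OF abelian_opposite, of Q \<phi> "prod.swap e'" "prod.swap e"
      \<psi> \<chi> "prod.swap d" P P' U V] assms
    ext_mor_opposite[OF assms(3,4)] ext_mor_opposite[OF assms(3,5)] ext_mor_opposite[OF assms(4,5)]
  by (simp add: extensions_opposite[symmetric])

lemma ext_pull_exists: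
  assumes "e \<in> extensions C Q P" "\<psi> \<in> Hom C Q' Q"
  obtains e' where "e' \<in> extensions C Q' P" "ext_mor C (Id C P) \<psi> e' e"
proof -
  obtain i E p where e: "e = (i, p)" "short_exact C P i E p Q"
    using assms(1) by (rule extensionE)
  have \<psi>: "\<psi> \<in> Arr C" "Cod C \<psi> = Q" "Dom C \<psi> = Q'"
    using assms(2) by auto
  obtain i' E' p' h where e': "short_exact C P i' E' p' Q'" and pb: "is_pullback C p \<psi> h p'"
      and h: "Dom C h = E'" "h \<cdot> i' = i"
    using extension_pullback_exists[OF e(2) \<psi>(1,2)] unfolding \<psi>(3) by metis
  have "ext_mor C (Id C P) \<psi> (i', p') (i, p)"
    by (rule ext_morI[OF e' e(2), of h])
      (use pullbackD[OF pb] h short_exactD[OF e(2)] in simp_all)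
  then show ?thesis
    using that extensionI[OF e'] e(1) by blast
qed

lemma ext_push_exists:
  assumes "e \<in> extensions C Q P" "\<phi> \<in> Hom C P P'"
  obtains e' where "e' \<in> extensions C Q P'" "ext_mor C \<phi> (Id C Q) e e'"
proof -
  obtain x where x: "x \<in> extensions (opposite C) P' Q"
      "ext_mor (opposite C) (Id C Q) \<phi> x (prod.swap e)"
    using abelian_category.ext_pull_exists[OF abelian_opposite, of "prod.swap e" P Q \<phi> P'] assms
    by (auto simp: extensions_opposite[symmetric])
  have "prod.swap x \<in> extensions C Q P'"
    using x(1) by (simp add: extensions_opposite)
  then show ?thesis
    using that[of "prod.swap x"] x(2) ext_mor_opposite[OF assms(1), of "prod.swap x" Q P'] by simp
qed

section \<open>Classes of extensions\<close>

lemma ext_mor_Id_sym: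
  assumes "ext_mor C (Id C P) (Id C Q) e e'" "e \<in> extensions C Q P" "e' \<in> extensions C Q P"
  shows "ext_mor C (Id C P) (Id C Q) e' e"
  by (rule ext_mor_factor_pull[OF assms(1) _ assms(3,2,3)])
    (use ext_mor_refl[OF assms(3)] extension_ends[OF assms(3)] in simp_all)

text \<open>By the five lemma the middle map of a morphism that is the identity on both ends is invertible.\<close>

lemma ext_class_eq_Collect:
  assumes "e \<in> extensions C Q P"
  shows "ext_class C e = {e' \<in> extensions C Q P. ext_mor C (Id C P) (Id C Q) e e'}"
proof -
  obtain i E p where e: "e = (i, p)" "short_exact C P i E p Q"
    using assms by (rule extensionE)
  note D = short_exactD[OF e(2)]
  have "ext_equiv C (i, p) e' \<longleftrightarrow> ext_mor C (Id C P) (Id C Q) (i, p) e'"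
    if e'_in: "e' \<in> extensions C Q P" for e'
  proof -
    obtain i' E' p' where e': "e' = (i', p')" "short_exact C P i' E' p' Q"
      using e'_in by (rule extensionE)
    note D' = short_exactD[OF e'(2)]
    show ?thesis
      unfolding e'(1)
    proof
      assume "ext_equiv C (i, p) (i', p')"
      then obtain h where h: "h \<in> Hom C (Cod C i) (Cod C i')" "h \<cdot> i = i'" "p' \<cdot> h = p"
        unfolding ext_equiv_def by blast
      then show "ext_mor C (Id C P) (Id C Q) (i, p) (i', p')"
        by (intro ext_morI[OF e(2) e'(2), of h]) (use D D' in simp_all)
    next
      assume m: "ext_mor C (Id C P) (Id C Q) (i, p) (i', p')"
      obtain h where h: "h \<in> Arr C" "Dom C h = E" "Cod C h = E'" "h \<cdot> i = i'" "p' \<cdot> h = Id C Q \<cdot> p"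
        using ext_mor_pullE[OF m e(2) e'(2)] .
      have ph: "p' \<cdot> h = p"
        using h(5) D(4,6) by simp
      have "is_iso C h"
        using five_lemma[OF e(2) e'(2) h(1-4) ph] .
      then show "ext_equiv C (i, p) (i', p')"
        unfolding ext_equiv_def prod.case
        by (intro bexI[of _ h] conjI h(4) ph) (use h(1-3) D(3) D'(3) in simp_all)
    qed
  qed
  then show ?thesis
    unfolding e(1) ext_class_def prod.case D(2,6) by blast
qed

lemma ext_class_self:
  "e \<in> extensions C Q P \<Longrightarrow> e \<in> ext_class C e"
  using ext_class_eq_Collect ext_mor_refl by simp

lemma ext_class_eq_iff:
  assumes "e \<in> extensions C Q P" "e' \<in> extensions C Q P"
  shows "ext_class C e = ext_class C e' \<longleftrightarrow> ext_mor C (Id C P) (Id C Q) e e'"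
proof
  assume "ext_class C e = ext_class C e'"
  then show "ext_mor C (Id C P) (Id C Q) e e'"
    using ext_class_self[OF assms(2)] ext_class_eq_Collect[OF assms(1)] by auto
next
  note I = extension_ends[OF assms(1)]
  assume m: "ext_mor C (Id C P) (Id C Q) e e'"
  note m' = ext_mor_Id_sym[OF m assms]
  have "ext_mor C (Id C P) (Id C Q) e x \<longleftrightarrow> ext_mor C (Id C P) (Id C Q) e' x"
    if "x \<in> extensions C Q P" for x
    using ext_mor_comp[OF m _ assms that] ext_mor_comp[OF m' _ assms(2,1) that] I by auto
  then show "ext_class C e = ext_class C e'"
    using ext_class_eq_Collect[OF assms(1)] ext_class_eq_Collect[OF assms(2)] by auto
qed

text \<open>An extension belongs to the pushed-out class exactly if it receives a morphism over \<open>\<phi>\<close> from some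
  representative, hence from \<open>e\<close>, hence, by the universal property, an equivalence from \<open>e'\<close>.\<close>

lemma ext_push_class:
  assumes m: "ext_mor C \<phi> (Id C Q) e e'"
    and e: "e \<in> extensions C Q P" and e': "e' \<in> extensions C Q P'" and \<phi>: "\<phi> \<in> Hom C P P'"
  shows "ext_push C \<phi> (ext_class C e) = ext_class C e'"
proof -
  note I = extension_ends[OF e] extension_ends[OF e']
  have 1: "x \<in> ext_push C \<phi> (ext_class C e) \<longleftrightarrow>
      x \<in> extensions C Q P' \<and> (\<exists>d \<in> ext_class C e. ext_mor C \<phi> (Id C Q) d x)" for x
  proof -
    have "(\<exists>h. x \<in> extensions C (Cod C (snd d)) P' \<and> is_pushout C (fst d) \<phi> h (fst x) \<and> snd x \<cdot> h = snd d)
        \<longleftrightarrow> x \<in> extensions C Q P' \<and> ext_mor C \<phi> (Id C Q) d x"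
      if d: "d \<in> extensions C Q P" for d
    proof -
      obtain j M q where d: "d = (j, q)" "short_exact C P j M q Q"
        using d by (rule extensionE)
      note D = short_exactD[OF d(2)]
      show ?thesis
      proof (cases "x \<in> extensions C Q P'")
        case True
        then obtain i' E' p' where x: "x = (i', p')" "short_exact C P' i' E' p' Q"
          by (rule extensionE)
        note Dx = short_exactD[OF x(2)]
        have "(\<exists>h. is_pushout C j \<phi> h i' \<and> p' \<cdot> h = q) \<longleftrightarrow> ext_mor C \<phi> (Id C Q) (j, q) (i', p')"
        proof
          assume "\<exists>h. is_pushout C j \<phi> h i' \<and> p' \<cdot> h = q"
          then obtain h where "h \<in> Hom C (Cod C j) (Cod C h)" "i' \<in> Hom C (Cod C \<phi>) (Cod C h)"
              "h \<cdot> j = i' \<cdot> \<phi>" "p' \<cdot> h = q"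
            unfolding is_pushout_def by blast
          then show "ext_mor C \<phi> (Id C Q) (j, q) (i', p')"
            by (intro ext_morI[OF d(2) x(2), of h]) (use D Dx in auto)
        next
          assume m: "ext_mor C \<phi> (Id C Q) (j, q) (i', p')"
          obtain h where h: "h \<in> Arr C" "Dom C h = M" "Cod C h = E'" "h \<cdot> j = i' \<cdot> \<phi>" "p' \<cdot> h = q"
            using ext_mor_pushE[OF m d(2) x(2)] .
          then show "\<exists>h. is_pushout C j \<phi> h i' \<and> p' \<cdot> h = q"
            using mor_pushout[OF d(2) x(2), of h \<phi>] \<phi> by auto
        qed
        then show ?thesis
          using True d(1) x(1) D(6) by simp
      qed (use d(1) D(6) in simp)
    qed
    moreover have "ext_class C e \<subseteq> extensions C Q P"
      using ext_class_eq_Collect[OF e] by auto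
    moreover have "x \<in> ext_push C \<phi> (ext_class C e) \<longleftrightarrow> (\<exists>d \<in> ext_class C e. \<exists>h.
        x \<in> extensions C (Cod C (snd d)) P' \<and> is_pushout C (fst d) \<phi> h (fst x) \<and> snd x \<cdot> h = snd d)"
      using \<phi> by (cases x) (simp add: ext_push_def case_prod_beta)
    ultimately show ?thesis by blast
  qed
  have 2: "(\<exists>d \<in> ext_class C e. ext_mor C \<phi> (Id C Q) d x) \<longleftrightarrow> ext_mor C (Id C P') (Id C Q) e' x"
    if x: "x \<in> extensions C Q P'" for x
  proof
    assume "\<exists>d \<in> ext_class C e. ext_mor C \<phi> (Id C Q) d x"
    then obtain d where d: "d \<in> extensions C Q P" "ext_mor C (Id C P) (Id C Q) e d"
        "ext_mor C \<phi> (Id C Q) d x"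
      using ext_class_eq_Collect[OF e] by auto
    have "ext_mor C \<phi> (Id C Q) e x"
      using ext_mor_comp[OF d(2,3) e d(1) x] \<phi> I by simp
    then show "ext_mor C (Id C P') (Id C Q) e' x"
      by (intro ext_mor_factor_push[OF m _ e e' x]) (use \<phi> I in simp_all)
  next
    assume "ext_mor C (Id C P') (Id C Q) e' x"
    then have "ext_mor C \<phi> (Id C Q) e x"
      using ext_mor_comp[OF m _ e e' x, of "Id C P'" "Id C Q"] \<phi> I by simp
    then show "\<exists>d \<in> ext_class C e. ext_mor C \<phi> (Id C Q) d x"
      using ext_class_self[OF e] by blast
  qed
  show ?thesis
    using 1 2 ext_class_eq_Collect[OF e'] by blast
qed

lemma ext_pull_class:
  assumes m: "ext_mor C (Id C P) \<psi> e' e"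
    and e: "e \<in> extensions C Q P" and e': "e' \<in> extensions C Q' P" and \<psi>: "\<psi> \<in> Hom C Q' Q"
  shows "ext_pull C \<psi> (ext_class C e) = ext_class C e'"
proof -
  note I = extension_ends[OF e] extension_ends[OF e']
  have 1: "x \<in> ext_pull C \<psi> (ext_class C e) \<longleftrightarrow>
      x \<in> extensions C Q' P \<and> (\<exists>d \<in> ext_class C e. ext_mor C (Id C P) \<psi> x d)" for x
  proof -
    have "(\<exists>h. x \<in> extensions C Q' (Dom C (fst d)) \<and> is_pullback C (snd d) \<psi> h (snd x) \<and> h \<cdot> fst x = fst d)
        \<longleftrightarrow> x \<in> extensions C Q' P \<and> ext_mor C (Id C P) \<psi> x d"
      if d: "d \<in> extensions C Q P" for d
    proof -
      obtain j M q where d: "d = (j, q)" "short_exact C P j M q Q"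
        using d by (rule extensionE)
      note D = short_exactD[OF d(2)]
      show ?thesis
      proof (cases "x \<in> extensions C Q' P")
        case True
        then obtain i' E' p' where x: "x = (i', p')" "short_exact C P i' E' p' Q'"
          by (rule extensionE)
        note Dx = short_exactD[OF x(2)]
        have "(\<exists>h. is_pullback C q \<psi> h p' \<and> h \<cdot> i' = j) \<longleftrightarrow> ext_mor C (Id C P) \<psi> (i', p') (j, q)"
        proof
          assume "\<exists>h. is_pullback C q \<psi> h p' \<and> h \<cdot> i' = j"
          then obtain h where pb: "is_pullback C q \<psi> h p'" and "h \<cdot> i' = j"
            by blast
          then show "ext_mor C (Id C P) \<psi> (i', p') (j, q)"
            by (intro ext_morI[OF x(2) d(2), of h]) (use pullbackD[OF pb] D Dx in auto)
        next
          assume m: "ext_mor C (Id C P) \<psi> (i', p') (j, q)"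
          obtain h where h: "h \<in> Arr C" "Dom C h = E'" "Cod C h = M" "h \<cdot> i' = j" "q \<cdot> h = \<psi> \<cdot> p'"
            using ext_mor_pullE[OF m x(2) d(2)] .
          then show "\<exists>h. is_pullback C q \<psi> h p' \<and> h \<cdot> i' = j"
            using mor_pullback[OF d(2) x(2), of h \<psi>] \<psi> by auto
        qed
        then show ?thesis
          using True d(1) x(1) D(2) by simp
      qed (use d(1) D(2) in simp)
    qed
    moreover have "ext_class C e \<subseteq> extensions C Q P"
      using ext_class_eq_Collect[OF e] by auto
    moreover have "x \<in> ext_pull C \<psi> (ext_class C e) \<longleftrightarrow> (\<exists>d \<in> ext_class C e. \<exists>h.
        x \<in> extensions C Q' (Dom C (fst d)) \<and> is_pullback C (snd d) \<psi> h (snd x) \<and> h \<cdot> fst x = fst d)"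
      using \<psi> by (cases x) (simp add: ext_pull_def case_prod_beta)
    ultimately show ?thesis by blast
  qed
  have 2: "(\<exists>d \<in> ext_class C e. ext_mor C (Id C P) \<psi> x d) \<longleftrightarrow> ext_mor C (Id C P) (Id C Q') e' x"
    if x: "x \<in> extensions C Q' P" for x
  proof
    assume "\<exists>d \<in> ext_class C e. ext_mor C (Id C P) \<psi> x d"
    then obtain d where d: "d \<in> extensions C Q P" "ext_mor C (Id C P) (Id C Q) e d"
        "ext_mor C (Id C P) \<psi> x d"
      using ext_class_eq_Collect[OF e] by auto
    have "ext_mor C (Id C P) \<psi> x e"
      using ext_mor_comp[OF d(3) ext_mor_Id_sym[OF d(2) e d(1)] x d(1) e] \<psi> I by simp
    then have "ext_mor C (Id C P) (Id C Q') x e'"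
      by (intro ext_mor_factor_pull[OF m _ e e' x]) (use \<psi> I in simp_all)
    then show "ext_mor C (Id C P) (Id C Q') e' x"
      using ext_mor_Id_sym x e' by blast
  next
    assume "ext_mor C (Id C P) (Id C Q') e' x"
    then have "ext_mor C (Id C P) \<psi> x e"
      using ext_mor_comp[OF ext_mor_Id_sym[of P Q' e' x] m x e' e] e' x \<psi> I by simp
    then show "\<exists>d \<in> ext_class C e. ext_mor C (Id C P) \<psi> x d"
      using ext_class_self[OF e] by blast
  qed
  show ?thesis
    using 1 2 ext_class_eq_Collect[OF e'] by blast
qed

end

section \<open>Direct sums of extensions\<close>

definition pair ::
    "('o, 'm, 'z) preadditive_category_scheme \<Rightarrow> 'o \<Rightarrow> 'o \<Rightarrow> 'm \<Rightarrow> 'm \<Rightarrow> 'm"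
  where "pair C A B f g = (inj1 C A B \<cdot>\<^bsub>C\<^esub> f) \<boxplus>\<^bsub>C\<^esub> (inj2 C A B \<cdot>\<^bsub>C\<^esub> g)"

context abelian_category
begin

lemma pair_simps [simp]:
  assumes "f \<in> Arr C" "g \<in> Arr C" "Cod C f = A" "Cod C g = B" "Dom C g = Dom C f"
  shows "pair C A B f g \<in> Arr C" "Dom C (pair C A B f g) = Dom C f"
    "Cod C (pair C A B f g) = dsum C A B"
    "proj1 C A B \<cdot> pair C A B f g = f" "proj2 C A B \<cdot> pair C A B f g = g"
proof -
  have "A \<in> Obj C" "B \<in> Obj C"
    using assms by auto
  then show "pair C A B f g \<in> Arr C" "Dom C (pair C A B f g) = Dom C f"
    "Cod C (pair C A B f g) = dsum C A B"
    "proj1 C A B \<cdot> pair C A B f g = f" "proj2 C A B \<cdot> pair C A B f g = g"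
    using assms by (simp_all add: pair_def)
qed

lemma diagonal_eq: "A \<in> Obj C \<Longrightarrow> diagonal C A = pair C A A (Id C A) (Id C A)"
  by (simp add: diagonal_def pair_def)

lemma pair_proj:
  assumes "A \<in> Obj C" "B \<in> Obj C"
  shows "pair C A B (proj1 C A B) (proj2 C A B) = Id C (dsum C A B)"
  by (simp add: pair_def assms)

lemma codiagonal_pair:
  assumes "f \<in> Hom C B A" "g \<in> Hom C B A"
  shows "codiagonal C A \<cdot> pair C A A f g = f \<boxplus> g"
proof -
  have "A \<in> Obj C"
    using assms by auto
  then show ?thesis
    using assms by (simp add: codiagonal_def pair_def)
qed

lemma codiagonal_Hom: "A \<in> Obj C \<Longrightarrow> codiagonal C A \<in> Hom C (dsum C A A) A"
  by (simp add: codiagonal_def)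

lemma diagonal_Hom: "A \<in> Obj C \<Longrightarrow> diagonal C A \<in> Hom C A (dsum C A A)"
  by (simp add: diagonal_eq)

lemma dsum_map_simps [simp]:
  assumes "f \<in> Arr C" "g \<in> Arr C" "Dom C f = A" "Dom C g = B" "Cod C f = A'" "Cod C g = B'"
  shows "dsum_map C A B A' B' f g \<in> Arr C" "Dom C (dsum_map C A B A' B' f g) = dsum C A B"
    "Cod C (dsum_map C A B A' B' f g) = dsum C A' B'"
    "dsum_map C A B A' B' f g \<cdot> inj1 C A B = inj1 C A' B' \<cdot> f"
    "dsum_map C A B A' B' f g \<cdot> inj2 C A B = inj2 C A' B' \<cdot> g"
    "proj1 C A' B' \<cdot> dsum_map C A B A' B' f g = f \<cdot> proj1 C A B"
    "proj2 C A' B' \<cdot> dsum_map C A B A' B' f g = g \<cdot> proj2 C A B"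
proof -
  have "A \<in> Obj C" "B \<in> Obj C" "A' \<in> Obj C" "B' \<in> Obj C"
    using assms by auto
  then show "dsum_map C A B A' B' f g \<in> Arr C" "Dom C (dsum_map C A B A' B' f g) = dsum C A B"
    "Cod C (dsum_map C A B A' B' f g) = dsum C A' B'"
    "dsum_map C A B A' B' f g \<cdot> inj1 C A B = inj1 C A' B' \<cdot> f"
    "dsum_map C A B A' B' f g \<cdot> inj2 C A B = inj2 C A' B' \<cdot> g"
    "proj1 C A' B' \<cdot> dsum_map C A B A' B' f g = f \<cdot> proj1 C A B"
    "proj2 C A' B' \<cdot> dsum_map C A B A' B' f g = g \<cdot> proj2 C A B"
    using assms by (simp_all add: dsum_map_def) (simp_all add: copair_def)
qed

lemma dsum_short_exact:
  assumes e: "short_exact C P i E p Q" and e': "short_exact C P' i' E' p' Q'"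
  shows "short_exact C (dsum C P P') (dsum_map C P P' E E' i i') (dsum C E E')
    (dsum_map C E E' Q Q' p p') (dsum C Q Q')"
proof -
  note D = short_exactD[OF e]
  note D' = short_exactD[OF e']
  let ?i = "dsum_map C P P' E E' i i'" and ?p = "dsum_map C E E' Q Q' p p'"
  have I: "?i \<in> Arr C" "Dom C ?i = dsum C P P'" "Cod C ?i = dsum C E E'"
    and P: "?p \<in> Arr C" "Dom C ?p = dsum C E E'" "Cod C ?p = dsum C Q Q'"
    using D D' by simp_all
  have I1: "proj1 C E E' \<cdot> (?i \<cdot> t) = i \<cdot> (proj1 C P P' \<cdot> t)"
    and I2: "proj2 C E E' \<cdot> (?i \<cdot> t) = i' \<cdot> (proj2 C P P' \<cdot> t)"
    if "t \<in> Arr C" "Cod C t = dsum C P P'" for t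
    by (rule Comp_eq_extend2; use that D D' in simp)+
  have P1: "proj1 C Q Q' \<cdot> (?p \<cdot> t) = p \<cdot> (proj1 C E E' \<cdot> t)"
    and P2: "proj2 C Q Q' \<cdot> (?p \<cdot> t) = p' \<cdot> (proj2 C E E' \<cdot> t)"
    if "t \<in> Arr C" "Cod C t = dsum C E E'" for t
    by (rule Comp_eq_extend2; use that D D' in simp)+
  have zero1: "proj1 C A B \<cdot> Zero C V (dsum C A B) = Zero C V A"
    and zero2: "proj2 C A B \<cdot> Zero C V (dsum C A B) = Zero C V B"
    if "A \<in> Obj C" "B \<in> Obj C" "V \<in> Obj C" for A B V
    using that by simp_all
  have "is_mono C ?i"
  proof (rule monoI)
    fix t
    assume t: "t \<in> Arr C" "Cod C t = Dom C ?i" "?i \<cdot> t = Zero C (Dom C t) (Cod C ?i)"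
    have "i \<cdot> (proj1 C P P' \<cdot> t) = Zero C (Dom C t) E"
      using I1[of t] t I D D' zero1 by simp
    then have 1: "proj1 C P P' \<cdot> t = Zero C (Dom C t) P"
      using mono_zero[OF D(8), of "proj1 C P P' \<cdot> t"] t I D D' by simp
    have "i' \<cdot> (proj2 C P P' \<cdot> t) = Zero C (Dom C t) E'"
      using I2[of t] t I D D' zero2 by simp
    then have 2: "proj2 C P P' \<cdot> t = Zero C (Dom C t) P'"
      using mono_zero[OF D'(8), of "proj2 C P P' \<cdot> t"] t I D D' by simp
    show "t = Zero C (Dom C t) (Dom C ?i)"
      by (rule dsum_eqI[of P P']) (use 1 2 t I D D' in simp_all)
  qed fact
  then have "is_kernel C ?i ?p"
  proof (rule kernelI)
    show "?p \<cdot> ?i = Zero C (Dom C ?i) (Cod C ?p)"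
    proof (rule dsum_eqI[of Q Q'])
      show "proj1 C Q Q' \<cdot> (?p \<cdot> ?i) = proj1 C Q Q' \<cdot> Zero C (Dom C ?i) (Cod C ?p)"
        using P1[of ?i] Comp_eq_extend[OF D(7), of "proj1 C P P'"] I P D D' by simp
      show "proj2 C Q Q' \<cdot> (?p \<cdot> ?i) = proj2 C Q Q' \<cdot> Zero C (Dom C ?i) (Cod C ?p)"
        using P2[of ?i] Comp_eq_extend[OF D'(7), of "proj2 C P P'"] I P D D' by simp
    qed (use I P D D' in simp_all)
  next
    fix t
    assume t: "t \<in> Arr C" "Cod C t = Dom C ?p" "?p \<cdot> t = Zero C (Dom C t) (Cod C ?p)"
    have "p \<cdot> (proj1 C E E' \<cdot> t) = Zero C (Dom C t) Q"
      using P1[of t] t P D D' zero1 by simp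
    then obtain u where u: "u \<in> Arr C" "Dom C u = Dom C t" "Cod C u = P" "i \<cdot> u = proj1 C E E' \<cdot> t"
      using short_exact_lift[OF e, of "proj1 C E E' \<cdot> t"] t P D D' by auto
    have "p' \<cdot> (proj2 C E E' \<cdot> t) = Zero C (Dom C t) Q'"
      using P2[of t] t P D D' zero2 by simp
    then obtain v where v: "v \<in> Arr C" "Dom C v = Dom C t" "Cod C v = P'" "i' \<cdot> v = proj2 C E E' \<cdot> t"
      using short_exact_lift[OF e', of "proj2 C E E' \<cdot> t"] t P D D' by auto
    have "?i \<cdot> pair C P P' u v = t"
      by (rule dsum_eqI[of E E']) (use I1 I2 u v t I P D D' in simp_all)
    then show "\<exists>u. u \<in> Arr C \<and> Dom C u = Dom C t \<and> Cod C u = Dom C ?i \<and> ?i \<cdot> u = t"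
      using u v I by (intro exI[of _ "pair C P P' u v"]) simp
  qed (use I P in simp_all)
  moreover have "is_epi C ?p"
  proof (rule epiI)
    fix t
    assume t: "t \<in> Arr C" "Dom C t = Cod C ?p" "t \<cdot> ?p = Zero C (Dom C ?p) (Cod C t)"
    have "t \<cdot> (inj1 C Q Q' \<cdot> p) = t \<cdot> (?p \<cdot> inj1 C E E')"
      using D D' by simp
    also have "\<dots> = Zero C (Dom C ?p) (Cod C t) \<cdot> inj1 C E E'"
      by (rule Comp_eq_extend[OF t(3)]) (use t P D D' in simp_all)
    finally have 1: "t \<cdot> inj1 C Q Q' = Zero C Q (Cod C t)"
      using epi_zero[OF D(9), of "t \<cdot> inj1 C Q Q'"] t P D D' by simp
    have "t \<cdot> (inj2 C Q Q' \<cdot> p') = t \<cdot> (?p \<cdot> inj2 C E E')"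
      using D D' by simp
    also have "\<dots> = Zero C (Dom C ?p) (Cod C t) \<cdot> inj2 C E E'"
      by (rule Comp_eq_extend[OF t(3)]) (use t P D D' in simp_all)
    finally have 2: "t \<cdot> inj2 C Q Q' = Zero C Q' (Cod C t)"
      using epi_zero[OF D'(9), of "t \<cdot> inj2 C Q Q'"] t P D D' by simp
    show "t = Zero C (Cod C ?p) (Cod C t)"
      by (rule dsum_coeqI[of _ Q Q']) (use 1 2 t P D D' in simp_all)
  qed fact
  ultimately show ?thesis
    using short_exactI I P by simp
qed

lemma ext_dsum_props:
  assumes e: "e \<in> extensions C Q P" and e': "e' \<in> extensions C Q' P'"
  shows ext_dsum_extension: "ext_dsum C e e' \<in> extensions C (dsum C Q Q') (dsum C P P')"
    and ext_dsum_proj1: "ext_mor C (proj1 C P P') (proj1 C Q Q') (ext_dsum C e e') e"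
    and ext_dsum_proj2: "ext_mor C (proj2 C P P') (proj2 C Q Q') (ext_dsum C e e') e'"
    and ext_dsum_pair: "\<lbrakk>d \<in> extensions C V U; ext_mor C f g d e; ext_mor C f' g' d e';
        f \<in> Hom C U P; f' \<in> Hom C U P'; g \<in> Hom C V Q; g' \<in> Hom C V Q'\<rbrakk>
      \<Longrightarrow> ext_mor C (pair C P P' f f') (pair C Q Q' g g') d (ext_dsum C e e')"
proof -
  obtain i E p where e: "e = (i, p)" "short_exact C P i E p Q"
    using e by (rule extensionE)
  obtain i' E' p' where e': "e' = (i', p')" "short_exact C P' i' E' p' Q'"
    using e' by (rule extensionE)
  note D = short_exactD[OF e(2)]
  note D' = short_exactD[OF e'(2)]
  let ?i = "dsum_map C P P' E E' i i'" and ?p = "dsum_map C E E' Q Q' p p'"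
  have "ext_dsum C (i, p) (i', p') = (?i, ?p)"
    using D D' by (simp add: ext_dsum_def)
  note d = e(1) e'(1) this
  note S = dsum_short_exact[OF e(2) e'(2)]
  show "ext_dsum C e e' \<in> extensions C (dsum C Q Q') (dsum C P P')"
    unfolding d using extensionI[OF S] .
  show "ext_mor C (proj1 C P P') (proj1 C Q Q') (ext_dsum C e e') e"
    unfolding d by (rule ext_morI[OF S e(2), of "proj1 C E E'"]) (use D D' in simp_all)
  show "ext_mor C (proj2 C P P') (proj2 C Q Q') (ext_dsum C e e') e'"
    unfolding d by (rule ext_morI[OF S e'(2), of "proj2 C E E'"]) (use D D' in simp_all)
  assume d_in: "d \<in> extensions C V U" and m: "ext_mor C f g d e" "ext_mor C f' g' d e'"
    and H: "f \<in> Hom C U P" "f' \<in> Hom C U P'" "g \<in> Hom C V Q" "g' \<in> Hom C V Q'"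
  obtain j M q where x: "d = (j, q)" "short_exact C U j M q V"
    using d_in by (rule extensionE)
  note Dx = short_exactD[OF x(2)]
  obtain h where h: "h \<in> Arr C" "Dom C h = M" "Cod C h = E" "h \<cdot> j = i \<cdot> f" "p \<cdot> h = g \<cdot> q"
    using ext_morE[OF m(1)[unfolded e(1) x(1)] x(2) e(2)] .
  obtain h' where h': "h' \<in> Arr C" "Dom C h' = M" "Cod C h' = E'" "h' \<cdot> j = i' \<cdot> f'" "p' \<cdot> h' = g' \<cdot> q"
    using ext_morE[OF m(2)[unfolded e'(1) x(1)] x(2) e'(2)] .
  let ?h = "pair C E E' h h'"
  have H1: "?h \<in> Arr C" "Dom C ?h = M" "Cod C ?h = dsum C E E'"
    using h h' by simp_all
  have "?h \<cdot> j = ?i \<cdot> pair C P P' f f'"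
  proof (rule dsum_eqI[of E E'])
    have "proj1 C E E' \<cdot> (?i \<cdot> pair C P P' f f') = i \<cdot> (proj1 C P P' \<cdot> pair C P P' f f')"
      by (rule Comp_eq_extend2) (use D D' H in simp_all)
    moreover have "proj1 C E E' \<cdot> (?h \<cdot> j) = h \<cdot> j"
      by (rule Comp_eq_extend) (use h(1-3) h'(1-3) D D' Dx in simp_all)
    ultimately show "proj1 C E E' \<cdot> (?h \<cdot> j) = proj1 C E E' \<cdot> (?i \<cdot> pair C P P' f f')"
      using h(4) H by simp
    have "proj2 C E E' \<cdot> (?i \<cdot> pair C P P' f f') = i' \<cdot> (proj2 C P P' \<cdot> pair C P P' f f')"
      by (rule Comp_eq_extend2) (use D D' H in simp_all)
    moreover have "proj2 C E E' \<cdot> (?h \<cdot> j) = h' \<cdot> j"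
      by (rule Comp_eq_extend) (use h(1-3) h'(1-3) D D' Dx in simp_all)
    ultimately show "proj2 C E E' \<cdot> (?h \<cdot> j) = proj2 C E E' \<cdot> (?i \<cdot> pair C P P' f f')"
      using h'(4) H by simp
  qed (use H1 H D D' Dx in simp_all)
  moreover have "?p \<cdot> ?h = pair C Q Q' g g' \<cdot> q"
  proof (rule dsum_eqI[of Q Q'])
    have "proj1 C Q Q' \<cdot> (?p \<cdot> ?h) = p \<cdot> (proj1 C E E' \<cdot> ?h)"
      by (rule Comp_eq_extend2) (use D D' H1 in simp_all)
    moreover have "proj1 C Q Q' \<cdot> (pair C Q Q' g g' \<cdot> q) = g \<cdot> q"
      by (rule Comp_eq_extend) (use H D D' Dx in simp_all)
    ultimately show "proj1 C Q Q' \<cdot> (?p \<cdot> ?h) = proj1 C Q Q' \<cdot> (pair C Q Q' g g' \<cdot> q)"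
      using h h'(1-3) by simp
    have "proj2 C Q Q' \<cdot> (?p \<cdot> ?h) = p' \<cdot> (proj2 C E E' \<cdot> ?h)"
      by (rule Comp_eq_extend2) (use D D' H1 in simp_all)
    moreover have "proj2 C Q Q' \<cdot> (pair C Q Q' g g' \<cdot> q) = g' \<cdot> q"
      by (rule Comp_eq_extend) (use H D D' Dx in simp_all)
    ultimately show "proj2 C Q Q' \<cdot> (?p \<cdot> ?h) = proj2 C Q Q' \<cdot> (pair C Q Q' g g' \<cdot> q)"
      using h' h(1-3) by simp
  qed (use H1 H D D' Dx in simp_all)
  ultimately show "ext_mor C (pair C P P' f f') (pair C Q Q' g g') d (ext_dsum C e e')"
    unfolding d x(1) by (intro ext_morI[OF x(2) S H1])
qed

section \<open>The group of extension classes\<close>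

text \<open>The pullback of the direct sum along the diagonal maps to both summands, so any two extensions of \<open>Q\<close>
  are pushouts of one.\<close>

lemma common_cover:
  assumes e: "e \<in> extensions C Q P" and e': "e' \<in> extensions C Q P'"
  obtains m K f f' where "m \<in> extensions C Q K" "f \<in> Hom C K P" "f' \<in> Hom C K P'"
    "ext_mor C f (Id C Q) m e" "ext_mor C f' (Id C Q) m e'"
proof -
  note I = extension_ends[OF e] extension_ends[OF e']
  note d = ext_dsum_extension[OF e e']
  obtain m where m: "m \<in> extensions C Q (dsum C P P')"
      "ext_mor C (Id C (dsum C P P')) (diagonal C Q) m (ext_dsum C e e')"
    using ext_pull_exists[OF d diagonal_Hom[OF I(1)]] .
  have "ext_mor C (proj1 C P P') (Id C Q) m e"
    using ext_mor_comp[OF m(2) ext_dsum_proj1[OF e e'] m(1) d e] I by (simp add: diagonal_eq)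
  moreover have "ext_mor C (proj2 C P P') (Id C Q) m e'"
    using ext_mor_comp[OF m(2) ext_dsum_proj2[OF e e'] m(1) d e'] I by (simp add: diagonal_eq)
  ultimately show ?thesis
    using that[OF m(1), of "proj1 C P P'" "proj2 C P P'"] I by simp
qed

text \<open>This is what makes the Baer sum computable: if two classes are pushed out from one extension
  along \<open>f\<close> and \<open>f'\<close>, their sum is pushed out from it along \<open>f + f'\<close>.\<close>

lemma baer_sum_class:
  assumes m: "m \<in> extensions C Q K" and f: "f \<in> Hom C K P" "f' \<in> Hom C K P"
    and e: "e \<in> extensions C Q P" "e' \<in> extensions C Q P" "e'' \<in> extensions C Q P"
    and mor: "ext_mor C f (Id C Q) m e" "ext_mor C f' (Id C Q) m e'"
      "ext_mor C (f \<boxplus> f') (Id C Q) m e''"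
  shows "baer_sum C Q P (ext_class C e) (ext_class C e') = ext_class C e''"
proof -
  note I = extension_ends[OF e(1)] extension_ends[OF m]
  have J: "dsum C P P \<in> Obj C" "dsum C Q Q \<in> Obj C"
    using I by simp_all
  let ?s = "ext_dsum C e e'"
  note s = ext_dsum_extension[OF e(1,2)]
  have "ext_class C (ext_dsum C x x') = ext_class C ?s"
    if x: "x \<in> ext_class C e" and x': "x' \<in> ext_class C e'" for x x'
  proof -
    have X: "x \<in> extensions C Q P" "ext_mor C (Id C P) (Id C Q) e x"
      using x ext_class_eq_Collect[OF e(1)] by auto
    have X': "x' \<in> extensions C Q P" "ext_mor C (Id C P) (Id C Q) e' x'"
      using x' ext_class_eq_Collect[OF e(2)] by auto
    have 1: "ext_mor C (proj1 C P P) (proj1 C Q Q) ?s x"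
      using ext_mor_comp[OF ext_dsum_proj1[OF e(1,2)] X(2) s e(1) X(1)] I by simp
    have 2: "ext_mor C (proj2 C P P) (proj2 C Q Q) ?s x'"
      using ext_mor_comp[OF ext_dsum_proj2[OF e(1,2)] X'(2) s e(2) X'(1)] I by simp
    have "ext_mor C (Id C (dsum C P P)) (Id C (dsum C Q Q)) ?s (ext_dsum C x x')"
      using ext_dsum_pair[OF X(1) X'(1) s 1 2] I by (simp add: pair_proj)
    then show ?thesis
      using ext_class_eq_iff[OF s ext_dsum_extension[OF X(1) X'(1)]] by simp
  qed
  then have union: "(\<Union>x\<in>ext_class C e. \<Union>x'\<in>ext_class C e'. ext_class C (ext_dsum C x x'))
      = ext_class C ?s"
    using ext_class_self[OF e(1)] ext_class_self[OF e(2)] by blast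
  obtain d where d: "d \<in> extensions C Q (dsum C P P)"
      "ext_mor C (Id C (dsum C P P)) (diagonal C Q) d ?s"
    using ext_pull_exists[OF s diagonal_Hom[OF I(1)]] .
  obtain x where x: "x \<in> extensions C Q P" "ext_mor C (codiagonal C P) (Id C Q) d x"
    using ext_push_exists[OF d(1) codiagonal_Hom[OF I(2)]] .
  have "baer_sum C Q P (ext_class C e) (ext_class C e') = ext_class C x"
    unfolding baer_sum_def union ext_pull_class[OF d(2) s d(1) diagonal_Hom[OF I(1)]]
    by (rule ext_push_class[OF x(2) d(1) x(1) codiagonal_Hom[OF I(2)]])
  moreover have "ext_class C x = ext_class C e''"
  proof -
    have "ext_mor C (pair C P P f f') (diagonal C Q \<cdot> Id C Q) m ?s"
      using ext_dsum_pair[OF e(1,2) m mor(1,2) f] I f by (simp add: diagonal_eq)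
    then have "ext_mor C (pair C P P f f') (Id C Q) m d"
      by (rule ext_mor_factor_pull[OF d(2) _ s d(1) m]) (use f I diagonal_Hom[OF I(1)] in simp_all)
    then have "ext_mor C (codiagonal C P \<cdot> pair C P P f f') (Id C Q \<cdot> Id C Q) m x"
      by (rule ext_mor_comp[OF _ x(2) m d(1) x(1)])
        (use f I codiagonal_Hom[OF I(2)] in simp_all)
    then have "ext_mor C (Id C P \<cdot> (f \<boxplus> f')) (Id C Q) m x"
      using codiagonal_pair[OF f] f I by simp
    then have "ext_mor C (Id C P) (Id C Q) e'' x"
      by (rule ext_mor_factor_push[OF mor(3) _ m e(3) x(1)]) (use f I in simp_all)
    then show ?thesis
      using ext_class_eq_iff[OF e(3) x(1)] by simp
  qed
  ultimately show ?thesis by simp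
qed

lemma split_short_exact:
  assumes "P \<in> Obj C" "Q \<in> Obj C"
  shows "short_exact C P (inj1 C P Q) (dsum C P Q) (proj2 C P Q) Q"
proof (rule short_exactI)
  have "is_mono C (inj1 C P Q)"
  proof (rule monoI)
    fix t
    assume t: "t \<in> Arr C" "Cod C t = Dom C (inj1 C P Q)"
      "inj1 C P Q \<cdot> t = Zero C (Dom C t) (Cod C (inj1 C P Q))"
    then have "proj1 C P Q \<cdot> (inj1 C P Q \<cdot> t) = Zero C (Dom C t) P"
      using assms by (simp del: proj_inj_Comp)
    then show "t = Zero C (Dom C t) (Dom C (inj1 C P Q))"
      using t(1,2) assms by simp
  qed (use assms in simp)
  then show "is_kernel C (inj1 C P Q) (proj2 C P Q)"
  proof (rule kernelI)
    fix t
    assume t: "t \<in> Arr C" "Cod C t = Dom C (proj2 C P Q)"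
      "proj2 C P Q \<cdot> t = Zero C (Dom C t) (Cod C (proj2 C P Q))"
    have "inj1 C P Q \<cdot> (proj1 C P Q \<cdot> t) = t"
      using dsum_decomp[of P Q t] t assms by simp
    then show "\<exists>u. u \<in> Arr C \<and> Dom C u = Dom C t \<and> Cod C u = Dom C (inj1 C P Q) \<and> inj1 C P Q \<cdot> u = t"
      using t assms by (intro exI[of _ "proj1 C P Q \<cdot> t"]) simp
  qed (use assms in simp_all)
  show "is_epi C (proj2 C P Q)"
  proof (rule epiI)
    fix t
    assume t: "t \<in> Arr C" "Dom C t = Cod C (proj2 C P Q)"
      "t \<cdot> proj2 C P Q = Zero C (Dom C (proj2 C P Q)) (Cod C t)"
    have "t \<cdot> (proj2 C P Q \<cdot> inj2 C P Q) = Zero C (Dom C (proj2 C P Q)) (Cod C t) \<cdot> inj2 C P Q"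
      by (rule Comp_eq_extend[OF t(3)]) (use t(1,2) assms in simp_all)
    then show "t = Zero C (Cod C (proj2 C P Q)) (Cod C t)"
      using t(1,2) assms by simp
  qed (use assms in simp)
qed (use assms in simp_all)

lemma Ext1_carrierE:
  assumes "x \<in> carrier (Ext1 C Q P)"
  obtains e where "e \<in> extensions C Q P" "x = ext_class C e"
  using assms by (auto simp: Ext1_def)

lemma Ext1_carrierI: "e \<in> extensions C Q P \<Longrightarrow> ext_class C e \<in> carrier (Ext1 C Q P)"
  by (auto simp: Ext1_def)

lemma connecting_class:
  assumes "m \<in> extensions C Q K" "e \<in> extensions C Q P" "f \<in> Hom C K P" "ext_mor C f (Id C Q) m e"
  shows "connecting C m f = ext_class C e"
  unfolding connecting_def using ext_push_class[OF assms(4,1,2,3)] .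

lemma connectingE:
  assumes "m \<in> extensions C Q K" "f \<in> Hom C K P"
  obtains e where "e \<in> extensions C Q P" "ext_mor C f (Id C Q) m e" "connecting C m f = ext_class C e"
  using ext_push_exists[OF assms] connecting_class[OF assms(1) _ assms(2)] by metis

lemma connecting_closed:
  assumes "m \<in> extensions C Q K" "f \<in> Hom C K P"
  shows "connecting C m f \<in> carrier (Ext1 C Q P)"
  using connectingE[OF assms] Ext1_carrierI by metis

lemma connecting_Add:
  assumes m: "m \<in> extensions C Q K" and f: "f \<in> Hom C K P" "g \<in> Hom C K P"
  shows "connecting C m f \<otimes>\<^bsub>Ext1 C Q P\<^esub> connecting C m g = connecting C m (f \<boxplus> g)"
proof -
  obtain e where e: "e \<in> extensions C Q P" "ext_mor C f (Id C Q) m e" "connecting C m f = ext_class C e"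
    using connectingE[OF m f(1)] .
  obtain e' where e': "e' \<in> extensions C Q P" "ext_mor C g (Id C Q) m e'" "connecting C m g = ext_class C e'"
    using connectingE[OF m f(2)] .
  have "f \<boxplus> g \<in> Hom C K P"
    using f by simp
  then obtain e'' where e'': "e'' \<in> extensions C Q P" "ext_mor C (f \<boxplus> g) (Id C Q) m e''"
      "connecting C m (f \<boxplus> g) = ext_class C e''"
    using connectingE[OF m] by blast
  show ?thesis
    using baer_sum_class[OF m f e(1) e'(1) e''(1) e(2) e'(2) e''(2)] e(3) e'(3) e''(3)
    by (simp add: Ext1_def)
qed

lemma connecting_Zero:
  assumes m: "m \<in> extensions C Q K" and P: "P \<in> Obj C"
  shows "connecting C m (Zero C K P) = \<one>\<^bsub>Ext1 C Q P\<^esub>"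
proof -
  obtain j M q where x: "m = (j, q)" "short_exact C K j M q Q"
    using m by (rule extensionE)
  note D = short_exactD[OF x(2)]
  note S = split_short_exact[OF P D(13)]
  \<comment> \<open>the morphism to the split extension is \<open>m \<rightarrow> Q \<rightarrow> P \<oplus> Q\<close>\<close>
  have "inj2 C P Q \<cdot> (q \<cdot> j) = Zero C K (dsum C P Q)"
    unfolding D(7) using P D by simp
  then have "ext_mor C (Zero C K P) (Id C Q) (j, q) (inj1 C P Q, proj2 C P Q)"
    by (intro ext_morI[OF x(2) S, of "inj2 C P Q \<cdot> q"]) (use P D in simp_all)
  then show ?thesis
    using connecting_class[OF m extensionI[OF S], of "Zero C K P"] P D x(1) by (simp add: Ext1_def)
qed

text \<open>Replacing a cover by a finer one only precomposes with the map of kernels; this is how several classes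
  are brought to a common cover.\<close>

lemma connecting_cover:
  assumes "m \<in> extensions C Q K" "m' \<in> extensions C Q K'" "k \<in> Hom C K' K"
    and "ext_mor C k (Id C Q) m' m" "f \<in> Hom C K P"
  shows "connecting C m f = connecting C m' (f \<cdot> k)"
proof -
  note I = extension_ends[OF assms(1)]
  obtain e where e: "e \<in> extensions C Q P" "ext_mor C f (Id C Q) m e" "connecting C m f = ext_class C e"
    using connectingE[OF assms(1,5)] .
  have "ext_mor C (f \<cdot> k) (Id C Q) m' e"
    using ext_mor_comp[OF assms(4) e(2) assms(2,1) e(1)] assms(3,5) I by simp
  then show ?thesis
    using connecting_class[OF assms(2) e(1)] e(3) assms(3,5) by simp
qed

lemma Ext1_cover1:
  assumes "x \<in> carrier (Ext1 C Q P)"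
  obtains m where "m \<in> extensions C Q P" "x = connecting C m (Id C P)"
proof -
  obtain e where e: "e \<in> extensions C Q P" "x = ext_class C e"
    using assms by (rule Ext1_carrierE)
  then show ?thesis
    using that[OF e(1)] connecting_class[OF e(1,1) _ ext_mor_refl[OF e(1)]] extension_ends[OF e(1)]
    by simp
qed

lemma Ext1_cover2:
  assumes "x \<in> carrier (Ext1 C Q P)" "m' \<in> extensions C Q K'"
  obtains m K f k where "m \<in> extensions C Q K" "f \<in> Hom C K P" "x = connecting C m f"
    "k \<in> Hom C K K'" "ext_mor C k (Id C Q) m m'"
proof -
  obtain e where e: "e \<in> extensions C Q P" "x = ext_class C e"
    using assms(1) by (rule Ext1_carrierE)
  obtain m K f k where m: "m \<in> extensions C Q K" "f \<in> Hom C K P" "k \<in> Hom C K K'"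
    "ext_mor C f (Id C Q) m e" "ext_mor C k (Id C Q) m m'"
    using common_cover[OF e(1) assms(2)] .
  show ?thesis
    using that[OF m(1,2) _ m(3,5)] connecting_class[OF m(1) e(1) m(2,4)] e(2) by simp
qed

text \<open>After the classes involved have been written as \<open>connecting C m f\<close> over one \<open>m\<close>, each axiom is the
  corresponding one for the addition of arrows.\<close>

lemma Ext1_comm_group:
  assumes Q: "Q \<in> Obj C" and P: "P \<in> Obj C"
  shows "comm_group (Ext1 C Q P)"
proof (rule comm_groupI)
  note split = extensionI[OF split_short_exact[OF P Q]]
  show "\<one>\<^bsub>Ext1 C Q P\<^esub> \<in> carrier (Ext1 C Q P)"
    using Ext1_carrierI[OF split] by (simp add: Ext1_def)
  fix x
  assume x: "x \<in> carrier (Ext1 C Q P)"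
  obtain m1 where m1: "m1 \<in> extensions C Q P" "x = connecting C m1 (Id C P)"
    using Ext1_cover1[OF x] .
  have Id: "Id C P \<in> Hom C P P" and Z: "Zero C P P \<in> Hom C P P"
    using P by simp_all
  show "\<one>\<^bsub>Ext1 C Q P\<^esub> \<otimes>\<^bsub>Ext1 C Q P\<^esub> x = x"
    using connecting_Add[OF m1(1) Z Id] connecting_Zero[OF m1(1) P] m1(2) P by simp
  obtain n where "n \<in> Hom C P P" "n \<boxplus> Id C P = Zero C P P"
    using negative_exists[of "Id C P"] P by auto
  then show "\<exists>y\<in>carrier (Ext1 C Q P). y \<otimes>\<^bsub>Ext1 C Q P\<^esub> x = \<one>\<^bsub>Ext1 C Q P\<^esub>"
    using connecting_Add[OF m1(1) _ Id, of n] connecting_Zero[OF m1(1) P] m1(2)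
      connecting_closed[OF m1(1), of n P] by auto
  fix y
  assume y: "y \<in> carrier (Ext1 C Q P)"
  obtain m K g k where m: "m \<in> extensions C Q K" and g: "g \<in> Hom C K P" "y = connecting C m g"
      and k: "k \<in> Hom C K P" "ext_mor C k (Id C Q) m m1"
    using Ext1_cover2[OF y m1(1)] .
  have x_eq: "x = connecting C m k"
    using connecting_cover[OF m1(1) m k Id] m1(2) k(1) by simp
  show "x \<otimes>\<^bsub>Ext1 C Q P\<^esub> y \<in> carrier (Ext1 C Q P)"
    using connecting_Add[OF m k(1) g(1)] connecting_closed[OF m, of "k \<boxplus> g" P] x_eq g k by simp
  show "x \<otimes>\<^bsub>Ext1 C Q P\<^esub> y = y \<otimes>\<^bsub>Ext1 C Q P\<^esub> x"
    using connecting_Add[OF m k(1) g(1)] connecting_Add[OF m g(1) k(1)] Add_commute_Arr[of k g] x_eq g k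
    by simp
  fix z
  assume z: "z \<in> carrier (Ext1 C Q P)"
  obtain m' K' h l where m': "m' \<in> extensions C Q K'" and h: "h \<in> Hom C K' P" "z = connecting C m' h"
      and l: "l \<in> Hom C K' K" "ext_mor C l (Id C Q) m' m"
    using Ext1_cover2[OF z m] .
  have x': "x = connecting C m' (k \<cdot> l)" and y': "y = connecting C m' (g \<cdot> l)"
    using connecting_cover[OF m m' l] x_eq g k by auto
  have H: "k \<cdot> l \<in> Hom C K' P" "g \<cdot> l \<in> Hom C K' P" "k \<cdot> l \<boxplus> g \<cdot> l \<in> Hom C K' P"
      "g \<cdot> l \<boxplus> h \<in> Hom C K' P"
    using g k h l by simp_all
  show "x \<otimes>\<^bsub>Ext1 C Q P\<^esub> y \<otimes>\<^bsub>Ext1 C Q P\<^esub> z = x \<otimes>\<^bsub>Ext1 C Q P\<^esub> (y \<otimes>\<^bsub>Ext1 C Q P\<^esub> z)"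
    unfolding x' y' h(2) connecting_Add[OF m' H(1,2)] connecting_Add[OF m' H(2) h(1)]
      connecting_Add[OF m' H(3) h(1)] connecting_Add[OF m' H(1,4)]
    using Add_assoc_Arr[of "k \<cdot> l" "g \<cdot> l" h] H h by simp
qed

lemma ext_pull_connecting:
  assumes m: "m \<in> extensions C Q K" and m': "m' \<in> extensions C Q' K" and \<psi>: "\<psi> \<in> Hom C Q' Q"
    and mor: "ext_mor C (Id C K) \<psi> m' m" and f: "f \<in> Hom C K P"
  shows "ext_pull C \<psi> (connecting C m f) = connecting C m' f"
proof -
  note I = extension_ends[OF m] extension_ends[OF m']
  obtain e where e: "e \<in> extensions C Q P" "ext_mor C f (Id C Q) m e" "connecting C m f = ext_class C e"
    using connectingE[OF m f] .
  obtain e' where e': "e' \<in> extensions C Q' P" "ext_mor C (Id C P) \<psi> e' e"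
    using ext_pull_exists[OF e(1) \<psi>] .
  have "ext_mor C f (\<psi> \<cdot> Id C Q') m' e"
    using ext_mor_comp[OF mor e(2) m' m e(1)] f \<psi> I by simp
  then have "ext_mor C f (Id C Q') m' e'"
    by (rule ext_mor_factor_pull[OF e'(2) _ e(1) e'(1) m']) (use f \<psi> I in simp_all)
  then show ?thesis
    using connecting_class[OF m' e'(1) f] ext_pull_class[OF e'(2) e(1) e'(1) \<psi>] e(3) by simp
qed

lemma ext_pull_hom:
  assumes \<psi>: "\<psi> \<in> Hom C Q' Q" and P: "P \<in> Obj C"
  shows "group_hom (Ext1 C Q P) (Ext1 C Q' P) (ext_pull C \<psi>)"
proof -
  have "Q \<in> Obj C" "Q' \<in> Obj C"
    using \<psi> by auto
  then interpret A: comm_group "Ext1 C Q P" + B: comm_group "Ext1 C Q' P"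
    using Ext1_comm_group P by simp_all
  show ?thesis
  proof unfold_locales
    show "ext_pull C \<psi> \<in> hom (Ext1 C Q P) (Ext1 C Q' P)"
    proof (rule homI)
      fix x
      assume x: "x \<in> carrier (Ext1 C Q P)"
      obtain e where e: "e \<in> extensions C Q P" "x = connecting C e (Id C P)"
        using Ext1_cover1[OF x] .
      have Id: "Id C P \<in> Hom C P P"
        using P by simp
      obtain e' where e': "e' \<in> extensions C Q' P" "ext_mor C (Id C P) \<psi> e' e"
        using ext_pull_exists[OF e(1) \<psi>] .
      show "ext_pull C \<psi> x \<in> carrier (Ext1 C Q' P)"
        using ext_pull_connecting[OF e(1) e'(1) \<psi> e'(2) Id] e(2) connecting_closed[OF e'(1) Id] by simp
      fix y
      assume y: "y \<in> carrier (Ext1 C Q P)"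
      obtain m K g k where m: "m \<in> extensions C Q K" and g: "g \<in> Hom C K P" "y = connecting C m g"
          and k: "k \<in> Hom C K P" "ext_mor C k (Id C Q) m e"
        using Ext1_cover2[OF y e(1)] .
      have x_eq: "x = connecting C m k"
        using connecting_cover[OF e(1) m k Id] e(2) k(1) by simp
      obtain m' where m': "m' \<in> extensions C Q' K" "ext_mor C (Id C K) \<psi> m' m"
        using ext_pull_exists[OF m \<psi>] .
      have kg: "k \<boxplus> g \<in> Hom C K P"
        using k g by simp
      show "ext_pull C \<psi> (x \<otimes>\<^bsub>Ext1 C Q P\<^esub> y) = ext_pull C \<psi> x \<otimes>\<^bsub>Ext1 C Q' P\<^esub> ext_pull C \<psi> y"
        unfolding x_eq g(2) connecting_Add[OF m k(1) g(1)] ext_pull_connecting[OF m m'(1) \<psi> m'(2) k(1)]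
          ext_pull_connecting[OF m m'(1) \<psi> m'(2) g(1)] ext_pull_connecting[OF m m'(1) \<psi> m'(2) kg]
          connecting_Add[OF m'(1) k(1) g(1)] ..
    qed
  qed
qed

end

section \<open>Exactness\<close>

context abelian_category
begin

lemma ext_pull_eq_class_iff:
  assumes e: "e \<in> extensions C Q P" and e': "e' \<in> extensions C Q' P" and \<psi>: "\<psi> \<in> Hom C Q' Q"
  shows "ext_pull C \<psi> (ext_class C e) = ext_class C e' \<longleftrightarrow> ext_mor C (Id C P) \<psi> e' e"
proof
  assume eq: "ext_pull C \<psi> (ext_class C e) = ext_class C e'"
  note I = extension_ends[OF e] extension_ends[OF e']
  obtain d where d: "d \<in> extensions C Q' P" "ext_mor C (Id C P) \<psi> d e"
    using ext_pull_exists[OF e \<psi>] .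
  have "ext_mor C (Id C P) (Id C Q') e' d"
    using ext_class_eq_iff[OF e' d(1)] ext_pull_class[OF d(2) e d(1) \<psi>] eq by simp
  then show "ext_mor C (Id C P) \<psi> e' e"
    using ext_mor_comp[OF _ d(2) e' d(1) e] \<psi> I by fastforce
qed (rule ext_pull_class[OF _ e e' \<psi>])

lemma connecting_eq_class_iff:
  assumes m: "m \<in> extensions C Q K" and e: "e \<in> extensions C Q P" and f: "f \<in> Hom C K P"
  shows "connecting C m f = ext_class C e \<longleftrightarrow> ext_mor C f (Id C Q) m e"
proof
  assume eq: "connecting C m f = ext_class C e"
  note I = extension_ends[OF m] extension_ends[OF e]
  obtain d where d: "d \<in> extensions C Q P" "ext_mor C f (Id C Q) m d" "connecting C m f = ext_class C d"
    using connectingE[OF m f] .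
  have "ext_mor C (Id C P) (Id C Q) d e"
    using ext_class_eq_iff[OF d(1) e] d(3) eq by simp
  then show "ext_mor C f (Id C Q) m e"
    using ext_mor_comp[OF d(2) _ m d(1) e, of "Id C P" "Id C Q"] f I by simp
qed (rule connecting_class[OF m e f])

text \<open>A pullback splits exactly if the map along which it is formed lifts.\<close>

lemma ext_pull_eq_one_iff:
  assumes e: "short_exact C P i E p Q" and \<psi>: "\<psi> \<in> Hom C V Q"
  shows "ext_pull C \<psi> (ext_class C (i, p)) = \<one>\<^bsub>Ext1 C V P\<^esub> \<longleftrightarrow> (\<exists>h \<in> Hom C V E. p \<cdot> h = \<psi>)"
proof -
  note D = short_exactD[OF e]
  have V: "V \<in> Obj C"
    using \<psi> by auto
  note S = split_short_exact[OF D(11) V]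
  have "ext_pull C \<psi> (ext_class C (i, p)) = \<one>\<^bsub>Ext1 C V P\<^esub> \<longleftrightarrow>
      ext_mor C (Id C P) \<psi> (inj1 C P V, proj2 C P V) (i, p)"
    using ext_pull_eq_class_iff[OF extensionI[OF e] extensionI[OF S] \<psi>] by (simp add: Ext1_def)
  also have "\<dots> \<longleftrightarrow> (\<exists>h \<in> Hom C V E. p \<cdot> h = \<psi>)"
  proof
    assume m: "ext_mor C (Id C P) \<psi> (inj1 C P V, proj2 C P V) (i, p)"
    obtain h where h: "h \<in> Arr C" "Dom C h = dsum C P V" "Cod C h = E" "p \<cdot> h = \<psi> \<cdot> proj2 C P V"
      using ext_mor_pullE[OF m S e] .
    have "p \<cdot> (h \<cdot> inj2 C P V) = \<psi> \<cdot> (proj2 C P V \<cdot> inj2 C P V)"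
      by (rule Comp_eq_extend2[OF h(4)]) (use h(1-3) D V \<psi> in simp_all)
    then show "\<exists>h \<in> Hom C V E. p \<cdot> h = \<psi>"
      using h(1-3) D V \<psi> by (intro bexI[of _ "h \<cdot> inj2 C P V"]) simp_all
  next
    assume "\<exists>h \<in> Hom C V E. p \<cdot> h = \<psi>"
    then obtain h where h: "h \<in> Arr C" "Dom C h = V" "Cod C h = E" "p \<cdot> h = \<psi>"
      by auto
    have "p \<cdot> copair C P V i h = \<psi> \<cdot> proj2 C P V"
      by (rule dsum_coeqI[of _ P V]) (use h D V \<psi> in simp_all)
    then show "ext_mor C (Id C P) \<psi> (inj1 C P V, proj2 C P V) (i, p)"
      by (intro ext_morI[OF S e, of "copair C P V i h"]) (use h(1-3) D V in simp_all)
  qed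
  finally show ?thesis .
qed

text \<open>Exactness at \<open>Ext\<^sup>1(Q, P)\<close>: a lift \<open>h\<close> of \<open>Y \<rightarrow> Q\<close> to the middle term of an extension of \<open>Q\<close>
  restricts to a map of kernels, along which that extension is the pushout.\<close>

lemma ext_pull_kernel:
  assumes y: "short_exact C K j Y \<pi> Q" and P: "P \<in> Obj C"
  shows "kernel (Ext1 C Q P) (Ext1 C Y P) (ext_pull C \<pi>) = connecting C (j, \<pi>) ` Hom C K P"
proof -
  note D = short_exactD[OF y]
  have \<pi>: "\<pi> \<in> Hom C Y Q"
    using D by simp
  note y' = extensionI[OF y]
  have "ext_pull C \<pi> x = \<one>\<^bsub>Ext1 C Y P\<^esub> \<longleftrightarrow> x \<in> connecting C (j, \<pi>) ` Hom C K P"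
    if x: "x \<in> carrier (Ext1 C Q P)" for x
  proof -
    obtain e where e': "e \<in> extensions C Q P" "x = ext_class C e"
      using x by (rule Ext1_carrierE)
    obtain i E p where e: "e = (i, p)" "short_exact C P i E p Q"
      using e'(1) by (rule extensionE)
    note De = short_exactD[OF e(2)]
    have "(\<exists>h \<in> Hom C Y E. p \<cdot> h = \<pi>) \<longleftrightarrow> (\<exists>f \<in> Hom C K P. ext_mor C f (Id C Q) (j, \<pi>) (i, p))"
    proof
      assume "\<exists>h \<in> Hom C Y E. p \<cdot> h = \<pi>"
      then obtain h where h: "h \<in> Arr C" "Dom C h = Y" "Cod C h = E" "p \<cdot> h = \<pi>"
        by auto
      have "p \<cdot> (h \<cdot> j) = \<pi> \<cdot> j"
        by (rule Comp_eq_extend[OF h(4)]) (use h(1-3) D De in simp_all)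
      then obtain f where f: "f \<in> Arr C" "Dom C f = K" "Cod C f = P" "i \<cdot> f = h \<cdot> j"
        using short_exact_lift[OF e(2), of "h \<cdot> j"] h(1-3) D by auto
      have "ext_mor C f (Id C Q) (j, \<pi>) (i, p)"
        by (rule ext_morI[OF y e(2), of h]) (use h f D in simp_all)
      then show "\<exists>f \<in> Hom C K P. ext_mor C f (Id C Q) (j, \<pi>) (i, p)"
        using f by auto
    next
      assume "\<exists>f \<in> Hom C K P. ext_mor C f (Id C Q) (j, \<pi>) (i, p)"
      then obtain f where m: "ext_mor C f (Id C Q) (j, \<pi>) (i, p)"
        by blast
      obtain h where "h \<in> Arr C" "Dom C h = Y" "Cod C h = E" "p \<cdot> h = \<pi>"
        using ext_mor_pushE[OF m y e(2)] .
      then show "\<exists>h \<in> Hom C Y E. p \<cdot> h = \<pi>"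
        by auto
    qed
    moreover have "x \<in> connecting C (j, \<pi>) ` Hom C K P \<longleftrightarrow>
        (\<exists>f \<in> Hom C K P. ext_mor C f (Id C Q) (j, \<pi>) (i, p))"
      unfolding image_iff e'(2) e(1)
      using connecting_eq_class_iff[OF y' e'(1)[unfolded e(1)]] by metis
    ultimately show ?thesis
      using ext_pull_eq_one_iff[OF e(2) \<pi>] unfolding e'(2) e(1) by blast
  qed
  moreover have "connecting C (j, \<pi>) ` Hom C K P \<subseteq> carrier (Ext1 C Q P)"
    using connecting_closed[OF y'] by blast
  ultimately show ?thesis
    unfolding kernel_def by blast
qed

text \<open>Exactness at \<open>Ext\<^sup>1(Y, P)\<close>: a lift \<open>s\<close> of \<open>K \<rightarrow> Y\<close> to \<open>X\<close> is a subobject meeting \<open>P\<close> trivially, and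
  \<open>X / K\<close> is an extension of \<open>Q\<close> by \<open>P\<close> that pulls back to \<open>X\<close>.\<close>

lemma ext_pull_surj:
  assumes y: "short_exact C K j Y \<pi> Q" and x: "short_exact C P i X p Y"
    and s: "s \<in> Hom C K X" "p \<cdot> s = j"
  obtains l where "l \<in> carrier (Ext1 C Q P)" "ext_pull C \<pi> l = ext_class C (i, p)"
proof -
  note D = short_exactD[OF y]
  note Dx = short_exactD[OF x]
  have sA: "s \<in> Arr C" "Dom C s = K" "Cod C s = X"
    using s(1) by simp_all
  have "is_mono C s"
  proof (rule monoI)
    fix t
    assume t: "t \<in> Arr C" "Cod C t = Dom C s" "s \<cdot> t = Zero C (Dom C t) (Cod C s)"
    have "p \<cdot> (s \<cdot> t) = j \<cdot> t"
      by (rule Comp_eq_extend[OF s(2)]) (use t(1,2) sA Dx in simp_all)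
    then show "t = Zero C (Dom C t) (Dom C s)"
      using mono_zero[OF D(8), of t] t sA D Dx by simp
  qed (fact sA)
  moreover obtain c where c: "is_cokernel C c s"
    using cokernel_exists[OF sA(1)] by blast
  ultimately have "is_kernel C s c"
    using cokernel_of_mono by blast
  then have sc: "short_exact C K s X c (Cod C c)"
    using c sA unfolding short_exact_def by (auto simp: is_kernel_def)
  note Dc = short_exactD[OF sc]
  have "\<pi> \<cdot> (p \<cdot> s) = Zero C K Q"
    using s(2) D by simp
  then obtain q where q: "q \<in> Arr C" "Cod C q = Q" "Dom C q = Cod C c" "q \<cdot> c = \<pi> \<cdot> p"
    using short_exact_colift[OF sc, of "\<pi> \<cdot> p"] D Dx sA by auto
  \<comment> \<open>\<open>p\<close> induces the identity on the kernels \<open>K\<close> of \<open>c\<close> and \<open>\<pi>\<close>\<close>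
  have "is_pullback C \<pi> q p c"
    by (rule mor_pullback[OF y sc]) (use q s(2) D Dx Dc in simp_all)
  then have pb: "is_pullback C q \<pi> c p"
    by (rule pullback_sym)
  have ci: "c \<cdot> i \<in> Arr C" "Dom C (c \<cdot> i) = P" "Cod C (c \<cdot> i) = Cod C c"
    using Dc Dx by simp_all
  have "is_mono C (c \<cdot> i)"
  proof (rule monoI)
    fix t
    assume t: "t \<in> Arr C" "Cod C t = Dom C (c \<cdot> i)" "(c \<cdot> i) \<cdot> t = Zero C (Dom C t) (Cod C (c \<cdot> i))"
    have "i \<cdot> t = Zero C (Dom C t) X"
    proof (rule pullback_eqI[OF pb])
      show "c \<cdot> (i \<cdot> t) = c \<cdot> Zero C (Dom C t) X"
        using t Dc Dx by simp
      show "p \<cdot> (i \<cdot> t) = p \<cdot> Zero C (Dom C t) X"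
        using Comp_eq_extend[OF Dx(7), of t] t Dc Dx by simp
    qed (use t Dc Dx in simp_all)
    then show "t = Zero C (Dom C t) (Dom C (c \<cdot> i))"
      using mono_zero[OF Dx(8), of t] t ci Dx Dc by simp
  qed (fact ci)
  then have "is_kernel C (c \<cdot> i) q"
  proof (rule kernelI)
    show "q \<cdot> (c \<cdot> i) = Zero C (Dom C (c \<cdot> i)) (Cod C q)"
      using Comp_eq_extend2[OF q(4), of i] q(1-3) Dc Dx D by simp
    fix t
    assume t: "t \<in> Arr C" "Cod C t = Dom C q" "q \<cdot> t = Zero C (Dom C t) (Cod C q)"
    have "q \<cdot> t = \<pi> \<cdot> Zero C (Dom C t) Y"
      using t D q by simp
    then obtain v where v: "v \<in> Arr C" "Dom C v = Dom C t" "Cod C v = X" "c \<cdot> v = t"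
        "p \<cdot> v = Zero C (Dom C t) Y"
      using pullback_lift_ex[OF pb, of t "Zero C (Dom C t) Y"] t(1,2) q(1-3) D Dc by auto
    obtain w where w: "w \<in> Arr C" "Dom C w = Dom C v" "Cod C w = P" "i \<cdot> w = v"
      using short_exact_lift[OF x v(1,3)] v(2,5) by auto
    have "(c \<cdot> i) \<cdot> w = t"
      using w v(4) Dc Dx by simp
    then show "\<exists>u. u \<in> Arr C \<and> Dom C u = Dom C t \<and> Cod C u = Dom C (c \<cdot> i) \<and> (c \<cdot> i) \<cdot> u = t"
      using w v(2) ci by (intro exI[of _ w]) simp
  qed (use q ci in simp_all)
  moreover have "is_epi C (q \<cdot> c)"
    unfolding q(4) by (rule epi_comp) (use D Dx in simp_all)
  then have "is_epi C q"
    by (rule epi_of_comp) (use q Dc in simp_all)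
  ultimately have l: "short_exact C P (c \<cdot> i) (Cod C c) q Q"
    using short_exactI ci q by simp
  have "ext_mor C (Id C P) \<pi> (i, p) (c \<cdot> i, q)"
    by (rule ext_morI[OF x l, of c]) (use q Dc Dx in simp_all)
  then show ?thesis
    using that[of "ext_class C (c \<cdot> i, q)"] ext_pull_class[OF _ extensionI[OF l] extensionI[OF x]]
      Ext1_carrierI[OF extensionI[OF l]] D by simp
qed

text \<open>The square on \<open>h\<close> and \<open>r\<close> is a pullback, so the kernel \<open>r\<close> of \<open>q\<close> pulls back along \<open>p'\<close> to a
  kernel \<open>h\<close> of the composite.\<close>

lemma mor_short_exact:
  assumes e: "short_exact C P i E p R" and x: "short_exact C P i' X p' Y"
    and r: "short_exact C R r Y q G"
    and h: "h \<in> Arr C" "Dom C h = E" "Cod C h = X" "h \<cdot> i = i'" "p' \<cdot> h = r \<cdot> p"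
  shows "short_exact C E h X (q \<cdot> p') G"
proof -
  note D = short_exactD[OF e]
  note Dx = short_exactD[OF x]
  note Dr = short_exactD[OF r]
  have pb: "is_pullback C p' r h p"
    by (rule mor_pullback[OF x e]) (use h Dr in simp_all)
  have "is_mono C h"
  proof (rule monoI)
    fix t
    assume t: "t \<in> Arr C" "Cod C t = Dom C h" "h \<cdot> t = Zero C (Dom C t) (Cod C h)"
    have "r \<cdot> (p \<cdot> t) = p' \<cdot> (h \<cdot> t)"
      by (rule Comp_eq_extend2[OF h(5)[symmetric]]) (use t(1,2) h(1-3) D Dr Dx in simp_all)
    also have "\<dots> = Zero C (Dom C t) Y"
      unfolding t(3) using t(1) h(3) Dx by simp
    finally have pt: "p \<cdot> t = Zero C (Dom C t) R"
      using mono_zero[OF Dr(8), of "p \<cdot> t"] t(1,2) h D Dr by simp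
    show "t = Zero C (Dom C t) (Dom C h)"
      by (rule pullback_eqI[OF pb]) (use t pt h(1-3) D in simp_all)
  qed fact
  then have "is_kernel C h (q \<cdot> p')"
  proof (rule kernelI)
    have "q \<cdot> (r \<cdot> p) = Zero C R G \<cdot> p"
      by (rule Comp_eq_extend[OF Dr(7)]) (use D Dr in simp_all)
    then show "(q \<cdot> p') \<cdot> h = Zero C (Dom C h) (Cod C (q \<cdot> p'))"
      using h D Dr Dx by simp
    fix t
    assume t: "t \<in> Arr C" "Cod C t = Dom C (q \<cdot> p')" "(q \<cdot> p') \<cdot> t = Zero C (Dom C t) (Cod C (q \<cdot> p'))"
    obtain v where v: "v \<in> Arr C" "Dom C v = Dom C t" "Cod C v = R" "r \<cdot> v = p' \<cdot> t"
      using short_exact_lift[OF r, of "p' \<cdot> t"] t Dr Dx by auto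
    obtain u where "u \<in> Arr C" "Dom C u = Dom C t" "Cod C u = Dom C h" "h \<cdot> u = t"
      using pullback_lift_ex[OF pb, of t v] t(1,2) v Dr Dx by auto
    then show "\<exists>u. u \<in> Arr C \<and> Dom C u = Dom C t \<and> Cod C u = Dom C h \<and> h \<cdot> u = t"
      by blast
  qed (use h Dr Dx in simp_all)
  moreover have "is_epi C (q \<cdot> p')"
    by (rule epi_comp) (use Dr Dx in simp_all)
  ultimately show ?thesis
    using short_exactI h Dr Dx by simp
qed

end

section \<open>Completions\<close>

locale completion_problem = abelian_category C
  for C :: "('o, 'm, 'z) preadditive_category_scheme" (structure) +
  fixes P Q R S E F G H Y :: 'o
    and iE pE iH pH iF pF iG pG yF yG :: 'm
  assumes seqE: "short_exact C P iE E pE R"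
    and seqH: "short_exact C P iH H pH S"
    and seqF: "short_exact C R iF F pF Q"
    and seqG: "short_exact C S iG G pG Q"
    and pb: "is_pullback C pF pG yF yG" and Y: "Dom C yF = Y"
begin

lemmas E_simps [simp] = short_exactD(1-7,11-13)[OF seqE]
lemmas H_simps [simp] = short_exactD(1-7,11-13)[OF seqH]
lemmas F_simps [simp] = short_exactD(1-7,11-13)[OF seqF]
lemmas G_simps [simp] = short_exactD(1-7,11-13)[OF seqG]

lemma Y_simps [simp]:
  "yF \<in> Arr C" "yG \<in> Arr C" "Dom C yF = Y" "Dom C yG = Y" "Cod C yF = F" "Cod C yG = G" "Y \<in> Obj C"
  using pullbackD[OF pb] Y by auto

lemma Y_commute: "pG \<cdot> yG = pF \<cdot> yF"
  using pullbackD(9)[OF pb] by simp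

definition "rY = pullback_lift C yF yG iF (Zero C R G)"

definition "sY = pullback_lift C yF yG (Zero C S F) iG"

lemma rY_simps [simp]:
  "rY \<in> Arr C" "Dom C rY = R" "Cod C rY = Y" "yF \<cdot> rY = iF" "yG \<cdot> rY = Zero C R G"
  unfolding rY_def using pullback_lift_simps[OF pb, of iF "Zero C R G"] by simp_all

lemma sY_simps [simp]:
  "sY \<in> Arr C" "Dom C sY = S" "Cod C sY = Y" "yF \<cdot> sY = Zero C S F" "yG \<cdot> sY = iG"
  unfolding sY_def using pullback_lift_simps[OF pb, of "Zero C S F" iG] by simp_all

lemma rY_exact: "short_exact C R rY Y yG G"
  using pullback_extension[OF seqF pb, of rY] by simp

lemma sY_exact: "short_exact C S sY Y yF F"
  using pullback_extension[OF seqG pullback_sym[OF pb], of sY] by simp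

abbreviation "j \<equiv> copair C R S rY sY"

abbreviation "\<pi> \<equiv> pF \<cdot> yF"

lemma yF_j: "yF \<cdot> j = iF \<cdot> proj1 C R S" and yG_j: "yG \<cdot> j = iG \<cdot> proj2 C R S"
  by (rule dsum_coeqI[of _ R S]; simp)+

text \<open>An arrow into \<open>Y\<close> killed by \<open>\<pi>\<close> has components in \<open>F\<close> and \<open>G\<close> that come from \<open>R\<close> and \<open>S\<close>.\<close>

lemma Y_exact: "short_exact C (dsum C R S) j Y \<pi> Q"
proof (rule short_exactI)
  have "is_mono C j"
  proof (rule monoI)
    fix t
    assume t: "t \<in> Arr C" "Cod C t = Dom C j" "j \<cdot> t = Zero C (Dom C t) (Cod C j)"
    have "iF \<cdot> (proj1 C R S \<cdot> t) = yF \<cdot> (j \<cdot> t)"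
      by (rule Comp_eq_extend2[OF yF_j[symmetric]]) (use t(1,2) in simp_all)
    also have "\<dots> = Zero C (Dom C t) F"
      unfolding t(3) using t(1) by simp
    finally have 1: "proj1 C R S \<cdot> t = Zero C (Dom C t) R"
      using mono_zero[OF short_exactD(8)[OF seqF], of "proj1 C R S \<cdot> t"] t(1,2) by simp
    have "iG \<cdot> (proj2 C R S \<cdot> t) = yG \<cdot> (j \<cdot> t)"
      by (rule Comp_eq_extend2[OF yG_j[symmetric]]) (use t(1,2) in simp_all)
    also have "\<dots> = Zero C (Dom C t) G"
      unfolding t(3) using t(1) by simp
    finally have 2: "proj2 C R S \<cdot> t = Zero C (Dom C t) S"
      using mono_zero[OF short_exactD(8)[OF seqG], of "proj2 C R S \<cdot> t"] t(1,2) by simp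
    show "t = Zero C (Dom C t) (Dom C j)"
      by (rule dsum_eqI[of R S]) (use 1 2 t(1,2) in simp_all)
  qed simp
  then show "is_kernel C j \<pi>"
  proof (rule kernelI)
    have "pF \<cdot> (iF \<cdot> proj1 C R S) = Zero C R Q \<cdot> proj1 C R S"
      by (rule Comp_eq_extend[OF short_exactD(7)[OF seqF]]) simp_all
    then show "\<pi> \<cdot> j = Zero C (Dom C j) (Cod C \<pi>)"
      by (simp add: yF_j)
    fix t
    assume t: "t \<in> Arr C" "Cod C t = Dom C \<pi>" "\<pi> \<cdot> t = Zero C (Dom C t) (Cod C \<pi>)"
    then have "pF \<cdot> (yF \<cdot> t) = Zero C (Dom C t) Q"
      by simp
    then obtain u where u: "u \<in> Arr C" "Dom C u = Dom C t" "Cod C u = R" "iF \<cdot> u = yF \<cdot> t"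
      using short_exact_lift[OF seqF, of "yF \<cdot> t"] t(1,2) by auto
    have "pG \<cdot> (yG \<cdot> t) = pF \<cdot> (yF \<cdot> t)"
      by (rule Comp_eq_extend2[OF Y_commute]) (use t(1,2) in simp_all)
    then have "pG \<cdot> (yG \<cdot> t) = Zero C (Dom C t) Q"
      using t by simp
    then obtain v where v: "v \<in> Arr C" "Dom C v = Dom C t" "Cod C v = S" "iG \<cdot> v = yG \<cdot> t"
      using short_exact_lift[OF seqG, of "yG \<cdot> t"] t(1,2) by auto
    have "j \<cdot> pair C R S u v = t"
    proof (rule pullback_eqI[OF pb])
      show "yF \<cdot> (j \<cdot> pair C R S u v) = yF \<cdot> t"
        using Comp_eq_extend2[OF yF_j, of "pair C R S u v"] u v by simp
      show "yG \<cdot> (j \<cdot> pair C R S u v) = yG \<cdot> t"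
        using Comp_eq_extend2[OF yG_j, of "pair C R S u v"] u v by simp
    qed (use u v t in simp_all)
    then show "\<exists>u. u \<in> Arr C \<and> Dom C u = Dom C t \<and> Cod C u = Dom C j \<and> j \<cdot> u = t"
      using u v by (intro exI[of _ "pair C R S u v"]) simp
  qed simp_all
  show "is_epi C \<pi>"
    by (rule epi_comp) (use short_exactD(9)[OF sY_exact] short_exactD(9)[OF seqF] in simp_all)
qed simp_all

lemma fibre_product_ext_eq: "fibre_product_ext C (iF, pF) (iG, pG) yF yG = (j, \<pi>)"
  by (simp add: fibre_product_ext_def rY_def sY_def)

text \<open>The map \<open>X \<rightarrow> Y\<close> restricts to \<open>E \<rightarrow> R\<close> and induces the identity on the quotients \<open>G\<close>; its kernel and
  cokernel are therefore those of \<open>E \<rightarrow> R\<close>, namely \<open>P\<close> and \<open>0\<close>.\<close>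

lemma completion_extension:
  assumes "is_completion C (iE, pE) (iH, pH) (iF, pF) (iG, pG) X a b c d"
  defines "y \<equiv> pullback_lift C yF yG c d"
  shows "short_exact C P (a \<cdot> iE) X y Y"
    and "ext_mor C (Id C P) rY (iE, pE) (a \<cdot> iE, y)"
    and "ext_mor C (Id C P) sY (iH, pH) (a \<cdot> iE, y)"
proof -
  have col: "short_exact C E a X d G" and row: "short_exact C H b X c F"
    and sq: "a \<cdot> iE = b \<cdot> iH" "c \<cdot> a = iF \<cdot> pE" "d \<cdot> b = iG \<cdot> pH" "pF \<cdot> c = pG \<cdot> d"
    using assms(1) by (auto simp: is_completion_def)
  note Dc = short_exactD[OF col]
  note Dr = short_exactD[OF row]
  have y: "y \<in> Arr C" "Dom C y = X" "Cod C y = Y" "yF \<cdot> y = c" "yG \<cdot> y = d"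
    unfolding y_def using pullback_lift_simps[OF pb, of c d] sq(4) Dc Dr by simp_all
  have ya: "y \<cdot> a = rY \<cdot> pE"
  proof (rule pullback_eqI[OF pb])
    show "yF \<cdot> (y \<cdot> a) = yF \<cdot> (rY \<cdot> pE)"
      using Comp_eq_extend[OF y(4), of a] Comp_eq_extend[OF rY_simps(4), of pE] y(1-3) Dc sq(2) by simp
    show "yG \<cdot> (y \<cdot> a) = yG \<cdot> (rY \<cdot> pE)"
      using Comp_eq_extend[OF y(5), of a] Comp_eq_extend[OF rY_simps(5), of pE] y(1-3) Dc by simp
  qed (use y Dc in simp_all)
  have yb: "y \<cdot> b = sY \<cdot> pH"
  proof (rule pullback_eqI[OF pb])
    show "yF \<cdot> (y \<cdot> b) = yF \<cdot> (sY \<cdot> pH)"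
      using Comp_eq_extend[OF y(4), of b] Comp_eq_extend[OF sY_simps(4), of pH] y(1-3) Dr by simp
    show "yG \<cdot> (y \<cdot> b) = yG \<cdot> (sY \<cdot> pH)"
      using Comp_eq_extend[OF y(5), of b] Comp_eq_extend[OF sY_simps(5), of pH] y(1-3) Dr sq(3) by simp
  qed (use y Dr in simp_all)
  have aiE: "a \<cdot> iE \<in> Arr C" "Dom C (a \<cdot> iE) = P" "Cod C (a \<cdot> iE) = X"
    using Dc by simp_all
  have "is_mono C (a \<cdot> iE)"
  proof (rule monoI)
    fix t
    assume t: "t \<in> Arr C" "Cod C t = Dom C (a \<cdot> iE)" "(a \<cdot> iE) \<cdot> t = Zero C (Dom C t) (Cod C (a \<cdot> iE))"
    have "iE \<cdot> t = Zero C (Dom C t) E"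
      using mono_zero[OF Dc(8), of "iE \<cdot> t"] t aiE Dc by simp
    then show "t = Zero C (Dom C t) (Dom C (a \<cdot> iE))"
      using mono_zero[OF short_exactD(8)[OF seqE], of t] t(1,2) aiE by simp
  qed fact
  then have "is_kernel C (a \<cdot> iE) y"
  proof (rule kernelI)
    have "y \<cdot> (a \<cdot> iE) = rY \<cdot> (pE \<cdot> iE)"
      by (rule Comp_eq_extend2[OF ya]) (use y(1-3) Dc in simp_all)
    then show "y \<cdot> (a \<cdot> iE) = Zero C (Dom C (a \<cdot> iE)) (Cod C y)"
      using aiE y by simp
    fix t
    assume t: "t \<in> Arr C" "Cod C t = Dom C y" "y \<cdot> t = Zero C (Dom C t) (Cod C y)"
    have "d \<cdot> t = Zero C (Dom C t) G"
      using Comp_eq_extend[OF y(5), of t] y(1-3) t by simp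
    then obtain u where u: "u \<in> Arr C" "Dom C u = Dom C t" "Cod C u = E" "a \<cdot> u = t"
      using short_exact_lift[OF col, of t] t(1,2) y(2) by auto
    have "rY \<cdot> (pE \<cdot> u) = y \<cdot> (a \<cdot> u)"
      by (rule Comp_eq_extend2[OF ya[symmetric]]) (use u(1-3) y(1-3) Dc in simp_all)
    then have "pE \<cdot> u = Zero C (Dom C u) R"
      using mono_zero[OF short_exactD(8)[OF rY_exact], of "pE \<cdot> u"] u t(3) y(3) by simp
    then obtain v where v: "v \<in> Arr C" "Dom C v = Dom C u" "Cod C v = P" "iE \<cdot> v = u"
      using short_exact_lift[OF seqE, of u] u(1-3) by auto
    have "(a \<cdot> iE) \<cdot> v = t"
      using v u(4) Dc by simp
    then show "\<exists>u. u \<in> Arr C \<and> Dom C u = Dom C t \<and> Cod C u = Dom C (a \<cdot> iE) \<and> (a \<cdot> iE) \<cdot> u = t"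
      using v u(2) aiE by (intro exI[of _ v]) simp
  qed (use y aiE in simp_all)
  moreover have "is_epi C y"
  proof (rule epiI)
    fix w
    assume w: "w \<in> Arr C" "Dom C w = Cod C y" "w \<cdot> y = Zero C (Dom C y) (Cod C w)"
    have "w \<cdot> (rY \<cdot> pE) = Zero C (Dom C y) (Cod C w) \<cdot> a"
      unfolding ya[symmetric] by (rule Comp_eq_extend[OF w(3)]) (use w(1,2) y(1-3) Dc in simp_all)
    then have "w \<cdot> rY = Zero C R (Cod C w)"
      using epi_zero[OF short_exactD(9)[OF seqE], of "w \<cdot> rY"] w(1,2) y(1-3) Dc by simp
    then obtain v where v: "v \<in> Arr C" "Cod C v = Cod C w" "Dom C v = G" "v \<cdot> yG = w"
      using short_exact_colift[OF rY_exact, of w] w(1,2) y(3) by auto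
    have "v \<cdot> (yG \<cdot> y) = w \<cdot> y"
      by (rule Comp_eq_extend[OF v(4)]) (use v(1-3) y(1-3) in simp_all)
    then have vd: "v \<cdot> d = Zero C X (Cod C v)"
      using w(3) v(2) y(2,5) by simp
    have "v = Zero C (Cod C d) (Cod C v)"
      by (rule epi_zero[OF Dc(9)]) (use v(1-3) vd Dc in simp_all)
    then have "v = Zero C G (Cod C w)"
      using v(2) Dc(6) by metis
    then have "w = Zero C G (Cod C w) \<cdot> yG"
      using v(4) by metis
    also have "\<dots> = Zero C (Cod C y) (Cod C w)"
      using w(1) y(3) by simp
    finally show "w = Zero C (Cod C y) (Cod C w)" .
  qed fact
  ultimately show x: "short_exact C P (a \<cdot> iE) X y Y"
    using short_exactI aiE y by simp
  show "ext_mor C (Id C P) rY (iE, pE) (a \<cdot> iE, y)"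
    by (rule ext_morI[OF seqE x, of a]) (use ya Dc in simp_all)
  show "ext_mor C (Id C P) sY (iH, pH) (a \<cdot> iE, y)"
    by (rule ext_morI[OF seqH x, of b]) (use yb sq(1) Dr aiE in simp_all)
qed

lemma extension_completion:
  assumes x: "short_exact C P i X p Y"
    and E: "ext_mor C (Id C P) rY (iE, pE) (i, p)" and H: "ext_mor C (Id C P) sY (iH, pH) (i, p)"
  shows "ext_class C (i, p) \<in> completion_classes C (iE, pE) (iH, pH) (iF, pF) (iG, pG) yF yG"
proof -
  note D = short_exactD[OF x]
  obtain a where a: "a \<in> Arr C" "Dom C a = E" "Cod C a = X" "a \<cdot> iE = i" "p \<cdot> a = rY \<cdot> pE"
    using ext_mor_pullE[OF E seqE x] .
  obtain b where b: "b \<in> Arr C" "Dom C b = H" "Cod C b = X" "b \<cdot> iH = i" "p \<cdot> b = sY \<cdot> pH"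
    using ext_mor_pullE[OF H seqH x] .
  have "short_exact C E a X (yG \<cdot> p) G" "short_exact C H b X (yF \<cdot> p) F"
    using mor_short_exact[OF seqE x rY_exact a] mor_short_exact[OF seqH x sY_exact b] .
  moreover have "(yF \<cdot> p) \<cdot> a = iF \<cdot> pE" "(yG \<cdot> p) \<cdot> b = iG \<cdot> pH"
    using Comp_eq_extend[OF rY_simps(4), of pE] Comp_eq_extend[OF sY_simps(5), of pH] a b D by simp_all
  moreover have "pF \<cdot> (yF \<cdot> p) = pG \<cdot> (yG \<cdot> p)"
    by (rule Comp_eq_extend2[OF Y_commute[symmetric]]) (use D in simp_all)
  ultimately have "is_completion C (iE, pE) (iH, pH) (iF, pF) (iG, pG) X a b (yF \<cdot> p) (yG \<cdot> p)"
    using a(4) b(4) by (simp add: is_completion_def)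
  moreover have "pullback_lift C yF yG (yF \<cdot> p) (yG \<cdot> p) = p"
    using pullback_lift_eq[OF pb, of p] D by simp
  ultimately show ?thesis
    unfolding completion_classes_def using a(4) by force
qed

lemma completion_classes_eq:
  "completion_classes C (iE, pE) (iH, pH) (iF, pF) (iG, pG) yF yG =
    {x \<in> carrier (Ext1 C Y P). ext_pull C rY x = ext_class C (iE, pE) \<and>
      ext_pull C sY x = ext_class C (iH, pH)}" (is "?S = ?T")
proof -
  have rs: "rY \<in> Hom C R Y" "sY \<in> Hom C S Y"
    by simp_all
  note eE = extensionI[OF seqE] and eH = extensionI[OF seqH]
  show ?thesis
  proof (intro equalityI subsetI)
    fix x
    assume "x \<in> ?S"
    then obtain X a b c d where x: "x = ext_class C (a \<cdot> iE, pullback_lift C yF yG c d)"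
        and compl: "is_completion C (iE, pE) (iH, pH) (iF, pF) (iG, pG) X a b c d"
      by (auto simp: completion_classes_def)
    note K = completion_extension[OF compl]
    note e = extensionI[OF K(1)]
    show "x \<in> ?T"
      using x Ext1_carrierI[OF e] ext_pull_class[OF K(2) e eE rs(1)] ext_pull_class[OF K(3) e eH rs(2)]
      by simp
  next
    fix x
    assume x: "x \<in> ?T"
    then obtain e where e: "e \<in> extensions C Y P" "x = ext_class C e"
      by (auto elim: Ext1_carrierE)
    obtain i X p where ip: "e = (i, p)" "short_exact C P i X p Y"
      using e(1) by (rule extensionE)
    show "x \<in> ?S"
      using x extension_completion[OF ip(2)] ext_pull_eq_class_iff[OF e(1) eE rs(1)]
        ext_pull_eq_class_iff[OF e(1) eH rs(2)] unfolding e(2) ip(1) by blast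
  qed
qed

text \<open>The composites \<open>R \<rightarrow> Y \<rightarrow> Q\<close> and \<open>S \<rightarrow> Y \<rightarrow> Q\<close> vanish, so classes pulled back from \<open>Q\<close> restrict to zero.\<close>

lemma pull_from_Q_trivial:
  assumes l: "l \<in> carrier (Ext1 C Q P)" and v: "v \<in> Hom C V Y" "\<pi> \<cdot> v = Zero C V Q"
  shows "ext_pull C v (ext_pull C \<pi> l) = \<one>\<^bsub>Ext1 C V P\<^esub>"
proof -
  have \<pi>: "\<pi> \<in> Hom C Y Q" and V: "V \<in> Obj C"
    using v by auto
  obtain e where e: "e \<in> extensions C Q P" "l = ext_class C e"
    using l by (rule Ext1_carrierE)
  obtain i L p where ip: "e = (i, p)" "short_exact C P i L p Q"
    using e(1) by (rule extensionE)
  note D = short_exactD[OF ip(2)]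
  obtain e' where e': "e' \<in> extensions C Y P" "ext_mor C (Id C P) \<pi> e' e"
    using ext_pull_exists[OF e(1) \<pi>] .
  obtain i' M p' where ip': "e' = (i', p')" "short_exact C P i' M p' Y"
    using e'(1) by (rule extensionE)
  note D' = short_exactD[OF ip'(2)]
  obtain h where h: "h \<in> Arr C" "Dom C h = M" "Cod C h = L" "h \<cdot> i' = i" "p \<cdot> h = \<pi> \<cdot> p'"
    using ext_mor_pullE[OF e'(2)[unfolded ip ip'] ip'(2) ip(2)] .
  have pb': "is_pullback C p \<pi> h p'"
    by (rule mor_pullback[OF ip(2) ip'(2)]) (use h in simp_all)
  have "p \<cdot> Zero C V L = \<pi> \<cdot> v"
    unfolding v(2) using D V by simp
  then obtain u where "u \<in> Arr C" "Dom C u = V" "Cod C u = M" "p' \<cdot> u = v"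
    using pullback_lift_ex[OF pb', of "Zero C V L" v] v(1) V D h(1-3) by auto
  then have "ext_pull C v (ext_class C e') = \<one>\<^bsub>Ext1 C V P\<^esub>"
    using ext_pull_eq_one_iff[OF ip'(2) v(1)] unfolding ip'(1) by auto
  then show ?thesis
    using ext_pull_class[OF e'(2) e(1) e'(1) \<pi>] e(2) by simp
qed

text \<open>Conversely, trivial restrictions to \<open>R\<close> and \<open>S\<close> are lifts of the two maps to the extension, which
  combine to a lift of \<open>R \<oplus> S \<rightarrow> Y\<close>.\<close>

lemma trivial_restrictions_from_Q:
  assumes x: "x \<in> carrier (Ext1 C Y P)"
    and R: "ext_pull C rY x = \<one>\<^bsub>Ext1 C R P\<^esub>" and S: "ext_pull C sY x = \<one>\<^bsub>Ext1 C S P\<^esub>"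
  obtains l where "l \<in> carrier (Ext1 C Q P)" "ext_pull C \<pi> l = x"
proof -
  obtain e where e: "e \<in> extensions C Y P" "x = ext_class C e"
    using x by (rule Ext1_carrierE)
  obtain i X p where ip: "e = (i, p)" "short_exact C P i X p Y"
    using e(1) by (rule extensionE)
  note D = short_exactD[OF ip(2)]
  obtain h where h: "h \<in> Arr C" "Dom C h = R" "Cod C h = X" "p \<cdot> h = rY"
    using ext_pull_eq_one_iff[OF ip(2), of rY R] R unfolding e(2) ip(1) by auto
  obtain k where k: "k \<in> Arr C" "Dom C k = S" "Cod C k = X" "p \<cdot> k = sY"
    using ext_pull_eq_one_iff[OF ip(2), of sY S] S unfolding e(2) ip(1) by auto
  have "p \<cdot> copair C R S h k = j"
    by (rule dsum_coeqI[of _ R S]) (use h k D in simp_all)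
  then show ?thesis
    using ext_pull_surj[OF Y_exact ip(2), of "copair C R S h k"] that h k e(2) ip(1) by auto
qed

text \<open>The extensions \<open>F\<close> and \<open>G\<close> of \<open>Q\<close> are both covered by \<open>Y\<close>, via the projections of \<open>R \<oplus> S\<close>; over \<open>Y\<close> the
  sum of the two connecting maps is evaluation at \<open>f + g : R \<oplus> S \<rightarrow> P\<close>.\<close>

lemma image_connecting_sum:
  "{connecting C (iF, pF) f \<otimes>\<^bsub>Ext1 C Q P\<^esub> connecting C (iG, pG) g | f g. f \<in> Hom C R P \<and> g \<in> Hom C S P}
    = connecting C (j, \<pi>) ` Hom C (dsum C R S) P" (is "?N = ?I")
proof -
  note y = extensionI[OF Y_exact]
  have mF: "ext_mor C (proj1 C R S) (Id C Q) (j, \<pi>) (iF, pF)"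
    by (rule ext_morI[OF Y_exact seqF, of yF]) (simp_all add: yF_j)
  have mG: "ext_mor C (proj2 C R S) (Id C Q) (j, \<pi>) (iG, pG)"
    by (rule ext_morI[OF Y_exact seqG, of yG]) (simp_all add: yG_j Y_commute)
  have sum: "connecting C (iF, pF) f \<otimes>\<^bsub>Ext1 C Q P\<^esub> connecting C (iG, pG) g =
      connecting C (j, \<pi>) (copair C R S f g)" if f: "f \<in> Hom C R P" and g: "g \<in> Hom C S P" for f g
  proof -
    have fg: "f \<cdot> proj1 C R S \<in> Hom C (dsum C R S) P" "g \<cdot> proj2 C R S \<in> Hom C (dsum C R S) P"
      using f g by simp_all
    show ?thesis
      using connecting_cover[OF extensionI[OF seqF] y _ mF f] connecting_cover[OF extensionI[OF seqG] y _ mG g]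
        connecting_Add[OF y fg] by (simp add: copair_def)
  qed
  show ?thesis
  proof (intro equalityI subsetI)
    fix x
    assume "x \<in> ?N"
    then obtain f g where f: "f \<in> Hom C R P" and g: "g \<in> Hom C S P"
        and x: "x = connecting C (j, \<pi>) (copair C R S f g)"
      using sum by auto
    have "copair C R S f g \<in> Hom C (dsum C R S) P"
      using f g by simp
    then show "x \<in> ?I"
      using x by blast
  next
    fix x
    assume "x \<in> ?I"
    then obtain k where k: "k \<in> Hom C (dsum C R S) P" and x: "x = connecting C (j, \<pi>) k"
      by blast
    let ?f = "k \<cdot> inj1 C R S" and ?g = "k \<cdot> inj2 C R S"
    have fg: "?f \<in> Hom C R P" "?g \<in> Hom C S P"
      using k by simp_all
    have "copair C R S ?f ?g = k"
      by (rule dsum_coeqI[of _ R S]) (use k in simp_all)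
    then have "x = connecting C (iF, pF) ?f \<otimes>\<^bsub>Ext1 C Q P\<^esub> connecting C (iG, pG) ?g"
      using sum[OF fg] x by simp
    then show "x \<in> ?N"
      using fg by blast
  qed
qed

end

section \<open>Torsors under the quotient by a kernel\<close>

lemma (in group_hom) kernel_coset:
  assumes "l \<in> carrier G"
  shows "kernel G H h #> l = {z \<in> carrier G. h z = h l}"
proof (intro equalityI subsetI)
  fix z
  assume "z \<in> kernel G H h #> l"
  then show "z \<in> {z \<in> carrier G. h z = h l}"
    using assms by (auto simp: r_coset_def kernel_def)
next
  fix z
  assume z: "z \<in> {z \<in> carrier G. h z = h l}"
  then have "z \<otimes> inv l \<in> kernel G H h" "z = z \<otimes> inv l \<otimes> l"
    using assms by (auto simp: kernel_def G.m_assoc)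
  then show "z \<in> kernel G H h #> l"
    unfolding r_coset_def by blast
qed

text \<open>The hypotheses say that \<open>T\<close> is a coset of the image of \<open>h\<close>, on which \<open>G\<close> acts by translation; the
  stabilisers are all equal to the kernel.\<close>

lemma (in group_hom) principal_homogeneous_space_coset:
  assumes T: "T \<subseteq> carrier H" "T \<noteq> {}"
    and closed: "\<And>l x. l \<in> carrier G \<Longrightarrow> x \<in> T \<Longrightarrow> h l \<otimes>\<^bsub>H\<^esub> x \<in> T"
    and trans: "\<And>x y. x \<in> T \<Longrightarrow> y \<in> T \<Longrightarrow> \<exists>l\<in>carrier G. h l \<otimes>\<^bsub>H\<^esub> x = y"
  shows "\<exists>act. principal_homogeneous_space (G Mod kernel G H h) T act
    \<and> (\<forall>l \<in> carrier G. \<forall>x \<in> T. act (kernel G H h #> l) x = h l \<otimes>\<^bsub>H\<^esub> x)"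
proof -
  let ?N = "kernel G H h"
  let ?Q = "G Mod ?N"
  interpret N: normal ?N G
    by (rule normal_kernel)
  \<comment> \<open>\<open>h\<close> is constant on a coset \<open>c\<close> of its kernel, so \<open>h ` c\<close> is a singleton\<close>
  define act where "act c = (\<lambda>x\<in>T. the_elem (h ` c) \<otimes>\<^bsub>H\<^esub> x)" for c
  have act: "act (?N #> l) x = h l \<otimes>\<^bsub>H\<^esub> x" if "l \<in> carrier G" "x \<in> T" for l x
  proof -
    have "h ` (?N #> l) = {h l}"
      using kernel_coset[OF that(1)] that(1) by auto
    then show ?thesis
      using that(2) by (simp add: act_def)
  qed
  have ext: "act c \<in> extensional T" for c
    by (simp add: act_def)
  have carrier_Q: "\<exists>l\<in>carrier G. c = ?N #> l" if "c \<in> carrier ?Q" for c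
    using that by (auto simp: FactGroup_def RCOSETS_def)
  have cancel: "h l = h l'" if "h l \<otimes>\<^bsub>H\<^esub> x = h l' \<otimes>\<^bsub>H\<^esub> x" "x \<in> T" "l \<in> carrier G" "l' \<in> carrier G" for l l' x
  proof -
    have "x \<in> carrier H" "h l \<in> carrier H" "h l' \<in> carrier H"
      using that T(1) by auto
    then show ?thesis
      using that(1) by simp
  qed
  have bij: "act c \<in> Bij T" if c: "c \<in> carrier ?Q" for c
  proof -
    obtain l where l: "l \<in> carrier G" "c = ?N #> l"
      using carrier_Q[OF c] by blast
    have "inj_on (act c) T"
    proof (rule inj_onI)
      fix x y
      assume xy: "x \<in> T" "y \<in> T" "act c x = act c y"
      then have "h l \<otimes>\<^bsub>H\<^esub> x = h l \<otimes>\<^bsub>H\<^esub> y" "x \<in> carrier H" "y \<in> carrier H"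
        using act[OF l(1)] l(2) T(1) by auto
      then show "x = y"
        using l(1) H.Units_l_cancel[of "h l" x y] by (simp add: H.Units_eq)
    qed
    moreover have "act c ` T = T"
    proof (intro equalityI subsetI)
      fix y
      assume y: "y \<in> T"
      have "act c (h (inv l) \<otimes>\<^bsub>H\<^esub> y) = y"
        using act[OF l(1) closed[of "inv l" y]] l y T(1) by (auto simp: H.m_assoc[symmetric])
      moreover have "h (inv l) \<otimes>\<^bsub>H\<^esub> y \<in> T"
        using closed l(1) y by blast
      ultimately show "y \<in> act c ` T"
        by (metis imageI)
    qed (use act[OF l(1)] closed l in auto)
    ultimately show ?thesis
      using ext by (simp add: Bij_def bij_betw_def)
  qed
  have "group_action ?Q T act"
    unfolding group_action_def
  proof (intro group_hom.intro group_hom_axioms.intro homI)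
    show "group ?Q"
      by (rule N.factorgroup_is_group)
    show "group (BijGroup T)"
      by (rule group_BijGroup)
    show "act c \<in> carrier (BijGroup T)" if "c \<in> carrier ?Q" for c
      using bij[OF that] by (simp add: BijGroup_def)
    fix c c'
    assume c: "c \<in> carrier ?Q" "c' \<in> carrier ?Q"
    obtain l l' where l: "l \<in> carrier G" "c = ?N #> l" and l': "l' \<in> carrier G" "c' = ?N #> l'"
      using carrier_Q c by blast
    have "c \<otimes>\<^bsub>?Q\<^esub> c' = ?N #> (l \<otimes> l')"
      using N.rcos_sum[OF l(1) l'(1)] l(2) l'(2) by (simp add: FactGroup_def)
    moreover have "act (?N #> (l \<otimes> l')) = compose T (act c) (act c')"
    proof (rule extensionalityI[OF ext])
      fix x
      assume x: "x \<in> T"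
      show "act (?N #> (l \<otimes> l')) x = compose T (act c) (act c') x"
        using act[of "l \<otimes> l'" x] act[OF l'(1) x] act[OF l(1) closed[OF l'(1) x]] x l l' T(1)
        by (auto simp: compose_eq H.m_assoc)
    qed (simp add: compose_extensional)
    ultimately show "act (c \<otimes>\<^bsub>?Q\<^esub> c') = act c \<otimes>\<^bsub>BijGroup T\<^esub> act c'"
      using bij c by (simp add: BijGroup_def)
  qed
  moreover have "\<exists>!c. c \<in> carrier ?Q \<and> act c x = y" if x: "x \<in> T" and y: "y \<in> T" for x y
  proof -
    obtain l where l: "l \<in> carrier G" "h l \<otimes>\<^bsub>H\<^esub> x = y"
      using trans[OF x y] by blast
    show ?thesis
    proof (rule ex1I[of _ "?N #> l"])
      show "?N #> l \<in> carrier ?Q \<and> act (?N #> l) x = y"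
        using act[OF l(1) x] l by (auto simp: FactGroup_def RCOSETS_def)
      fix c
      assume c: "c \<in> carrier ?Q \<and> act c x = y"
      then obtain l' where l': "l' \<in> carrier G" "c = ?N #> l'"
        using carrier_Q by blast
      have "h l' = h l"
        using cancel[OF _ x l'(1) l(1)] act[OF l'(1) x] c l'(2) l(2) by simp
      then show "c = ?N #> l"
        using kernel_coset l(1) l' by simp
    qed
  qed
  ultimately show ?thesis
    using act T(2) unfolding principal_homogeneous_space_def by blast
qed

section \<open>The torsor of completion classes\<close>

theorem mainTheorem2:
  fixes C :: "('o, 'm, 'z) preadditive_category_scheme"
    and P Q R S E F G H Y :: 'o
    and iE pE iH pH iF pF iG pG yF yG :: 'm
  assumes "abelian_category C"
    and "short_exact C P iE E pE R"
    and "short_exact C P iH H pH S"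
    and "short_exact C R iF F pF Q"
    and "short_exact C S iG G pG Q"
    and "is_pullback C pF pG yF yG" and "Dom C yF = Y"
  defines "\<S> \<equiv> completion_classes C (iE, pE) (iH, pH) (iF, pF) (iG, pG) yF yG"
    and "\<delta>F \<equiv> connecting C (iF, pF)"
    and "\<delta>G \<equiv> connecting C (iG, pG)"
    and "\<alpha> \<equiv> connecting C (fibre_product_ext C (iF, pF) (iG, pG) yF yG)"
    and "\<beta> \<equiv> ext_pull C (pF \<cdot>\<^bsub>C\<^esub> yF)"
  defines "N \<equiv> {\<delta>F f \<otimes>\<^bsub>Ext1 C Q P\<^esub> \<delta>G g | f g. f \<in> Hom C R P \<and> g \<in> Hom C S P}"
  assumes "\<S> \<noteq> {}"
  shows "\<S> \<subseteq> carrier (Ext1 C Y P)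
    \<and> comm_group (Ext1 C Q P Mod N)
    \<and> (\<exists>act. principal_homogeneous_space (Ext1 C Q P Mod N) \<S> act
          \<and> (\<forall>l \<in> carrier (Ext1 C Q P). \<forall>\<xi> \<in> \<S>.
                act (N #>\<^bsub>Ext1 C Q P\<^esub> l) \<xi> = \<beta> l \<otimes>\<^bsub>Ext1 C Y P\<^esub> \<xi>))
    \<and> (\<alpha> ` Hom C (dsum C R S) P = carrier (Ext1 C Q P) \<longrightarrow> (\<exists>!\<xi>. \<xi> \<in> \<S>))"
proof -
  interpret completion_problem C P Q R S E F G H Y iE pE iH pH iF pF iG pG yF yG
    using assms by (simp add: completion_problem_def completion_problem_axioms_def)
  interpret A: comm_group "Ext1 C Q P"
    by (rule Ext1_comm_group) simp_all
  interpret B: comm_group "Ext1 C Y P"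
    by (rule Ext1_comm_group) simp_all
  interpret \<beta>: group_hom "Ext1 C Q P" "Ext1 C Y P" \<beta>
    unfolding \<beta>_def by (rule ext_pull_hom) simp_all
  interpret \<rho>: group_hom "Ext1 C Y P" "Ext1 C R P" "ext_pull C rY"
    by (rule ext_pull_hom) simp_all
  interpret \<sigma>: group_hom "Ext1 C Y P" "Ext1 C S P" "ext_pull C sY"
    by (rule ext_pull_hom) simp_all
  have S_iff: "\<xi> \<in> \<S> \<longleftrightarrow> \<xi> \<in> carrier (Ext1 C Y P) \<and> ext_pull C rY \<xi> = ext_class C (iE, pE) \<and>
      ext_pull C sY \<xi> = ext_class C (iH, pH)" for \<xi>
    unfolding \<S>_def completion_classes_eq by simp
  have \<alpha>: "\<alpha> ` Hom C (dsum C R S) P = N"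
    unfolding \<alpha>_def N_def \<delta>F_def \<delta>G_def image_connecting_sum fibre_product_ext_eq ..
  have N: "N = kernel (Ext1 C Q P) (Ext1 C Y P) \<beta>"
    unfolding N_def \<delta>F_def \<delta>G_def image_connecting_sum \<beta>_def
    by (rule ext_pull_kernel[OF Y_exact, symmetric]) simp
  have zero: "\<pi> \<cdot>\<^bsub>C\<^esub> rY = Zero C R Q" "\<pi> \<cdot>\<^bsub>C\<^esub> sY = Zero C S Q"
    by simp_all
  have closed: "\<beta> l \<otimes>\<^bsub>Ext1 C Y P\<^esub> \<xi> \<in> \<S>" if l: "l \<in> carrier (Ext1 C Q P)" and \<xi>: "\<xi> \<in> \<S>" for l \<xi>
  proof -
    have "ext_pull C rY (\<beta> l) = \<one>\<^bsub>Ext1 C R P\<^esub>" "ext_pull C sY (\<beta> l) = \<one>\<^bsub>Ext1 C S P\<^esub>"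
      unfolding \<beta>_def using pull_from_Q_trivial[OF l] zero by simp_all
    then show ?thesis
      using \<xi> l \<rho>.hom_closed[of \<xi>] \<sigma>.hom_closed[of \<xi>] unfolding S_iff by simp
  qed
  have trans: "\<exists>l\<in>carrier (Ext1 C Q P). \<beta> l \<otimes>\<^bsub>Ext1 C Y P\<^esub> \<xi> = \<eta>" if \<xi>: "\<xi> \<in> \<S>" and \<eta>: "\<eta> \<in> \<S>" for \<xi> \<eta>
  proof -
    let ?d = "\<eta> \<otimes>\<^bsub>Ext1 C Y P\<^esub> inv\<^bsub>Ext1 C Y P\<^esub> \<xi>"
    have c: "\<xi> \<in> carrier (Ext1 C Y P)" "\<eta> \<in> carrier (Ext1 C Y P)"
      using \<xi> \<eta> S_iff by auto
    have "ext_pull C rY ?d = \<one>\<^bsub>Ext1 C R P\<^esub>" "ext_pull C sY ?d = \<one>\<^bsub>Ext1 C S P\<^esub>"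
      using \<xi> \<eta> c \<rho>.hom_closed[of \<xi>] \<sigma>.hom_closed[of \<xi>] unfolding S_iff by simp_all
    then obtain l where l: "l \<in> carrier (Ext1 C Q P)" "\<beta> l = ?d"
      using trivial_restrictions_from_Q[of ?d] c unfolding \<beta>_def by auto
    then show ?thesis
      using c by (intro bexI[of _ l]) (simp_all add: B.m_assoc)
  qed
  have sub: "\<S> \<subseteq> carrier (Ext1 C Y P)"
    using S_iff by blast
  moreover have "comm_group (Ext1 C Q P Mod N)"
    unfolding N using A.abelian_FactGroup[OF \<beta>.subgroup_kernel] .
  moreover have "\<exists>act. principal_homogeneous_space (Ext1 C Q P Mod N) \<S> act
          \<and> (\<forall>l \<in> carrier (Ext1 C Q P). \<forall>\<xi> \<in> \<S>.
                act (N #>\<^bsub>Ext1 C Q P\<^esub> l) \<xi> = \<beta> l \<otimes>\<^bsub>Ext1 C Y P\<^esub> \<xi>)"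
    unfolding N using \<beta>.principal_homogeneous_space_coset[OF sub \<open>\<S> \<noteq> {}\<close> closed trans] .
  moreover have "\<exists>!\<xi>. \<xi> \<in> \<S>" if surj: "\<alpha> ` Hom C (dsum C R S) P = carrier (Ext1 C Q P)"
  proof -
    have "\<beta> l = \<one>\<^bsub>Ext1 C Y P\<^esub>" if "l \<in> carrier (Ext1 C Q P)" for l
      using that surj unfolding \<alpha> N kernel_def by blast
    then have "\<xi> = \<eta>" if "\<xi> \<in> \<S>" "\<eta> \<in> \<S>" for \<xi> \<eta>
      using trans[OF that] that sub by force
    then show ?thesis
      using \<open>\<S> \<noteq> {}\<close> by blast
  qed
  ultimately show ?thesis
    by blast
qed

end
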